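(* Let $\langle E,\#,\vdash\rangle$ be a (live) connected event structure and let $\mathcal{G}_E$ be the graph grammar constructed from it as described in the context. Then $E$ and $\mathcal{E}(\mathrm{Dom}(\mathcal{G}_E))$ are isomorphic event structures.
   Context: Event structures: $\langle E,\vdash,\#\rangle$, $\vdash\subseteq\mathcal{P}_{fin}(E)\times E$ upward closed in the first argument, $\#$ a binary relation; consistent = no two elements in conflict; a configuration is a consistent $C$ such that each $e\in C$ has $e_1,\dots,e_n=e$ in $C$ with $\{e_1,\dots,e_{k-1}\}\vdash e_k$; live: events not jointly contained in a configuration are in conflict and $\neg(e\#e)$. $C\vdash_0 e$: $C$ a configuration, $C\vdash e$, and no configuration $C'\subseteq C$ with $C'\vdash e$ other than $C$. Connected: any two $C\vdash_0 e$, $C'\vdash_0 e$ are linked by a chain of minimal enablings of $e$, consecutive ones $C_1,C_2$ having $C_1\cup C_2\cup\{e\}$ consistent. Isomorphism of ES: bijection preserving and reflecting $\#$ and $\vdash$. Construction of $\mathcal{G}_E$. For $e\in E$ let $U_e=\prod\{X\mid X\vdash_0 e\}$; an element $u\in U_e$ picks one event from each minimal enabling of $e$, and $e'$ occurs in $u$ if it is a component of $u$. Type graph $T$: for each $e$ a node $i_e$; for each $e$ a node (typed) $e$ with a loop labelled $e$ and a loop labelled $u$ for each $u\in U_e$; for each pair $e\#e'$ a node $e\#e'$. Basic graphs (typed by labels): $I_e$ = single node $i_e$; $S_e$ = single node $e$ with loop $e$; $L_{u,e}$ = single node $e$ with loop $u$; $C_{e,e'}$ = single node $e\#e'$. $S_e\cup\bigcup_{u\in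 U_e}L_{u,e}$ denotes the one-node graph carrying all these loops, while $\uplus$ is disjoint union. Start graph $G_s$: the disjoint union of all $I_e$, $S_e$, $L_{u,e}$ ($e\in E$, $u\in U_e$) and all $C_{e,e'}$ ($e\#e'$). Rule names $P=E$; rule $e$ has left-hand side the disjoint union of $I_e$, of $C_{e,e'}$ for every $e'$ with $e\#e'$, of the one-node graph $S_e\cup\bigcup_{u\in U_e}L_{u,e}$, and, for each $e'$ such that $e$ occurs in some $u'\in U_{e'}$, of $S_{e'}\uplus\biguplus_{u'\in U_{e'},\,e\text{ occurs in }u'}L_{u',e'}$. Its interface is the left-hand side without the nodes $i_e$ and $C_{e,e'}$ (with $l$ the inclusion); the right-hand side is obtained from the interface by merging, for each such $e'$, the node of $S_{e'}$ and the nodes of those $L_{u',e'}$ into a single node ($r$ the quotient map). Semantics. Graph rewriting is double-pushout rewriting in the category of $T$-typed graphs; rules $L\xleftarrow{l}K\xrightarrow{r}R$ have $l$ mono, not epi. $\mathrm{Dom}(\mathcal{G})$ is the ideal completion of the partial order $\mathcal{P}(\mathcal{G})$ of concatenable derivation traces starting from the canonical representative of $G_s$ (decorated derivations, i.e. derivations with isomorphisms from canonical graphs to their first and last graphs, modulo the equivalence generated by abstraction equivalence—isomorphism of derivation diagrams compatible with decorations—and shift equivalence—swapping sequentially independent consecutive steps), ordered by: $[\psi]\sqsubseteq[\psi']$ iff $\psi;\psi''$ is equivalent to $\psi'$ for some $\psi''$. For a weak prime domain $D$: irreducibles are compacts $i$ that are not joins of pairwise consistent sets of compacts not containing $i$;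 $\mathrm{pred}(i)$ is the unique immediate predecessor; $i\leftrightarrow i'$ if for all sets $X$ of irreducibles with $X\cup\{i\},X\cup\{i'\}$ downward closed and consistent $\bigsqcup(X\cup\{i\})=\bigsqcup(X\cup\{i'\})$, and for some such $X$, $\bigsqcup X\neq\bigsqcup(X\cup\{i\})$. $\mathcal{E}(D)$ has events the classes $[i]$ of irreducibles modulo the transitive closure of $\leftrightarrow$; $e\#e'$ iff no compact $d$ has both $e,e'$ among the classes of irreducibles below $d$; $X\vdash e$ iff some $i\in e$ has the classes of all irreducibles strictly below $i$ contained in $X$.
   Formalization: Isomorphism preserves and reflects ⊢ only for configurations, since for arbitrary finite sets the claim fails (e.g. ∅⊢b, {b}⊢a, {a}⊢e, no conflicts); the conflict node of e#e' is indexed by the unordered pair {e,e'}. *)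

theory Defs
  imports Main "HOL-Library.FuncSet"
begin

section \<open>Event structures\<close>

record 'e es =
  events :: "'e set"
  enables :: "'e set \<Rightarrow> 'e \<Rightarrow> bool"
  conflict :: "'e \<Rightarrow> 'e \<Rightarrow> bool"

definition event_structure :: "'e es \<Rightarrow> bool" where
  "event_structure S \<longleftrightarrow>
     (\<forall>X e. enables S X e \<longrightarrow> finite X \<and> X \<subseteq> events S \<and> e \<in> events S) \<and>
     (\<forall>X Y e. enables S X e \<and> X \<subseteq> Y \<and> finite Y \<and> Y \<subseteq> events S \<longrightarrow> enables S Y e) \<and>
     (\<forall>e e'. conflict S e e' \<longrightarrow> e \<in> events S \<and> e' \<in> events S)"

definition es_consistent :: "'e es \<Rightarrow> 'e set \<Rightarrow> bool" where
  "es_consistent S X \<longleftrightarrow> X \<subseteq> events S \<and> (\<forall>x\<in>X. \<forall>y\<in>X. \<not> conflict S x y)"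

definition configuration :: "'e es \<Rightarrow> 'e set \<Rightarrow> bool" where
  "configuration S C \<longleftrightarrow>
     es_consistent S C \<and>
     (\<forall>e\<in>C. \<exists>xs. xs \<noteq> [] \<and> last xs = e \<and> set xs \<subseteq> C \<and>
        (\<forall>k<length xs. enables S (set (take k xs)) (xs ! k)))"

definition live :: "'e es \<Rightarrow> bool" where
  "live S \<longleftrightarrow>
     (\<forall>e\<in>events S. \<forall>e'\<in>events S.
        (\<nexists>C. configuration S C \<and> {e, e'} \<subseteq> C) \<longrightarrow> conflict S e e') \<and>
     (\<forall>e\<in>events S. \<not> conflict S e e)"

definition min_enables :: "'e es \<Rightarrow> 'e set \<Rightarrow> 'e \<Rightarrow> bool" where
  "min_enables S C e \<longleftrightarrow>
     configuration S C \<and> enables S C e \<and>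
     (\<forall>C'. configuration S C' \<and> C' \<subseteq> C \<and> enables S C' e \<longrightarrow> C' = C)"

definition connected_es :: "'e es \<Rightarrow> bool" where
  "connected_es S \<longleftrightarrow>
     (\<forall>e C C'. min_enables S C e \<and> min_enables S C' e \<longrightarrow>
        (\<lambda>A B. min_enables S A e \<and> min_enables S B e \<and>
               es_consistent S (A \<union> B \<union> {e}))\<^sup>*\<^sup>* C C')"

text \<open>
  Morphisms of event structures compare enabling on configurations, and so do isomorphisms.
  Enablings by sets that are not configurations have no computational content and cannot be
  recovered from a domain: with no conflicts and the enabling generated by \<open>{} \<turnstile> b\<close>, \<open>{b} \<turnstile> a\<close>,
  \<open>{a} \<turnstile> e\<close>, the configurations form a four-element chain, whose event structure has
  \<open>{a, b} \<turnstile> e\<close> but not \<open>{a} \<turnstile> e\<close> (see \<open>chain_es_enables_not_recoverable\<close> below).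
\<close>

definition es_iso :: "'a es \<Rightarrow> 'b es \<Rightarrow> ('a \<Rightarrow> 'b) \<Rightarrow> bool" where
  "es_iso S S' f \<longleftrightarrow>
     bij_betw f (events S) (events S') \<and>
     (\<forall>x\<in>events S. \<forall>y\<in>events S. conflict S x y \<longleftrightarrow> conflict S' (f x) (f y)) \<and>
     (\<forall>C. \<forall>e\<in>events S. configuration S C \<and> enables S C e \<longrightarrow> enables S' (f ` C) (f e)) \<and>
     (\<forall>C\<subseteq>events S. \<forall>e\<in>events S.
        configuration S' (f ` C) \<and> enables S' (f ` C) (f e) \<longrightarrow> enables S C e)"

definition es_isomorphic :: "'a es \<Rightarrow> 'b es \<Rightarrow> bool" where
  "es_isomorphic S S' \<longleftrightarrow> (\<exists>f. es_iso S S' f)"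

text \<open>When enabling is generated by configurations, it is preserved and reflected on all sets.\<close>

definition config_generated :: "'e es \<Rightarrow> bool" where
  "config_generated S \<longleftrightarrow>
     (\<forall>X e. enables S X e \<longrightarrow> (\<exists>C\<subseteq>X. configuration S C \<and> enables S C e))"

lemma es_iso_enables_iff:
  assumes iso: "es_iso S S' f"
    and es: "event_structure S" "event_structure S'"
    and gen: "config_generated S" "config_generated S'"
    and X: "X \<subseteq> events S" "finite X" and e: "e \<in> events S"
  shows "enables S X e \<longleftrightarrow> enables S' (f ` X) (f e)"
proof -
  have up1: "enables S Y x" if "enables S Z x" "Y \<subseteq> events S" "finite Y" "Z \<subseteq> Y" for Y Z x
    using es(1) that unfolding event_structure_def by metis
  have up2: "enables S' Y x" if "enables S' Z x" "Y \<subseteq> events S'" "finite Y" "Z \<subseteq> Y" for Y Z x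
    using es(2) that unfolding event_structure_def by metis
  have bij: "f ` events S = events S'"
    using iso unfolding es_iso_def by (elim conjE) (rule bij_betw_imp_surj_on)
  have pres: "enables S' (f ` C) (f e)" if "configuration S C" "enables S C e" for C
    using iso e that unfolding es_iso_def by (elim conjE) blast
  have refl: "enables S C e"
    if "C \<subseteq> events S" "configuration S' (f ` C)" "enables S' (f ` C) (f e)" for C
    using iso e that unfolding es_iso_def by (elim conjE) blast
  show ?thesis
  proof
    assume "enables S X e"
    then obtain C where C: "C \<subseteq> X" "configuration S C" "enables S C e"
      using gen(1) unfolding config_generated_def by blast
    then have "enables S' (f ` C) (f e)"
      using pres by simp
    moreover have "f ` X \<subseteq> events S'"
      using X(1) bij by (metis image_mono)
    ultimately show "enables S' (f ` X) (f e)"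
      by (rule up2) (use X C(1) in auto)
  next
    assume "enables S' (f ` X) (f e)"
    then obtain C' where C': "C' \<subseteq> f ` X" "configuration S' C'" "enables S' C' (f e)"
      using gen(2) unfolding config_generated_def by blast
    then obtain C where C: "C \<subseteq> X" "C' = f ` C"
      by (meson subset_imageE)
    then have "C \<subseteq> events S"
      using X(1) by simp
    then have "enables S C e"
      using refl C' C(2) by simp
    then show "enables S X e"
      by (rule up1) (use X C(1) in auto)
  qed
qed

section \<open>The event structure of a weak prime domain\<close>

text \<open>A domain is given by its set of elements \<open>D\<close> in an ambient partially ordered type.\<close>

definition is_join :: "'d::order set \<Rightarrow> 'd set \<Rightarrow> 'd \<Rightarrow> bool" where
  "is_join D X s \<longleftrightarrow> s \<in> D \<and> (\<forall>x\<in>X. x \<le> s) \<and> (\<forall>y\<in>D. (\<forall>x\<in>X. x \<le> y) \<longrightarrow> s \<le> y)"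

definition join :: "'d::order set \<Rightarrow> 'd set \<Rightarrow> 'd" where
  "join D X = (THE s. is_join D X s)"

definition consistent_in :: "'d::order set \<Rightarrow> 'd set \<Rightarrow> bool" where
  "consistent_in D X \<longleftrightarrow> (\<exists>d\<in>D. \<forall>x\<in>X. x \<le> d)"

definition directed_in :: "'d::order set \<Rightarrow> 'd set \<Rightarrow> bool" where
  "directed_in D X \<longleftrightarrow> X \<subseteq> D \<and> X \<noteq> {} \<and> (\<forall>x\<in>X. \<forall>y\<in>X. \<exists>z\<in>X. x \<le> z \<and> y \<le> z)"

definition compacts :: "'d::order set \<Rightarrow> 'd set" where
  "compacts D = {d \<in> D. \<forall>X s. directed_in D X \<and> is_join D X s \<and> d \<le> s \<longrightarrow> (\<exists>x\<in>X. d \<le> x)}"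

definition irreducibles :: "'d::order set \<Rightarrow> 'd set" where
  "irreducibles D =
     {i \<in> compacts D. \<forall>X\<subseteq>compacts D.
        (\<forall>x\<in>X. \<forall>y\<in>X. consistent_in D {x, y}) \<and> is_join D X i \<longrightarrow> i \<in> X}"

definition closed_consistent_irrs :: "'d::order set \<Rightarrow> 'd set \<Rightarrow> bool" where
  "closed_consistent_irrs D X \<longleftrightarrow>
     X \<subseteq> irreducibles D \<and>
     (\<forall>x\<in>X. \<forall>j\<in>irreducibles D. j \<le> x \<longrightarrow> j \<in> X) \<and>
     consistent_in D X"

definition interchangeable :: "'d::order set \<Rightarrow> ('d \<times> 'd) set" where
  "interchangeable D =
     {(i, i'). i \<in> irreducibles D \<and> i' \<in> irreducibles D \<and>
        (\<forall>X\<subseteq>irreducibles D.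
           closed_consistent_irrs D (X \<union> {i}) \<and> closed_consistent_irrs D (X \<union> {i'}) \<longrightarrow>
             join D (X \<union> {i}) = join D (X \<union> {i'})) \<and>
        (\<exists>X\<subseteq>irreducibles D.
           closed_consistent_irrs D (X \<union> {i}) \<and> closed_consistent_irrs D (X \<union> {i'}) \<and>
             join D X \<noteq> join D (X \<union> {i}))}"

definition irr_class :: "'d::order set \<Rightarrow> 'd \<Rightarrow> 'd set" where
  "irr_class D i = (interchangeable D)\<^sup>+ `` {i}"

definition es_of_domain :: "'d::order set \<Rightarrow> 'd set es" where
  "es_of_domain D =
     \<lparr>events = irr_class D ` irreducibles D,
      enables = (\<lambda>X e. finite X \<and> X \<subseteq> irr_class D ` irreducibles D \<and>
                       e \<in> irr_class D ` irreducibles D \<and>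
                       (\<exists>i\<in>e. irr_class D ` {j \<in> irreducibles D. j < i} \<subseteq> X)),
      conflict = (\<lambda>e e'. e \<in> irr_class D ` irreducibles D \<and> e' \<in> irr_class D ` irreducibles D \<and>
                         \<not> (\<exists>d\<in>compacts D. {e, e'} \<subseteq> irr_class D ` {j \<in> irreducibles D. j \<le> d}))\<rparr>"

text \<open>
  The example mentioned at \<open>es_iso\<close>: a live and connected event structure for which no domain
  yields an event structure with the same enabling on arbitrary sets.
\<close>

definition chain_es :: "nat es" where
  "chain_es =
     \<lparr>events = {0, 1, 2},
      enables = (\<lambda>X e. X \<subseteq> {0, 1, 2} \<and> (e = 0 \<or> e = 1 \<and> 0 \<in> X \<or> e = 2 \<and> 1 \<in> X)),
      conflict = (\<lambda>_ _. False)\<rparr>"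

lemma event_structure_chain_es: "event_structure chain_es"
  unfolding event_structure_def chain_es_def by (auto intro: finite_subset)

lemma chain_es_configurations:
  "configuration chain_es {}" "configuration chain_es {0}"
  "configuration chain_es {0, 1}" "configuration chain_es {0, 1, 2}"
proof -
  have sec: "\<exists>xs. xs \<noteq> [] \<and> last xs = e \<and> set xs \<subseteq> C \<and>
      (\<forall>k<length xs. enables chain_es (set (take k xs)) (xs ! k))"
    if "e \<le> 2" "{..e} \<subseteq> C" for e C
  proof -
    have k: "k < Suc e \<Longrightarrow> enables chain_es (set (take k [0..<Suc e])) ([0..<Suc e] ! k)" for k
      using that(1) by (auto simp: chain_es_def take_upt nth_upt simp del: upt_Suc)
    show ?thesis
      using that k by (intro exI[of _ "[0..<Suc e]"]) (auto simp del: upt_Suc simp: last_upt)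
  qed
  show "configuration chain_es {}" "configuration chain_es {0}"
    "configuration chain_es {0, 1}" "configuration chain_es {0, 1, 2}"
    unfolding configuration_def
    by (intro conjI ballI sec; force simp: es_consistent_def chain_es_def)+
qed

lemma live_chain_es: "live chain_es"
proof -
  have "\<not> conflict chain_es e e'" for e e'
    by (simp add: chain_es_def)
  moreover have "events chain_es = {0, 1, 2}"
    by (simp add: chain_es_def)
  ultimately show ?thesis
    unfolding live_def using chain_es_configurations(4) by blast
qed

lemma connected_chain_es: "connected_es chain_es"
proof -
  have zero: "0 \<in> C" if C: "configuration chain_es C" and e: "e \<in> C" for C e
  proof -
    obtain xs where xs: "xs \<noteq> []" "set xs \<subseteq> C"
      "\<forall>k<length xs. enables chain_es (set (take k xs)) (xs ! k)"
      using C e unfolding configuration_def by blast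
    then have "enables chain_es {} (xs ! 0)"
      by (metis length_greater_0_conv list.set(1) take0)
    then have "xs ! 0 = 0"
      by (auto simp: chain_es_def)
    then show ?thesis
      using xs(1,2) by (metis length_greater_0_conv nth_mem subsetD)
  qed
  have min: "C = {..<e}" if C: "min_enables chain_es C e" for C e
  proof -
    have en: "enables chain_es C e" and conf: "configuration chain_es C"
      using C by (auto simp: min_enables_def)
    have "e \<in> {0, 1, 2}"
      using en by (auto simp: chain_es_def)
    then have e: "{..<e} \<in> {{}, {0}, {0, 1}}" "e \<le> 2"
      by (auto simp: lessThan_Suc numeral_2_eq_2)
    have "{..<e} \<subseteq> C"
    proof
      fix x assume "x \<in> {..<e}"
      then have "x = 0 \<and> e \<noteq> 0 \<or> x = 1 \<and> e = 2"
        using e(2) unfolding lessThan_iff by linarith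
      then show "x \<in> C"
        using en zero[OF conf] by (fastforce simp: chain_es_def)
    qed
    moreover have "configuration chain_es {..<e}"
      using e(1) chain_es_configurations by (elim insertE emptyE) simp_all
    moreover have "enables chain_es {..<e} e"
      using \<open>e \<in> {0, 1, 2}\<close> by (elim insertE emptyE) (auto simp: chain_es_def)
    ultimately show ?thesis
      using C unfolding min_enables_def by blast
  qed
  then show ?thesis
    unfolding connected_es_def by (metis (no_types, lifting) rtranclp.rtrancl_refl)
qed

lemma chain_es_enables_not_recoverable:
  fixes D :: "'d::order set" and f :: "nat \<Rightarrow> 'd set"
  shows "\<not> (\<forall>X\<subseteq>events chain_es. \<forall>e\<in>events chain_es.
            enables chain_es X e \<longleftrightarrow> enables (es_of_domain D) (f ` X) (f e))"
proof
  assume *: "\<forall>X\<subseteq>events chain_es. \<forall>e\<in>events chain_es.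
    enables chain_es X e \<longleftrightarrow> enables (es_of_domain D) (f ` X) (f e)"
  have iff: "enables chain_es X e \<longleftrightarrow> enables (es_of_domain D) (f ` X) (f e)"
    if "X \<subseteq> {0, 1, 2}" "e \<in> {0, 1, 2}" for X e
  proof -
    have "events chain_es = {0, 1, 2}"
      by (simp add: chain_es_def)
    then show ?thesis
      using * that by metis
  qed
  have 1: "enables (es_of_domain D) {f 1} (f 2)"
    using iff[of "{1}" 2] by (simp add: chain_es_def)
  have 2: "\<not> enables (es_of_domain D) {} (f 2)"
    using iff[of "{}" 2] by (simp add: chain_es_def)
  have 3: "enables (es_of_domain D) {f 0} (f 1)"
    using iff[of "{0}" 1] by (simp add: chain_es_def)
  have 4: "\<not> enables (es_of_domain D) {f 1} (f 1)"
    using iff[of "{1}" 1] by (simp add: chain_es_def)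
  obtain i where i: "i \<in> f 2" "irr_class D ` {j \<in> irreducibles D. j < i} \<subseteq> {f 1}"
    using 1 by (auto simp: es_of_domain_def)
  have "irr_class D ` {j \<in> irreducibles D. j < i} \<noteq> {}"
    using 1 2 i(1) by (auto simp: es_of_domain_def)
  then obtain j where j: "j \<in> irreducibles D" "j < i" "irr_class D j = f 1"
    using i(2) by blast
  obtain k where "k \<in> f 1"
    using 3 by (auto simp: es_of_domain_def)
  then have jk: "(j, k) \<in> (interchangeable D)\<^sup>+"
    using j(3) by (auto simp: irr_class_def)
  have "sym (interchangeable D)"
    unfolding interchangeable_def by (rule symI) (auto; metis)
  then have "(k, j) \<in> (interchangeable D)\<^sup>+"
    using jk by (meson symD sym_trancl)
  with jk have "(j, j) \<in> (interchangeable D)\<^sup>+"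
    by (rule trancl_trans)
  then have "j \<in> f 1"
    using j(3) unfolding irr_class_def by blast
  moreover have "irr_class D ` {l \<in> irreducibles D. l < j} \<subseteq> {f 1}"
    using i(2) j(2) by (auto dest: less_trans)
  ultimately have "enables (es_of_domain D) {f 1} (f 1)"
    using 1 3 by (auto simp: es_of_domain_def)
  with 4 show False by simp
qed

section \<open>Typed graphs\<close>

record ('n, 'a) graph =
  nodes :: "'n set"
  edges :: "'a set"
  src :: "'a \<Rightarrow> 'n"
  tgt :: "'a \<Rightarrow> 'n"

record ('n, 'a, 'tn, 'ta) tgraph = "('n, 'a) graph" +
  ntype :: "'n \<Rightarrow> 'tn"
  etype :: "'a \<Rightarrow> 'ta"

definition is_graph :: "('n, 'a, 'z) graph_scheme \<Rightarrow> bool" where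
  "is_graph G \<longleftrightarrow> (\<forall>a\<in>edges G. src G a \<in> nodes G \<and> tgt G a \<in> nodes G)"

definition typed_graph :: "('tn, 'ta) graph \<Rightarrow> ('n, 'a, 'tn, 'ta) tgraph \<Rightarrow> bool" where
  "typed_graph T G \<longleftrightarrow>
     is_graph G \<and>
     (\<forall>v\<in>nodes G. ntype G v \<in> nodes T) \<and>
     (\<forall>a\<in>edges G. etype G a \<in> edges T \<and>
        src T (etype G a) = ntype G (src G a) \<and> tgt T (etype G a) = ntype G (tgt G a))"

text \<open>
  Only the restriction of a morphism to the items of its source is meaningful; morphisms are
  therefore compared by \<open>mor_eq\<close>, relative to the source graph.
\<close>

type_synonym ('n, 'a) mor = "('n \<Rightarrow> 'n) \<times> ('a \<Rightarrow> 'a)"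

definition mor_comp :: "('n, 'a) mor \<Rightarrow> ('n, 'a) mor \<Rightarrow> ('n, 'a) mor" (infixl \<open>\<odot>\<close> 70) where
  "g \<odot> f = (fst g \<circ> fst f, snd g \<circ> snd f)"

definition mor_eq ::
    "('n, 'a, 'tn, 'ta) tgraph \<Rightarrow> ('n, 'a) mor \<Rightarrow> ('n, 'a) mor \<Rightarrow> bool" where
  "mor_eq G f g \<longleftrightarrow>
     (\<forall>v\<in>nodes G. fst f v = fst g v) \<and> (\<forall>a\<in>edges G. snd f a = snd g a)"

definition mor_inv :: "('n, 'a, 'tn, 'ta) tgraph \<Rightarrow> ('n, 'a) mor \<Rightarrow> ('n, 'a) mor" where
  "mor_inv G f = (inv_into (nodes G) (fst f), inv_into (edges G) (snd f))"

definition typed_mor ::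
    "('n, 'a, 'tn, 'ta) tgraph \<Rightarrow> ('n, 'a, 'tn, 'ta) tgraph \<Rightarrow> ('n, 'a) mor \<Rightarrow> bool" where
  "typed_mor G H f \<longleftrightarrow>
     (\<forall>v\<in>nodes G. fst f v \<in> nodes H \<and> ntype H (fst f v) = ntype G v) \<and>
     (\<forall>a\<in>edges G. snd f a \<in> edges H \<and> etype H (snd f a) = etype G a \<and>
        src H (snd f a) = fst f (src G a) \<and> tgt H (snd f a) = fst f (tgt G a))"

definition typed_iso ::
    "('n, 'a, 'tn, 'ta) tgraph \<Rightarrow> ('n, 'a, 'tn, 'ta) tgraph \<Rightarrow> ('n, 'a) mor \<Rightarrow> bool" where
  "typed_iso G H f \<longleftrightarrow>
     typed_mor G H f \<and>
     bij_betw (fst f) (nodes G) (nodes H) \<and> bij_betw (snd f) (edges G) (edges H)"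

text \<open>A fixed choice of a canonical graph in each isomorphism class.\<close>

definition can ::
    "('tn, 'ta) graph \<Rightarrow> ('n, 'a, 'tn, 'ta) tgraph \<Rightarrow> ('n, 'a, 'tn, 'ta) tgraph" where
  "can T G = (SOME C. typed_graph T C \<and> (\<exists>f. typed_iso C G f))"

text \<open>
  \<open>pushout T K A B C f g p q\<close>: the square \<open>f : K \<rightarrow> A\<close>, \<open>g : K \<rightarrow> B\<close>, \<open>p : A \<rightarrow> C\<close>, \<open>q : B \<rightarrow> C\<close>
  is a pushout of \<open>T\<close>-typed graphs. The category consists of the graphs with items in \<open>'n\<close> and
  \<open>'a\<close>; when both types are infinite it is closed, up to isomorphism, under pushouts.
\<close>

definition pushout ::
    "('tn, 'ta) graph \<Rightarrow>
     ('n, 'a, 'tn, 'ta) tgraph \<Rightarrow> ('n, 'a, 'tn, 'ta) tgraph \<Rightarrow>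
     ('n, 'a, 'tn, 'ta) tgraph \<Rightarrow> ('n, 'a, 'tn, 'ta) tgraph \<Rightarrow>
     ('n, 'a) mor \<Rightarrow> ('n, 'a) mor \<Rightarrow> ('n, 'a) mor \<Rightarrow> ('n, 'a) mor \<Rightarrow> bool" where
  "pushout T K A B C f g p q \<longleftrightarrow>
     typed_graph T K \<and> typed_graph T A \<and> typed_graph T B \<and> typed_graph T C \<and>
     typed_mor K A f \<and> typed_mor K B g \<and> typed_mor A C p \<and> typed_mor B C q \<and>
     mor_eq K (p \<odot> f) (q \<odot> g) \<and>
     (\<forall>X p' q'.
        typed_graph T X \<and> typed_mor A X p' \<and> typed_mor B X q' \<and>
        mor_eq K (p' \<odot> f) (q' \<odot> g) \<longrightarrow>
        (\<exists>h. typed_mor C X h \<and> mor_eq A (h \<odot> p) p' \<and> mor_eq B (h \<odot> q) q' \<and>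
           (\<forall>h'. typed_mor C X h' \<and> mor_eq A (h' \<odot> p) p' \<and> mor_eq B (h' \<odot> q) q' \<longrightarrow>
              mor_eq C h' h)))"

section \<open>Graph grammars and derivations\<close>

record ('n, 'a, 'tn, 'ta) rule =
  lhs :: "('n, 'a, 'tn, 'ta) tgraph"
  interface :: "('n, 'a, 'tn, 'ta) tgraph"
  rhs :: "('n, 'a, 'tn, 'ta) tgraph"
  lmor :: "('n, 'a) mor"
  rmor :: "('n, 'a) mor"

record ('n, 'a, 'tn, 'ta, 'p) grammar =
  type_graph :: "('tn, 'ta) graph"
  start_graph :: "('n, 'a, 'tn, 'ta) tgraph"
  rule_names :: "'p set"
  rule_of :: "'p \<Rightarrow> ('n, 'a, 'tn, 'ta) rule"

definition is_rule :: "('tn, 'ta) graph \<Rightarrow> ('n, 'a, 'tn, 'ta) rule \<Rightarrow> bool" where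
  "is_rule T r \<longleftrightarrow>
     typed_graph T (lhs r) \<and> typed_graph T (interface r) \<and> typed_graph T (rhs r) \<and>
     typed_mor (interface r) (lhs r) (lmor r) \<and> typed_mor (interface r) (rhs r) (rmor r) \<and>
     inj_on (fst (lmor r)) (nodes (interface r)) \<and> inj_on (snd (lmor r)) (edges (interface r)) \<and>
     \<not> (fst (lmor r) ` nodes (interface r) = nodes (lhs r) \<and>
        snd (lmor r) ` edges (interface r) = edges (lhs r))"

definition graph_grammar :: "('n, 'a, 'tn, 'ta, 'p) grammar \<Rightarrow> bool" where
  "graph_grammar \<G> \<longleftrightarrow>
     is_graph (type_graph \<G>) \<and> typed_graph (type_graph \<G>) (start_graph \<G>) \<and>
     (\<forall>p\<in>rule_names \<G>. is_rule (type_graph \<G>) (rule_of \<G> p))"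

text \<open>
  A direct derivation from \<open>G\<close> is the double-pushout diagram
  \<open>L \<leftarrow> K \<rightarrow> R\<close> over \<open>G \<leftarrow> D \<rightarrow> H\<close>. The record contains everything but \<open>G\<close>: the context
  graph \<open>D\<close>, the resulting graph \<open>H\<close>, the vertical morphisms \<open>L \<rightarrow> G\<close> (\<open>match\<close>),
  \<open>K \<rightarrow> D\<close> (\<open>kmatch\<close>), \<open>R \<rightarrow> H\<close> (\<open>comatch\<close>), and the bottom morphisms
  \<open>D \<rightarrow> G\<close> (\<open>ctx_l\<close>) and \<open>D \<rightarrow> H\<close> (\<open>ctx_r\<close>).
\<close>

record ('n, 'a, 'tn, 'ta, 'p) step =
  pname :: 'p
  ctx :: "('n, 'a, 'tn, 'ta) tgraph"
  result :: "('n, 'a, 'tn, 'ta) tgraph"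
  match :: "('n, 'a) mor"
  kmatch :: "('n, 'a) mor"
  comatch :: "('n, 'a) mor"
  ctx_l :: "('n, 'a) mor"
  ctx_r :: "('n, 'a) mor"

definition direct_derivation ::
    "('n, 'a, 'tn, 'ta, 'p) grammar \<Rightarrow> ('n, 'a, 'tn, 'ta) tgraph \<Rightarrow>
     ('n, 'a, 'tn, 'ta, 'p) step \<Rightarrow> bool" where
  "direct_derivation \<G> G s \<longleftrightarrow>
     pname s \<in> rule_names \<G> \<and>
     (let r = rule_of \<G> (pname s) in
        pushout (type_graph \<G>) (interface r) (lhs r) (ctx s) G
          (lmor r) (kmatch s) (match s) (ctx_l s) \<and>
        pushout (type_graph \<G>) (interface r) (rhs r) (ctx s) (result s)
          (rmor r) (kmatch s) (comatch s) (ctx_r s))"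

fun derivation ::
    "('n, 'a, 'tn, 'ta, 'p) grammar \<Rightarrow> ('n, 'a, 'tn, 'ta) tgraph \<Rightarrow>
     ('n, 'a, 'tn, 'ta, 'p) step list \<Rightarrow> bool" where
  "derivation \<G> G [] \<longleftrightarrow> typed_graph (type_graph \<G>) G"
| "derivation \<G> G (s # ss) \<longleftrightarrow> direct_derivation \<G> G s \<and> derivation \<G> (result s) ss"

definition graph_at ::
    "('n, 'a, 'tn, 'ta) tgraph \<Rightarrow> ('n, 'a, 'tn, 'ta, 'p) step list \<Rightarrow> nat \<Rightarrow>
     ('n, 'a, 'tn, 'ta) tgraph" where
  "graph_at G ss i = (case i of 0 \<Rightarrow> G | Suc j \<Rightarrow> result (ss ! j))"

record ('n, 'a, 'tn, 'ta, 'p) dderivation =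
  alpha :: "('n, 'a) mor"
  first_graph :: "('n, 'a, 'tn, 'ta) tgraph"
  steps :: "('n, 'a, 'tn, 'ta, 'p) step list"
  omega :: "('n, 'a) mor"

definition last_graph :: "('n, 'a, 'tn, 'ta, 'p) dderivation \<Rightarrow> ('n, 'a, 'tn, 'ta) tgraph" where
  "last_graph \<psi> = graph_at (first_graph \<psi>) (steps \<psi>) (length (steps \<psi>))"

definition dsource ::
    "('n, 'a, 'tn, 'ta, 'p) grammar \<Rightarrow> ('n, 'a, 'tn, 'ta, 'p) dderivation \<Rightarrow>
     ('n, 'a, 'tn, 'ta) tgraph" where
  "dsource \<G> \<psi> = can (type_graph \<G>) (first_graph \<psi>)"

definition dtarget ::
    "('n, 'a, 'tn, 'ta, 'p) grammar \<Rightarrow> ('n, 'a, 'tn, 'ta, 'p) dderivation \<Rightarrow>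
     ('n, 'a, 'tn, 'ta) tgraph" where
  "dtarget \<G> \<psi> = can (type_graph \<G>) (last_graph \<psi>)"

definition decorated_derivation ::
    "('n, 'a, 'tn, 'ta, 'p) grammar \<Rightarrow> ('n, 'a, 'tn, 'ta, 'p) dderivation \<Rightarrow> bool" where
  "decorated_derivation \<G> \<psi> \<longleftrightarrow>
     derivation \<G> (first_graph \<psi>) (steps \<psi>) \<and>
     typed_iso (dsource \<G> \<psi>) (first_graph \<psi>) (alpha \<psi>) \<and>
     typed_iso (dtarget \<G> \<psi>) (last_graph \<psi>) (omega \<psi>)"

text \<open>
  Sequential composition, for \<open>dtarget \<G> \<psi> = dsource \<G> \<psi>'\<close>. The first graph of \<open>\<psi>'\<close> is replaced
  by the last graph of \<open>\<psi>\<close> along the isomorphism given by the decorations.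
\<close>

definition dcomp ::
    "('n, 'a, 'tn, 'ta, 'p) grammar \<Rightarrow> ('n, 'a, 'tn, 'ta, 'p) dderivation \<Rightarrow>
     ('n, 'a, 'tn, 'ta, 'p) dderivation \<Rightarrow> ('n, 'a, 'tn, 'ta, 'p) dderivation" where
  "dcomp \<G> \<psi> \<psi>' =
     (let \<iota> = omega \<psi> \<odot> mor_inv (dsource \<G> \<psi>') (alpha \<psi>') in
      case steps \<psi>' of
        [] \<Rightarrow> \<psi>\<lparr>omega := \<iota> \<odot> omega \<psi>'\<rparr>
      | s # ss \<Rightarrow>
          \<psi>\<lparr>steps := steps \<psi> @ s\<lparr>match := \<iota> \<odot> match s, ctx_l := \<iota> \<odot> ctx_l s\<rparr> # ss,
            omega := omega \<psi>'\<rparr>)"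

definition abstraction_equiv ::
    "('n, 'a, 'tn, 'ta, 'p) grammar \<Rightarrow> ('n, 'a, 'tn, 'ta, 'p) dderivation \<Rightarrow>
     ('n, 'a, 'tn, 'ta, 'p) dderivation \<Rightarrow> bool" where
  "abstraction_equiv \<G> \<psi> \<psi>' \<longleftrightarrow>
     decorated_derivation \<G> \<psi> \<and> decorated_derivation \<G> \<psi>' \<and>
     dsource \<G> \<psi> = dsource \<G> \<psi>' \<and> dtarget \<G> \<psi> = dtarget \<G> \<psi>' \<and>
     length (steps \<psi>) = length (steps \<psi>') \<and>
     (\<exists>\<theta> \<delta>.
        (\<forall>i\<le>length (steps \<psi>).
           typed_iso (graph_at (first_graph \<psi>) (steps \<psi>) i)
             (graph_at (first_graph \<psi>') (steps \<psi>') i) (\<theta> i)) \<and>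
        mor_eq (dsource \<G> \<psi>) (\<theta> 0 \<odot> alpha \<psi>) (alpha \<psi>') \<and>
        mor_eq (dtarget \<G> \<psi>) (\<theta> (length (steps \<psi>)) \<odot> omega \<psi>) (omega \<psi>') \<and>
        (\<forall>i<length (steps \<psi>).
           let s = steps \<psi> ! i; s' = steps \<psi>' ! i; r = rule_of \<G> (pname s) in
             pname s = pname s' \<and>
             typed_iso (ctx s) (ctx s') (\<delta> i) \<and>
             mor_eq (lhs r) (\<theta> i \<odot> match s) (match s') \<and>
             mor_eq (interface r) (\<delta> i \<odot> kmatch s) (kmatch s') \<and>
             mor_eq (rhs r) (\<theta> (Suc i) \<odot> comatch s) (comatch s') \<and>
             mor_eq (ctx s) (\<theta> i \<odot> ctx_l s) (ctx_l s' \<odot> \<delta> i) \<and>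
             mor_eq (ctx s) (\<theta> (Suc i) \<odot> ctx_r s) (ctx_r s' \<odot> \<delta> i)))"

definition independence_pair ::
    "('n, 'a, 'tn, 'ta, 'p) grammar \<Rightarrow>
     ('n, 'a, 'tn, 'ta, 'p) step \<Rightarrow> ('n, 'a, 'tn, 'ta, 'p) step \<Rightarrow>
     ('n, 'a) mor \<Rightarrow> ('n, 'a) mor \<Rightarrow> bool" where
  "independence_pair \<G> s1 s2 i1 i2 \<longleftrightarrow>
     (let R1 = rhs (rule_of \<G> (pname s1)); L2 = lhs (rule_of \<G> (pname s2)) in
        typed_mor R1 (ctx s2) i1 \<and> mor_eq R1 (ctx_l s2 \<odot> i1) (comatch s1) \<and>
        typed_mor L2 (ctx s1) i2 \<and> mor_eq L2 (ctx_r s1 \<odot> i2) (match s2))"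

text \<open>
  The two-step derivation \<open>t2; t1\<close> from \<open>G\<close> is an interchange of \<open>s1; s2\<close> via the independence
  pair \<open>i1, i2\<close>, as in the local Church-Rosser construction. With \<open>G \<leftarrow> D1 \<rightarrow> H \<leftarrow> D2 \<rightarrow> M\<close> the
  bottom line of \<open>s1; s2\<close>, let \<open>B\<close> be the common part of \<open>D1\<close> and \<open>D2\<close>, so that
  \<open>D1 = L2 +\<^bsub>K2\<^esub> B\<close> and \<open>D2 = R1 +\<^bsub>K1\<^esub> B\<close>; the bottom line \<open>G \<leftarrow> D2' \<rightarrow> H' \<leftarrow> D1' \<rightarrow> M\<close>
  of \<open>t2; t1\<close> has \<open>D2' = L1 +\<^bsub>K1\<^esub> B\<close> and \<open>D1' = R2 +\<^bsub>K2\<^esub> B\<close>, with the induced morphisms;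
  \<open>j2, j1\<close> is the resulting independence pair of \<open>t2; t1\<close>. The pair is a parameter since rules
  may merge items, so that it need not be determined by \<open>s1; s2\<close>.
\<close>

definition interchange ::
    "('n, 'a, 'tn, 'ta, 'p) grammar \<Rightarrow> ('n, 'a, 'tn, 'ta) tgraph \<Rightarrow>
     ('n, 'a) mor \<Rightarrow> ('n, 'a) mor \<Rightarrow>
     ('n, 'a, 'tn, 'ta, 'p) step \<Rightarrow> ('n, 'a, 'tn, 'ta, 'p) step \<Rightarrow>
     ('n, 'a, 'tn, 'ta, 'p) step \<Rightarrow> ('n, 'a, 'tn, 'ta, 'p) step \<Rightarrow> bool" where
  "interchange \<G> G i1 i2 s1 s2 t2 t1 \<longleftrightarrow>
     derivation \<G> G [s1, s2] \<and> derivation \<G> G [t2, t1] \<and>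
     pname t1 = pname s1 \<and> pname t2 = pname s2 \<and> result t1 = result s2 \<and>
     independence_pair \<G> s1 s2 i1 i2 \<and>
     (let T = type_graph \<G>; r1 = rule_of \<G> (pname s1); r2 = rule_of \<G> (pname s2) in
      \<exists>B k1 k2 b1 b2 c1 c2 j1 j2.
        pushout T (interface r2) (lhs r2) B (ctx s1) (lmor r2) k2 i2 b1 \<and>
        pushout T (interface r1) (rhs r1) B (ctx s2) (rmor r1) k1 i1 b2 \<and>
        pushout T (interface r1) (lhs r1) B (ctx t2) (lmor r1) k1 j1 c2 \<and>
        pushout T (interface r2) (rhs r2) B (ctx t1) (rmor r2) k2 j2 c1 \<and>
        mor_eq B (ctx_r s1 \<odot> b1) (ctx_l s2 \<odot> b2) \<and>
        mor_eq (interface r1) (b1 \<odot> k1) (kmatch s1) \<and>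
        mor_eq (interface r2) (b2 \<odot> k2) (kmatch s2) \<and>
        mor_eq (lhs r2) (match t2) (ctx_l s1 \<odot> i2) \<and>
        mor_eq (interface r2) (kmatch t2) (c2 \<odot> k2) \<and>
        mor_eq (rhs r2) (comatch t2) (ctx_l t1 \<odot> j2) \<and>
        mor_eq (lhs r1) (match t1) (ctx_r t2 \<odot> j1) \<and>
        mor_eq (interface r1) (kmatch t1) (c1 \<odot> k1) \<and>
        mor_eq (rhs r1) (comatch t1) (ctx_r s2 \<odot> i1) \<and>
        mor_eq B (ctx_l t2 \<odot> c2) (ctx_l s1 \<odot> b1) \<and>
        mor_eq (lhs r1) (ctx_l t2 \<odot> j1) (match s1) \<and>
        mor_eq B (ctx_r t2 \<odot> c2) (ctx_l t1 \<odot> c1) \<and>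
        mor_eq B (ctx_r t1 \<odot> c1) (ctx_r s2 \<odot> b2) \<and>
        mor_eq (rhs r2) (ctx_r t1 \<odot> j2) (comatch s2))"

definition shift_step ::
    "('n, 'a, 'tn, 'ta, 'p) grammar \<Rightarrow> ('n, 'a, 'tn, 'ta, 'p) dderivation \<Rightarrow>
     ('n, 'a, 'tn, 'ta, 'p) dderivation \<Rightarrow> bool" where
  "shift_step \<G> \<psi> \<psi>' \<longleftrightarrow>
     decorated_derivation \<G> \<psi> \<and> decorated_derivation \<G> \<psi>' \<and>
     (\<exists>us s1 s2 t2 t1 vs i1 i2.
        steps \<psi> = us @ [s1, s2] @ vs \<and> \<psi>' = \<psi>\<lparr>steps := us @ [t2, t1] @ vs\<rparr> \<and>
        interchange \<G> (graph_at (first_graph \<psi>) us (length us)) i1 i2 s1 s2 t2 t1)"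

definition trace_equiv ::
    "('n, 'a, 'tn, 'ta, 'p) grammar \<Rightarrow> ('n, 'a, 'tn, 'ta, 'p) dderivation \<Rightarrow>
     ('n, 'a, 'tn, 'ta, 'p) dderivation \<Rightarrow> bool" where
  "trace_equiv \<G> = equivclp (\<lambda>\<psi> \<psi>'. abstraction_equiv \<G> \<psi> \<psi>' \<or> shift_step \<G> \<psi> \<psi>')"

type_synonym ('n, 'a, 'tn, 'ta, 'p) trace = "('n, 'a, 'tn, 'ta, 'p) dderivation set"

definition trace_of ::
    "('n, 'a, 'tn, 'ta, 'p) grammar \<Rightarrow> ('n, 'a, 'tn, 'ta, 'p) dderivation \<Rightarrow>
     ('n, 'a, 'tn, 'ta, 'p) trace" where
  "trace_of \<G> \<psi> = {\<psi>'. trace_equiv \<G> \<psi> \<psi>'}"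

definition start_traces ::
    "('n, 'a, 'tn, 'ta, 'p) grammar \<Rightarrow> ('n, 'a, 'tn, 'ta, 'p) trace set" where
  "start_traces \<G> =
     {trace_of \<G> \<psi> | \<psi>. decorated_derivation \<G> \<psi> \<and>
        dsource \<G> \<psi> = can (type_graph \<G>) (start_graph \<G>)}"

definition trace_le ::
    "('n, 'a, 'tn, 'ta, 'p) grammar \<Rightarrow> ('n, 'a, 'tn, 'ta, 'p) trace \<Rightarrow>
     ('n, 'a, 'tn, 'ta, 'p) trace \<Rightarrow> bool" where
  "trace_le \<G> t t' \<longleftrightarrow>
     (\<exists>\<psi>\<in>t. \<exists>\<psi>'\<in>t'. \<exists>\<psi>''. decorated_derivation \<G> \<psi>'' \<and> dtarget \<G> \<psi> = dsource \<G> \<psi>'' \<and>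
        trace_equiv \<G> (dcomp \<G> \<psi> \<psi>'') \<psi>')"

text \<open>
  For a grammar whose reachable graphs have non-trivial automorphisms \<open>trace_le\<close> is only a
  preorder, but its ideals are those of the induced partial order.
\<close>

definition Dom ::
    "('n, 'a, 'tn, 'ta, 'p) grammar \<Rightarrow> ('n, 'a, 'tn, 'ta, 'p) trace set set" where
  "Dom \<G> =
     {I. I \<subseteq> start_traces \<G> \<and> I \<noteq> {} \<and>
         (\<forall>t\<in>I. \<forall>t'\<in>start_traces \<G>. trace_le \<G> t' t \<longrightarrow> t' \<in> I) \<and>
         (\<forall>t\<in>I. \<forall>t'\<in>I. \<exists>t''\<in>I. trace_le \<G> t t'' \<and> trace_le \<G> t' t'')}"

section \<open>The grammar of an event structure\<close>

type_synonym 'e choice = "'e set \<Rightarrow> 'e"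

definition choices :: "'e es \<Rightarrow> 'e \<Rightarrow> 'e choice set" where
  "choices S e = Pi\<^sub>E {X. min_enables S X e} (\<lambda>X. X)"

definition occurs_in :: "'e es \<Rightarrow> 'e \<Rightarrow> 'e \<Rightarrow> 'e choice \<Rightarrow> bool" where
  "occurs_in S e e' u' \<longleftrightarrow> u' \<in> choices S e' \<and> (\<exists>X. min_enables S X e' \<and> u' X = e)"

text \<open>
  The conflict node of \<open>e # e'\<close> is indexed by the unordered pair \<open>{e, e'}\<close>: it is the resource
  for which the rules \<open>e\<close> and \<open>e'\<close> compete, hence shared by them.
\<close>

datatype 'e tnode = TI 'e | TE 'e | TC "'e set"

datatype 'e tedge = Ev 'e | Ch 'e "'e choice"

text \<open>
  Nodes and edges of typed graphs: the nodes of the basic graphs \<open>I\<^sub>e\<close>, \<open>S\<^sub>e\<close>, \<open>L\<^bsub>u,e\<^esub>\<close> and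
  \<open>C\<^bsub>e,e'\<^esub>\<close>, and their loops, named by their type. The spare items occur neither in the start
  graph nor in the rules; they make both types infinite (see the remark on \<open>pushout\<close>).
\<close>

datatype 'e gnode = NI 'e | NS 'e | NL 'e "'e choice" | NC "'e set" | NSpare nat

datatype 'e gedge = Loop "'e tedge" | ESpare nat

fun node_type :: "'e gnode \<Rightarrow> 'e tnode" where
  "node_type (NI e) = TI e"
| "node_type (NS e) = TE e"
| "node_type (NL e u) = TE e"
| "node_type (NC c) = TC c"
| "node_type (NSpare n) = undefined"

fun edge_type :: "'e gedge \<Rightarrow> 'e tedge" where
  "edge_type (Loop x) = x"
| "edge_type (ESpare n) = undefined"

definition loop_graph ::
    "'e gnode set \<Rightarrow> 'e tedge set \<Rightarrow> ('e tedge \<Rightarrow> 'e gnode) \<Rightarrow>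
     ('e gnode, 'e gedge, 'e tnode, 'e tedge) tgraph" where
  "loop_graph N A at =
     \<lparr>nodes = N, edges = Loop ` A,
      src = (\<lambda>a. at (edge_type a)), tgt = (\<lambda>a. at (edge_type a)),
      ntype = node_type, etype = edge_type\<rparr>"

definition es_type_graph :: "'e es \<Rightarrow> ('e tnode, 'e tedge) graph" where
  "es_type_graph S =
     (let at = (\<lambda>x. case x of Ev e \<Rightarrow> TE e | Ch e u \<Rightarrow> TE e) in
      \<lparr>nodes = TI ` events S \<union> TE ` events S \<union> {TC {e, e'} | e e'. conflict S e e'},
       edges = Ev ` events S \<union> {Ch e u | e u. e \<in> events S \<and> u \<in> choices S e},
       src = at, tgt = at\<rparr>)"

definition es_start_graph :: "'e es \<Rightarrow> ('e gnode, 'e gedge, 'e tnode, 'e tedge) tgraph" where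
  "es_start_graph S =
     loop_graph
       (NI ` events S \<union> NS ` events S \<union> {NL e u | e u. e \<in> events S \<and> u \<in> choices S e} \<union>
        {NC {e, e'} | e e'. conflict S e e'})
       (Ev ` events S \<union> {Ch e u | e u. e \<in> events S \<and> u \<in> choices S e})
       (\<lambda>x. case x of Ev e \<Rightarrow> NS e | Ch e u \<Rightarrow> NL e u)"

text \<open>
  The left-hand side of rule \<open>e\<close> has all loops of \<open>e\<close> on the single node \<open>NS e\<close>. Its components
  are disjoint because \<open>e\<close> never occurs in an element of \<open>choices S e\<close>: a configuration containing
  \<open>e\<close> has a smaller subconfiguration that enables \<open>e\<close>.
\<close>

definition es_rule :: "'e es \<Rightarrow> 'e \<Rightarrow> ('e gnode, 'e gedge, 'e tnode, 'e tedge) rule" where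
  "es_rule S e =
     (let merged = {NS e} \<union> {NS e' | e' u'. e' \<in> events S \<and> occurs_in S e e' u'};
          kept = merged \<union> {NL e' u' | e' u'. e' \<in> events S \<and> occurs_in S e e' u'};
          deleted = {NI e} \<union> {NC {e, e'} | e'. conflict S e e'};
          loops = {Ev e} \<union> Ch e ` choices S e \<union>
                  {Ev e' | e' u'. e' \<in> events S \<and> occurs_in S e e' u'} \<union>
                  {Ch e' u' | e' u'. e' \<in> events S \<and> occurs_in S e e' u'};
          at = (\<lambda>x. case x of Ev e' \<Rightarrow> NS e' | Ch e' u' \<Rightarrow> if e' = e then NS e else NL e' u');
          merge = (\<lambda>v. case v of NL e' u' \<Rightarrow> NS e' | _ \<Rightarrow> v)
      in \<lparr>lhs = loop_graph (kept \<union> deleted) loops at,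
          interface = loop_graph kept loops at,
          rhs = loop_graph merged loops (\<lambda>x. merge (at x)),
          lmor = (id, id),
          rmor = (merge, id)\<rparr>)"

definition es_grammar ::
    "'e es \<Rightarrow> ('e gnode, 'e gedge, 'e tnode, 'e tedge, 'e) grammar" where
  "es_grammar S =
     \<lparr>type_graph = es_type_graph S, start_graph = es_start_graph S,
      rule_names = events S, rule_of = es_rule S\<rparr>"

lemma graph_grammar_es_grammar:
  assumes "event_structure S"
  shows "graph_grammar (es_grammar S)"
proof -
  have *: "e \<in> events S \<and> e' \<in> events S" if "conflict S e e'" for e e'
    using conjunct2[OF conjunct2[OF assms[unfolded event_structure_def]]] that by blast
  have "is_rule (es_type_graph S) (es_rule S e)" if e: "e \<in> events S" for e
    unfolding is_rule_def
  proof (intro conjI)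
    note defs = typed_graph_def is_graph_def typed_mor_def es_rule_def
      es_type_graph_def loop_graph_def Let_def
    have occ: "u' \<in> choices S e'" if "occurs_in S e e' u'" for e' u'
      using that by (simp add: occurs_in_def)
    show "typed_graph (es_type_graph S) (lhs (es_rule S e))"
      using e by (auto simp: defs dest: * occ split: if_splits)
    show "typed_graph (es_type_graph S) (interface (es_rule S e))"
      using e by (auto simp: defs dest: * occ split: if_splits)
    show "typed_graph (es_type_graph S) (rhs (es_rule S e))"
      using e by (auto simp: defs dest: occ split: if_splits)
    show "typed_mor (interface (es_rule S e)) (lhs (es_rule S e)) (lmor (es_rule S e))"
      by (auto simp: defs split: if_splits)
    show "typed_mor (interface (es_rule S e)) (rhs (es_rule S e)) (rmor (es_rule S e))"
      by (auto simp: defs split: if_splits)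
    show "inj_on (fst (lmor (es_rule S e))) (nodes (interface (es_rule S e)))"
      and "inj_on (snd (lmor (es_rule S e))) (edges (interface (es_rule S e)))"
      by (simp_all add: es_rule_def Let_def)
    have "NI e \<in> nodes (lhs (es_rule S e))" "NI e \<notin> nodes (interface (es_rule S e))"
      by (auto simp: defs)
    then show "\<not> (fst (lmor (es_rule S e)) ` nodes (interface (es_rule S e)) = nodes (lhs (es_rule S e)) \<and>
        snd (lmor (es_rule S e)) ` edges (interface (es_rule S e)) = edges (lhs (es_rule S e)))"
      by (auto simp: es_rule_def Let_def)
  qed
  then show ?thesis
    by (auto simp: graph_grammar_def es_grammar_def typed_graph_def is_graph_def
        es_start_graph_def es_type_graph_def loop_graph_def Let_def dest: * split: tedge.splits)
qed

end

theory Submission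
  imports Defs
begin

text \<open>
  The graph reached after firing a set \<open>A\<close> of events has exactly one edge of each type, and every
  node is determined by its type or by a loop on it; hence it is rigid, and a step is determined up
  to unique isomorphism by the name of its rule. The loops of \<open>e\<close> all lie on one node iff \<open>A\<close>
  meets every choice \<open>u \<in> U\<^sub>e\<close>, that is, iff \<open>A\<close> contains a minimal enabling of \<open>e\<close>; so the
  firing sequences are the securings of finite configurations. Two securings of the same
  configuration differ by swaps of adjacent events that are both enabled, and such swaps are shifts.
  Hence start traces are finite configurations ordered by inclusion, and their ideals are all
  configurations. The irreducible configurations are \<open>C \<union> {e}\<close> with \<open>C \<turnstile>\<^sub>0 e\<close>, two of them
  with the same \<open>e\<close> are interchangeable when they are compatible, and connectedness says that
  their classes are the events.
\<close>

section \<open>Configurations and minimal enablings\<close>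

text \<open>Why the loops test enabling: if no minimal enabling of \<open>e\<close> lies in
  \<open>A\<close>, picking from each of them an event outside \<open>A\<close> gives a choice that
  \<open>A\<close> misses. Connectedness does two jobs. The first link of a chain carries the
  consistency of \<open>C \<union> {e}\<close>, so every minimal enabling \<open>C\<close> of
  \<open>e\<close> really yields a configuration \<open>C \<union> {e}\<close>; and a whole chain
  translates into a chain of interchangeable irreducibles. On the graph side, pushouts are known
  only through their universal property, so injectivity, coverage and the shape of a pushout
  complement are extracted by testing against suitable graphs. To avoid quotients, reachable graphs
  get explicit representatives, in which the node \<open>NL e u\<close> becomes \<open>NS e\<close>
  as soon as a fired event occurs in \<open>u\<close>. All morphisms of standard derivations are
  such maps \<open>fuse A\<close>, whose composites collapse to the one with the larger set, so the
  many squares of an interchange commute by calculation. For arbitrary derivations isomorphisms are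
  chosen stage by stage with no compatibility demanded; rigidity supplies it afterwards.\<close>

definition secured :: "'e es \<Rightarrow> 'e list \<Rightarrow> bool" where
  "secured S xs \<longleftrightarrow> (\<forall>k<length xs. enables S (set (take k xs)) (xs ! k))"

lemma secured_Nil [simp]: "secured S []"
  by (simp add: secured_def)

lemma secured_take: "secured S xs \<Longrightarrow> secured S (take n xs)"
  by (simp add: secured_def)

lemma secured_snoc: "secured S (xs @ [x]) \<longleftrightarrow> secured S xs \<and> enables S (set xs) x"
  by (auto simp: secured_def nth_append less_Suc_eq)

locale es_base =
  fixes S :: "'e es"
  assumes es: "event_structure S"
begin

lemma enables_mono: "enables S X e \<Longrightarrow> X \<subseteq> Y \<Longrightarrow> finite Y \<Longrightarrow> Y \<subseteq> events S \<Longrightarrow> enables S Y e"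
  using es unfolding event_structure_def by metis

lemma enables_finite: "enables S X e \<Longrightarrow> finite X"
  and enables_events: "enables S X e \<Longrightarrow> e \<in> events S"
  using es unfolding event_structure_def by metis+

lemma conflict_events: "conflict S e e' \<Longrightarrow> e \<in> events S \<and> e' \<in> events S"
  using es unfolding event_structure_def by metis

lemma secured_events: "secured S xs \<Longrightarrow> set xs \<subseteq> events S"
proof
  fix x assume "secured S xs" "x \<in> set xs"
  then obtain k where "x = xs ! k" "enables S (set (take k xs)) (xs ! k)"
    unfolding secured_def by (metis in_set_conv_nth)
  then show "x \<in> events S"
    using enables_events by simp
qed

text \<open>A securing may repeat events, so no disjointness is asked for: each entry of
  \<open>ys\<close> is still enabled by what precedes it, by upward closure.\<close>

lemma secured_append: "secured S xs \<Longrightarrow> secured S ys \<Longrightarrow> secured S (xs @ ys)"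
proof (induction ys rule: rev_induct)
  case (snoc y ys)
  have ys: "secured S ys" "enables S (set ys) y"
    using snoc.prems(2) by (auto simp: secured_snoc)
  have "enables S (set xs \<union> set ys) y"
    by (rule enables_mono[OF ys(2)]) (use secured_events[OF snoc.prems(1)] secured_events[OF ys(1)] in auto)
  then show ?case
    using snoc.IH[OF snoc.prems(1) ys(1)] secured_snoc[of S "xs @ ys" y] by simp
qed simp

lemma configurationD:
  assumes "configuration S C"
  shows "C \<subseteq> events S" "\<And>x y. x \<in> C \<Longrightarrow> y \<in> C \<Longrightarrow> \<not> conflict S x y" "es_consistent S C"
  using assms by (auto simp: configuration_def es_consistent_def)

lemma configuration_secured:
  assumes "configuration S C" "e \<in> C"
  obtains xs where "xs \<noteq> []" "last xs = e" "set xs \<subseteq> C" "secured S xs"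
  using assms by (auto simp: configuration_def secured_def)

lemma configurationI:
  assumes "es_consistent S C"
    and "\<And>e. e \<in> C \<Longrightarrow> \<exists>xs. e \<in> set xs \<and> set xs \<subseteq> C \<and> secured S xs"
  shows "configuration S C"
  unfolding configuration_def
proof (intro conjI ballI)
  fix e assume "e \<in> C"
  then obtain xs where xs: "e \<in> set xs" "set xs \<subseteq> C" "secured S xs"
    using assms(2) by blast
  then obtain k where k: "k < length xs" "xs ! k = e"
    by (metis in_set_conv_nth)
  then have "take (Suc k) xs \<noteq> []" "last (take (Suc k) xs) = e" "set (take (Suc k) xs) \<subseteq> C"
    using xs(2) by (auto simp: take_Suc_conv_app_nth dest: in_set_takeD)
  moreover have "secured S (take (Suc k) xs)"
    using xs(3) by (rule secured_take)
  ultimately show "\<exists>xs. xs \<noteq> [] \<and> last xs = e \<and> set xs \<subseteq> C \<and>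
      (\<forall>k<length xs. enables S (set (take k xs)) (xs ! k))"
    unfolding secured_def by blast
qed (fact assms(1))

lemma es_consistent_subset: "es_consistent S C \<Longrightarrow> C' \<subseteq> C \<Longrightarrow> es_consistent S C'"
  by (auto simp: es_consistent_def)

lemma configuration_set: "secured S xs \<Longrightarrow> es_consistent S (set xs) \<Longrightarrow> configuration S (set xs)"
  by (rule configurationI) auto

lemma configuration_empty [simp]: "configuration S {}"
  using configuration_set[of "[]"] by (simp add: es_consistent_def)

text \<open>A securing inside one member is a securing inside the union; only consistency can fail,
  which is why it is a hypothesis.\<close>

lemma configuration_Union:
  assumes "\<And>C. C \<in> \<C> \<Longrightarrow> configuration S C" and "es_consistent S (\<Union>\<C>)"
  shows "configuration S (\<Union>\<C>)"
proof (rule configurationI[OF assms(2)])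
  fix e assume "e \<in> \<Union>\<C>"
  then obtain C where C: "C \<in> \<C>" "e \<in> C"
    by blast
  then obtain xs where "xs \<noteq> []" "last xs = e" "set xs \<subseteq> C" "secured S xs"
    using configuration_secured assms(1) by metis
  then show "\<exists>xs. e \<in> set xs \<and> set xs \<subseteq> \<Union>\<C> \<and> secured S xs"
    using C by (metis Union_upper last_in_set subset_trans)
qed

lemma configuration_Un:
  "configuration S C \<Longrightarrow> configuration S C' \<Longrightarrow> es_consistent S (C \<union> C') \<Longrightarrow> configuration S (C \<union> C')"
  using configuration_Union[of "{C, C'}"] by auto

lemma finite_configuration_secured:
  assumes "configuration S C" "finite C"
  obtains xs where "secured S xs" "set xs = C"
proof -
  have "\<exists>xs. secured S xs \<and> F \<subseteq> set xs \<and> set xs \<subseteq> C" if "finite F" "F \<subseteq> C" for F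
    using that
  proof (induction F rule: finite_induct)
    case empty
    then show ?case by (intro exI[of _ "[]"]) simp
  next
    case (insert x F)
    then obtain xs where xs: "secured S xs" "F \<subseteq> set xs" "set xs \<subseteq> C"
      by auto
    obtain ys where ys: "ys \<noteq> []" "last ys = x" "set ys \<subseteq> C" "secured S ys"
      using configuration_secured[OF assms(1)] insert.prems by auto
    have "x \<in> set ys"
      using ys(1,2) by auto
    then show ?case
      using xs ys secured_append[of xs ys] by (intro exI[of _ "xs @ ys"]) auto
  qed
  from this[OF assms(2) subset_refl] that show ?thesis
    by blast
qed

lemma configuration_insert:
  assumes "configuration S C" "enables S C e" "es_consistent S (insert e C)"
  shows "configuration S (insert e C)"
proof -
  obtain xs where "secured S xs" "set xs = C"
    using assms finite_configuration_secured enables_finite by metis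
  then show ?thesis
    using assms configuration_set[of "xs @ [e]"] by (simp add: secured_snoc)
qed

text \<open>In a securing of \<open>x\<close> inside \<open>C\<close>, everything before the first
  entry outside \<open>A\<close> lies in \<open>A\<close>, so that entry is enabled at
  \<open>A\<close>. This lets a configuration grow towards a larger one, one event at a
  time.\<close>

lemma configuration_subset_enables:
  assumes A: "configuration S A" "finite A" and C: "configuration S C" and x: "x \<in> C" "x \<notin> A"
  obtains e where "e \<in> C" "e \<notin> A" "enables S A e"
proof -
  obtain xs where xs: "xs \<noteq> []" "last xs = x" "set xs \<subseteq> C" "secured S xs"
    using configuration_secured C x by metis
  have "\<exists>y\<in>set xs. y \<notin> A"
    using xs(1,2) x(2) last_in_set by blast
  then obtain ys y zs where yz: "xs = ys @ y # zs" "y \<notin> A" "\<forall>z\<in>set ys. z \<in> A"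
    using split_list_first_prop[of xs "\<lambda>y. y \<notin> A"] by auto
  have "enables S (set ys) y"
    using xs(4) secured_take[of S xs "Suc (length ys)"] by (simp add: yz secured_snoc)
  then have "enables S A y"
    by (rule enables_mono) (use A yz(3) configurationD(1) in auto)
  then show ?thesis
    using that yz xs(3) by auto
qed

section \<open>Minimal enablings inside a configuration\<close>

lemma min_enables_exists:
  assumes "configuration S C" "enables S C e"
  obtains M where "min_enables S M e" "M \<subseteq> C"
proof -
  let ?F = "{M. M \<subseteq> C \<and> configuration S M \<and> enables S M e}"
  have "finite C"
    using assms enables_finite by blast
  then have fin: "finite ?F"
    by (rule finite_subset[rotated, OF finite_Pow_iff[THEN iffD2]]) auto
  moreover have "C \<in> ?F"
    using assms by simp
  ultimately have "\<exists>M\<in>?F. M \<subseteq> C \<and> (\<forall>M'\<in>?F. M' \<subseteq> M \<longrightarrow> M = M')"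
    by (rule finite_has_minimal2)
  then obtain M where "M \<in> ?F" "\<forall>M'\<in>?F. M' \<subseteq> M \<longrightarrow> M = M'"
    by (elim bexE conjE) (rule that)
  then have "min_enables S M e" "M \<subseteq> C"
    unfolding min_enables_def by auto
  then show ?thesis
    by (rule that)
qed

lemma min_enablesD:
  assumes "min_enables S M e"
  shows "configuration S M" "enables S M e" "finite M" "M \<subseteq> events S" "e \<in> events S"
  using assms enables_finite configurationD(1) enables_events by (auto simp: min_enables_def)

lemma configuration_min_enables:
  assumes "configuration S C" "e \<in> C"
  obtains M where "min_enables S M e" "M \<subseteq> C - {e}"
proof -
  obtain xs where xs: "xs \<noteq> []" "last xs = e" "set xs \<subseteq> C" "secured S xs"
    using configuration_secured assms by metis
  then have "e \<in> set xs"
    by auto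
  \<comment> \<open>A securing may contain \<open>e\<close> several times. Cutting at the first
    occurrence keeps \<open>e\<close> out of the prefix, which is what puts the enabling inside
    \<open>C - {e}\<close>.\<close>
  then obtain ys zs where yz: "xs = ys @ e # zs" "e \<notin> set ys"
    by (metis split_list_first)
  have "secured S ys" "enables S (set ys) e"
    using xs(4) secured_take[of S xs "Suc (length ys)"] by (auto simp: yz secured_snoc)
  moreover have "es_consistent S (set ys)"
    by (rule es_consistent_subset[OF configurationD(3)[OF assms(1)]]) (use xs yz in auto)
  ultimately obtain M where "min_enables S M e" "M \<subseteq> set ys"
    using configuration_set min_enables_exists by metis
  moreover have "set ys \<subseteq> C - {e}"
    using xs(3) yz by auto
  ultimately show ?thesis
    using that by blast
qed

text \<open>Otherwise \<open>M - {e}\<close> would contain another minimal enabling of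
  \<open>e\<close>, against the minimality of \<open>M\<close>.\<close>

lemma min_enables_not_mem: "min_enables S M e \<Longrightarrow> e \<notin> M"
proof
  assume M: "min_enables S M e" and "e \<in> M"
  then obtain M' where M': "min_enables S M' e" "M' \<subseteq> M - {e}"
    using configuration_min_enables min_enablesD(1) by blast
  then have "M' = M"
    using M unfolding min_enables_def by blast
  then show False
    using M'(2) \<open>e \<in> M\<close> by blast
qed

lemma not_occurs_in_self: "\<not> occurs_in S e e u"
  using min_enables_not_mem by (auto simp: occurs_in_def choices_def PiE_def)

end

section \<open>Consequences of liveness and connectedness\<close>

locale live_es = es_base S for S :: "'e es" +
  assumes live: "live S"
begin

text \<open>Liveness forces conflict wherever two events have no common configuration; the converse
  is consistency of configurations. Symmetry of conflict follows, since the right-hand side is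
  symmetric.\<close>

lemma conflict_iff:
  assumes "e \<in> events S" "e' \<in> events S"
  shows "conflict S e e' \<longleftrightarrow> (\<nexists>C. configuration S C \<and> e \<in> C \<and> e' \<in> C)"
proof
  show "conflict S e e' \<Longrightarrow> \<nexists>C. configuration S C \<and> e \<in> C \<and> e' \<in> C"
    using configurationD(2) by metis
  show "\<nexists>C. configuration S C \<and> e \<in> C \<and> e' \<in> C \<Longrightarrow> conflict S e e'"
    using assms live unfolding live_def by simp
qed

lemma conflict_sym: "conflict S e e' \<Longrightarrow> conflict S e' e"
  using conflict_iff conflict_events by metis

lemma conflict_irrefl: "\<not> conflict S e e"
  using live conflict_events[of e e] unfolding live_def by metis

lemma event_in_configuration:
  assumes "e \<in> events S" obtains C where "configuration S C" "e \<in> C"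
  using assms conflict_iff conflict_irrefl by metis

end

locale live_connected_es = live_es S for S :: "'e es" +
  assumes conn: "connected_es S"
begin

text \<open>The first link of a chain leaving \<open>M\<close> contains the consistency of
  \<open>M \<union> B \<union> {e}\<close>. A chain that really leaves \<open>M\<close> needs a
  second minimal enabling: liveness puts \<open>e\<close> into some configuration, which contains
  one, \<open>M0\<close>. If \<open>M = M0\<close>, that configuration itself shows
  consistency.\<close>

lemma min_enables_consistent:
  assumes M: "min_enables S M e"
  shows "es_consistent S (insert e M)"
proof -
  obtain C where C: "configuration S C" "e \<in> C"
    using min_enablesD(5)[OF M] event_in_configuration by blast
  then obtain M0 where M0: "min_enables S M0 e" "M0 \<subseteq> C - {e}"
    by (rule configuration_min_enables)
  show ?thesis
  proof (cases "M = M0")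
    case True
    then show ?thesis
      using es_consistent_subset[OF configurationD(3)[OF C(1)], of "insert e M"] C M0 by auto
  next
    case False
    have "(\<lambda>A B. min_enables S A e \<and> min_enables S B e \<and> es_consistent S (A \<union> B \<union> {e}))\<^sup>*\<^sup>* M M0"
      using conn M M0(1) unfolding connected_es_def by blast
    then obtain B where "es_consistent S (M \<union> B \<union> {e})"
      using False by (auto elim: converse_rtranclpE)
    then show ?thesis
      by (rule es_consistent_subset) auto
  qed
qed

lemma min_enables_configuration: "min_enables S M e \<Longrightarrow> configuration S (insert e M)"
  using configuration_insert min_enables_consistent min_enablesD by blast

text \<open>So the top event of an irreducible configuration is well defined. If
  \<open>e \<noteq> e'\<close>, then \<open>M'\<close> contains \<open>e\<close> and hence a minimal
  enabling of \<open>e\<close> inside \<open>M' - {e}\<close>, which lies in \<open>M\<close>; by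
  minimality it is \<open>M\<close>, and \<open>e' \<in> M\<close> would lie in
  \<open>M'\<close>.\<close>

lemma min_enables_insert_unique:
  assumes M: "min_enables S M e" and M': "min_enables S M' e'" and eq: "insert e M = insert e' M'"
  shows "e = e'"
proof (rule ccontr)
  assume "e \<noteq> e'"
  then have "e \<in> M'" "e' \<in> M"
    using eq by auto
  then obtain N where N: "min_enables S N e" "N \<subseteq> M' - {e}"
    using configuration_min_enables min_enablesD(1)[OF M'] by blast
  then have "N \<subseteq> M"
    using eq by auto
  then have "N = M"
    using N(1) M unfolding min_enables_def by blast
  then show False
    using N(2) \<open>e' \<in> M\<close> min_enables_not_mem[OF M'] by auto
qed

text \<open>A choice missed by \<open>A\<close> can be formed iff every minimal enabling has an
  event outside \<open>A\<close>. If \<open>{}\<close> is a minimal enabling there are no choices at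
  all, and both sides hold.\<close>

lemma choices_hit_iff:
  assumes e: "e \<in> events S"
  shows "(\<forall>u\<in>choices S e. \<exists>a\<in>A. occurs_in S a e u) \<longleftrightarrow> (\<exists>M. min_enables S M e \<and> M \<subseteq> A)"
proof
  assume L: "\<forall>u\<in>choices S e. \<exists>a\<in>A. occurs_in S a e u"
  show "\<exists>M. min_enables S M e \<and> M \<subseteq> A"
  proof (rule ccontr)
    assume *: "\<nexists>M. min_enables S M e \<and> M \<subseteq> A"
    define u where "u = (\<lambda>X\<in>{X. min_enables S X e}. SOME x. x \<in> X - A)"
    have u: "u X \<in> X - A" if "min_enables S X e" for X
    proof -
      have "\<exists>x. x \<in> X - A"
        using that * by blast
      then show ?thesis
        using that by (simp add: u_def) (metis (lifting) DiffE someI_ex)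
    qed
    then have "u \<in> choices S e"
      by (auto simp: choices_def PiE_def u_def)
    then show False
      using L u by (auto simp: occurs_in_def)
  qed
next
  assume "\<exists>M. min_enables S M e \<and> M \<subseteq> A"
  then show "\<forall>u\<in>choices S e. \<exists>a\<in>A. occurs_in S a e u"
    by (auto simp: occurs_in_def choices_def PiE_def Pi_def)
qed

end

section \<open>The event structure of a domain of configurations\<close>

text \<open>Only the order enters \<open>es_of_domain\<close>, so the domain is any set
  order-isomorphic to the configurations; the ideals of traces are put in at the very end.\<close>

locale configuration_domain = live_connected_es S for S :: "'e es" +
  fixes D :: "'d::order set" and \<phi> :: "'d \<Rightarrow> 'e set"
  assumes bij: "bij_betw \<phi> D {C. configuration S C}"
    and le_iff: "x \<in> D \<Longrightarrow> y \<in> D \<Longrightarrow> x \<le> y \<longleftrightarrow> \<phi> x \<subseteq> \<phi> y"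
begin

lemma conf: "x \<in> D \<Longrightarrow> configuration S (\<phi> x)"
  using bij by (auto simp: bij_betw_def)

lemma phi_surj:
  assumes "configuration S C" obtains x where "x \<in> D" "\<phi> x = C"
proof -
  have "C \<in> \<phi> ` D"
    using assms bij by (simp add: bij_betw_def)
  then show ?thesis
    using that by blast
qed

lemma phi_eq_iff: "x \<in> D \<Longrightarrow> y \<in> D \<Longrightarrow> \<phi> x = \<phi> y \<longleftrightarrow> x = y"
  using bij by (auto simp: bij_betw_def inj_on_eq_iff)

lemma less_iff: "x \<in> D \<Longrightarrow> y \<in> D \<Longrightarrow> x < y \<longleftrightarrow> \<phi> x \<subset> \<phi> y"
  using le_iff[of x y] phi_eq_iff[of x y] by (auto simp: less_le)

section \<open>Joins, compact elements and irreducibles\<close>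

lemma is_join_iff:
  assumes "X \<subseteq> D" "configuration S (\<Union>(\<phi> ` X))" "s \<in> D"
  shows "is_join D X s \<longleftrightarrow> \<phi> s = \<Union>(\<phi> ` X)"
proof
  obtain u where u: "u \<in> D" "\<phi> u = \<Union>(\<phi> ` X)"
    using phi_surj assms(2) by blast
  assume "is_join D X s"
  moreover have "x \<le> u" if "x \<in> X" for x
    using that u assms(1) le_iff[of x u] by auto
  ultimately have "s \<le> u" "\<And>x. x \<in> X \<Longrightarrow> x \<le> s"
    using u(1) by (auto simp: is_join_def)
  then have "\<phi> s \<subseteq> \<phi> u" "\<And>x. x \<in> X \<Longrightarrow> \<phi> x \<subseteq> \<phi> s"
    using u(1) assms(1,3) le_iff[of s u] le_iff[of _ s] by (simp, blast)
  then show "\<phi> s = \<Union>(\<phi> ` X)"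
    using u(2) by auto
next
  assume s: "\<phi> s = \<Union>(\<phi> ` X)"
  show "is_join D X s"
    unfolding is_join_def
  proof (intro conjI ballI impI)
    show "x \<le> s" if "x \<in> X" for x
      using that assms(1,3) s le_iff[of x s] by auto
    show "s \<le> y" if "y \<in> D" "\<forall>x\<in>X. x \<le> y" for y
    proof -
      have "\<phi> x \<subseteq> \<phi> y" if "x \<in> X" for x
        using that \<open>y \<in> D\<close> \<open>\<forall>x\<in>X. x \<le> y\<close> assms(1) le_iff[of x y] by auto
      then show ?thesis
        using s le_iff[OF assms(3) \<open>y \<in> D\<close>] by auto
    qed
  qed (fact assms(3))
qed

lemma configuration_Union_bounded:
  assumes "X \<subseteq> D" "consistent_in D X"
  shows "configuration S (\<Union>(\<phi> ` X))"
proof -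
  obtain d where d: "d \<in> D" "\<forall>x\<in>X. x \<le> d"
    using assms(2) by (auto simp: consistent_in_def)
  then have "\<Union>(\<phi> ` X) \<subseteq> \<phi> d"
    using assms(1) le_iff by blast
  then have "es_consistent S (\<Union>(\<phi> ` X))"
    using d(1) conf configurationD(3) es_consistent_subset by blast
  then show ?thesis
    by (rule configuration_Union[rotated]) (use assms(1) conf in auto)
qed

lemma join_bounded:
  assumes "X \<subseteq> D" "consistent_in D X"
  shows "join D X \<in> D" "\<phi> (join D X) = \<Union>(\<phi> ` X)"
proof -
  note c = configuration_Union_bounded[OF assms]
  obtain s where s: "s \<in> D" "\<phi> s = \<Union>(\<phi> ` X)"
    using c phi_surj by blast
  have j: "is_join D X t \<longleftrightarrow> t = s" for t
  proof (cases "t \<in> D")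
    case True
    then show ?thesis
      using is_join_iff[OF assms(1) c True] s phi_eq_iff[OF True s(1)] by simp
  qed (use s in \<open>auto simp: is_join_def\<close>)
  then have "join D X = s"
    unfolding join_def by (intro the_equality) auto
  then show "join D X \<in> D" "\<phi> (join D X) = \<Union>(\<phi> ` X)"
    using s by auto
qed

lemma directed_finite_subset:
  assumes X: "directed_in D X" and F: "finite F" "F \<subseteq> \<Union>(\<phi> ` X)"
  shows "\<exists>x\<in>X. F \<subseteq> \<phi> x"
  using F
proof (induction F rule: finite_induct)
  case empty
  then show ?case using X by (auto simp: directed_in_def)
next
  case (insert a F)
  then obtain x y where xy: "x \<in> X" "F \<subseteq> \<phi> x" "y \<in> X" "a \<in> \<phi> y"
    by auto
  then obtain z where z: "z \<in> X" "x \<le> z" "y \<le> z"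
    using X unfolding directed_in_def by blast
  have "x \<in> D" "y \<in> D" "z \<in> D"
    using X xy z unfolding directed_in_def by auto
  then have "insert a F \<subseteq> \<phi> z"
    using le_iff z xy by blast
  then show ?case
    using z(1) by blast
qed

text \<open>An element is the directed join of its finite subconfigurations, since each event
  \<open>e\<close> sits in a finite one, \<open>insert e M\<close>; a compact element must lie below
  one of them. Conversely, a finite set is absorbed by a single member of a directed family.\<close>

lemma compacts_iff: "d \<in> compacts D \<longleftrightarrow> d \<in> D \<and> finite (\<phi> d)"
proof
  assume d: "d \<in> compacts D"
  then have dD: "d \<in> D"
    by (simp add: compacts_def)
  define X where "X = {x \<in> D. finite (\<phi> x) \<and> \<phi> x \<subseteq> \<phi> d}"
  have sub: "X \<subseteq> D"
    by (auto simp: X_def)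
  have get: "\<exists>x\<in>X. \<phi> x = C" if "configuration S C" "finite C" "C \<subseteq> \<phi> d" for C
  proof -
    obtain x where "x \<in> D" "\<phi> x = C"
      using phi_surj[OF \<open>configuration S C\<close>] by blast
    then show ?thesis
      using that by (auto simp: X_def)
  qed
  have dir: "directed_in D X"
    unfolding directed_in_def
  proof (intro conjI ballI)
    show "X \<noteq> {}"
      using get[of "{}"] by auto
    fix x y assume xy: "x \<in> X" "y \<in> X"
    have "configuration S (\<phi> x \<union> \<phi> y)"
      by (rule configuration_Un, insert xy, auto simp: X_def intro: conf)
        (rule es_consistent_subset[OF configurationD(3)[OF conf[OF dD]]], auto)
    moreover have "finite (\<phi> x \<union> \<phi> y)" "\<phi> x \<union> \<phi> y \<subseteq> \<phi> d"
      using xy by (auto simp: X_def)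
    ultimately obtain z where z: "z \<in> X" "\<phi> z = \<phi> x \<union> \<phi> y"
      using get by blast
    have "x \<in> D" "y \<in> D" "z \<in> D"
      using sub xy z by auto
    then show "\<exists>z\<in>X. x \<le> z \<and> y \<le> z"
      using z le_iff[of x z] le_iff[of y z] by (intro bexI[of _ z]) simp_all
  qed (fact sub)
  have un: "\<Union>(\<phi> ` X) = \<phi> d"
  proof
    show "\<phi> d \<subseteq> \<Union>(\<phi> ` X)"
    proof
      fix e assume e: "e \<in> \<phi> d"
      then obtain M where M: "min_enables S M e" "M \<subseteq> \<phi> d - {e}"
        using conf[OF dD] configuration_min_enables by blast
      have "\<exists>x\<in>X. \<phi> x = insert e M"
        by (rule get) (use M e min_enables_configuration min_enablesD in auto)
      then show "e \<in> \<Union>(\<phi> ` X)"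
        by blast
    qed
  qed (auto simp: X_def)
  have "is_join D X d"
    using is_join_iff[of X d] sub dD un conf by auto
  then obtain x where "x \<in> X" "d \<le> x"
    using d dir unfolding compacts_def by blast
  then show "d \<in> D \<and> finite (\<phi> d)"
    using le_iff[of d x] dD finite_subset[of "\<phi> d" "\<phi> x"] by (simp add: X_def)
next
  assume d: "d \<in> D \<and> finite (\<phi> d)"
  have "\<exists>x\<in>X. d \<le> x" if X: "directed_in D X" and s: "is_join D X s" "d \<le> s" for X s
  proof -
    have sub: "X \<subseteq> D" and sD: "s \<in> D"
      using X s by (auto simp: directed_in_def is_join_def)
    have "consistent_in D X"
      using s(1) by (auto simp: consistent_in_def is_join_def)
    then have "\<phi> s = \<Union>(\<phi> ` X)"
      using is_join_iff[OF sub _ sD] configuration_Union_bounded[OF sub] s(1) by blast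
    then obtain x where "x \<in> X" "\<phi> d \<subseteq> \<phi> x"
      using directed_finite_subset[OF X, of "\<phi> d"] d s(2) le_iff[of d s] sD by auto
    then show ?thesis
      using le_iff d sub by blast
  qed
  then show "d \<in> compacts D"
    using d by (auto simp: compacts_def)
qed

text \<open>An irreducible is not the join of its proper subconfigurations, so some event
  \<open>e\<close> lies in none of them; as \<open>insert e M\<close> is a subconfiguration with
  \<open>e\<close>, it is everything. Conversely, if \<open>insert e M\<close> is a join, a joined
  element containing \<open>e\<close> contains a minimal enabling of \<open>e\<close> inside
  \<open>M\<close>, hence \<open>M\<close> itself.\<close>

lemma irreducible_iff:
  "i \<in> irreducibles D \<longleftrightarrow> i \<in> D \<and> (\<exists>e M. min_enables S M e \<and> \<phi> i = insert e M)"
proof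
  assume i: "i \<in> irreducibles D"
  then have iD: "i \<in> D" and fin: "finite (\<phi> i)"
    using compacts_iff by (auto simp: irreducibles_def)
  define X where "X = {x \<in> D. \<phi> x \<subset> \<phi> i}"
  have sub: "X \<subseteq> D" "X \<subseteq> compacts D"
    using fin compacts_iff by (auto simp: X_def intro: finite_subset)
  have bnd: "consistent_in D Y" if "Y \<subseteq> X" for Y
    unfolding consistent_in_def by (rule bexI[OF _ iD]) (use that iD le_iff in \<open>auto simp: X_def\<close>)
  have "\<not> is_join D X i"
  proof
    assume "is_join D X i"
    moreover have "\<forall>x\<in>X. \<forall>y\<in>X. consistent_in D {x, y}"
      using bnd by simp
    ultimately have "i \<in> X"
      using i sub(2) unfolding irreducibles_def by blast
    then show False
      by (simp add: X_def)
  qed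
  then have "\<Union>(\<phi> ` X) \<noteq> \<phi> i"
    using is_join_iff[OF sub(1) configuration_Union_bounded[OF sub(1) bnd[OF subset_refl]] iD] by simp
  moreover have "\<Union>(\<phi> ` X) \<subseteq> \<phi> i"
    by (auto simp: X_def)
  ultimately obtain e where e: "e \<in> \<phi> i" "\<And>x. x \<in> X \<Longrightarrow> e \<notin> \<phi> x"
    by blast
  then obtain M where M: "min_enables S M e" "M \<subseteq> \<phi> i - {e}"
    using conf[OF iD] configuration_min_enables by blast
  obtain x where x: "x \<in> D" "\<phi> x = insert e M"
    using phi_surj min_enables_configuration[OF M(1)] by blast
  have "x \<notin> X"
    using e(2) x(2) by blast
  then have "\<phi> i = insert e M"
    using x M(2) e(1) by (auto simp: X_def)
  then show "i \<in> D \<and> (\<exists>e M. min_enables S M e \<and> \<phi> i = insert e M)"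
    using iD M(1) by blast
next
  assume "i \<in> D \<and> (\<exists>e M. min_enables S M e \<and> \<phi> i = insert e M)"
  then obtain e M where iD: "i \<in> D" and M: "min_enables S M e" and i: "\<phi> i = insert e M"
    by blast
  have "i \<in> X" if X: "X \<subseteq> compacts D" and j: "is_join D X i" for X
  proof -
    have sub: "X \<subseteq> D"
      using X compacts_iff by auto
    have "consistent_in D X"
      using j by (auto simp: consistent_in_def is_join_def)
    then have un: "\<phi> i = \<Union>(\<phi> ` X)"
      using is_join_iff[OF sub _ iD] configuration_Union_bounded[OF sub] j by blast
    then have "e \<in> \<Union>(\<phi> ` X)"
      using i by blast
    then obtain x where x: "x \<in> X" "e \<in> \<phi> x" "\<phi> x \<subseteq> \<phi> i"
      using un by auto
    then obtain N where N: "min_enables S N e" "N \<subseteq> \<phi> x - {e}"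
      using sub conf[of x] configuration_min_enables[of "\<phi> x" e] by auto
    then have "N \<subseteq> M"
      using x i by auto
    then have "N = M"
      using N(1) M unfolding min_enables_def by blast
    then have "\<phi> x = \<phi> i"
      using x N(2) i by auto
    then show ?thesis
      using x(1) sub iD phi_eq_iff by blast
  qed
  then show "i \<in> irreducibles D"
    using iD i M min_enablesD(3) compacts_iff by (auto simp: irreducibles_def)
qed

text \<open>The event of the domain that corresponds to \<open>e\<close>: this set turns out to be a
  full class of irreducibles, and \<open>irrs_of\<close> is the isomorphism.\<close>

definition irrs_of :: "'e \<Rightarrow> 'd set" where
  "irrs_of e = {i \<in> D. \<exists>M. min_enables S M e \<and> \<phi> i = insert e M}"

lemma irrs_of_irreducible: "i \<in> irrs_of e \<Longrightarrow> i \<in> irreducibles D"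
  using irreducible_iff by (auto simp: irrs_of_def)

lemma irrs_of_unique: "i \<in> irrs_of e \<Longrightarrow> i \<in> irrs_of e' \<Longrightarrow> e = e'"
  using min_enables_insert_unique by (auto simp: irrs_of_def)

lemma irreducible_below:
  assumes "d \<in> D" "e \<in> \<phi> d"
  obtains j where "j \<in> irrs_of e" "j \<le> d"
proof -
  obtain M where M: "min_enables S M e" "M \<subseteq> \<phi> d - {e}"
    using conf[OF assms(1)] assms(2) configuration_min_enables by blast
  then obtain x where x: "x \<in> D" "\<phi> x = insert e M"
    using phi_surj min_enables_configuration by blast
  then have "x \<le> d"
    using assms M(2) le_iff by auto
  then show ?thesis
    using that x M(1) by (auto simp: irrs_of_def)
qed

text \<open>A subconfiguration of \<open>\<phi> i\<close> containing \<open>e\<close> contains a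
  minimal enabling of \<open>e\<close>, necessarily \<open>M\<close>, and so is all of
  \<open>\<phi> i\<close>. Thus the configuration \<open>M\<close> is the unique immediate
  predecessor of \<open>i\<close>.\<close>

lemma irr_lessD:
  assumes i: "i \<in> D" "\<phi> i = insert e M" "min_enables S M e" and j: "j \<in> irreducibles D" "j \<le> i" "j \<noteq> i"
  shows "\<phi> j \<subseteq> M"
proof -
  have jD: "j \<in> D"
    using j irreducible_iff by blast
  have sub: "\<phi> j \<subseteq> insert e M"
    using j i jD le_iff by auto
  have "e \<notin> \<phi> j"
  proof
    assume e: "e \<in> \<phi> j"
    then obtain N where N: "min_enables S N e" "N \<subseteq> \<phi> j - {e}"
      using conf[OF jD] configuration_min_enables by blast
    then have "N \<subseteq> M"
      using sub by blast
    then have "N = M"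
      using N(1) i(3) unfolding min_enables_def by blast
    then have "\<phi> j = \<phi> i"
      using N(2) sub e i(2) by auto
    then show False
      using j(3) phi_eq_iff jD i(1) by blast
  qed
  then show ?thesis
    using sub by blast
qed

section \<open>Interchangeable irreducibles and their classes\<close>

lemma closed_irrs_cover:
  assumes i: "i \<in> D" "\<phi> i = insert e M" "min_enables S M e"
    and X: "closed_consistent_irrs D (X \<union> {i})"
  shows "M \<subseteq> \<Union>(\<phi> ` X)"
proof
  fix a assume a: "a \<in> M"
  obtain m where m: "m \<in> D" "\<phi> m = M"
    using phi_surj min_enablesD(1)[OF i(3)] by blast
  then obtain j where j: "j \<in> irrs_of a" "j \<le> m"
    using irreducible_below a by blast
  have jD: "j \<in> D" "a \<in> \<phi> j" "\<phi> j \<subseteq> M"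
    using j m le_iff by (auto simp: irrs_of_def)
  have "j \<le> i"
    using jD i m le_iff by auto
  then have "j \<in> X \<union> {i}"
    using X irrs_of_irreducible[OF j(1)] unfolding closed_consistent_irrs_def by blast
  moreover have "j \<noteq> i"
    using jD(3) i min_enables_not_mem by blast
  ultimately show "a \<in> \<Union>(\<phi> ` X)"
    using jD by blast
qed

text \<open>Downward closure puts all irreducibles strictly below \<open>i\<close> into
  \<open>X\<close>, and they already cover \<open>M\<close>; so \<open>i\<close> contributes at most
  the single event \<open>e\<close>. Interchangeability thereby becomes a comparison of single
  events.\<close>

lemma closed_irrs_join:
  assumes i: "i \<in> D" "\<phi> i = insert e M" "min_enables S M e"
    and X: "closed_consistent_irrs D (X \<union> {i})"
  shows "join D (X \<union> {i}) \<in> D" "\<phi> (join D (X \<union> {i})) = insert e (\<Union>(\<phi> ` X))"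
    "join D X \<in> D" "\<phi> (join D X) = \<Union>(\<phi> ` X)"
proof -
  have sub: "X \<union> {i} \<subseteq> D" and c: "consistent_in D (X \<union> {i})"
    using X irreducible_iff by (auto simp: closed_consistent_irrs_def)
  from join_bounded[OF this]
  show "join D (X \<union> {i}) \<in> D" "\<phi> (join D (X \<union> {i})) = insert e (\<Union>(\<phi> ` X))"
    using closed_irrs_cover[OF i X] i(2) by auto
  have "consistent_in D X"
    using c by (auto simp: consistent_in_def)
  then show "join D X \<in> D" "\<phi> (join D X) = \<Union>(\<phi> ` X)"
    using join_bounded[of X] sub by auto
qed

text \<open>For the witnessing \<open>X\<close> each of the two joins adds at most one event to the
  join of \<open>X\<close>. The joins agree and differ from that of \<open>X\<close>, so the added
  event is the same.\<close>

lemma interchangeable_same_event: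
  assumes "(i, i') \<in> interchangeable D" "i \<in> irrs_of e"
  shows "i' \<in> irrs_of e"
proof -
  obtain M where i: "i \<in> D" "\<phi> i = insert e M" "min_enables S M e"
    using assms(2) by (auto simp: irrs_of_def)
  have "i' \<in> irreducibles D"
    using assms(1) by (simp add: interchangeable_def)
  then obtain e' M' where i': "i' \<in> D" "\<phi> i' = insert e' M'" "min_enables S M' e'"
    using irreducible_iff by auto
  obtain X where X: "closed_consistent_irrs D (X \<union> {i})" "closed_consistent_irrs D (X \<union> {i'})"
    "join D X \<noteq> join D (X \<union> {i})" "join D (X \<union> {i}) = join D (X \<union> {i'})"
    using assms(1) unfolding interchangeable_def by blast
  note 1 = closed_irrs_join[OF i X(1)] and 2 = closed_irrs_join[OF i' X(2)]
  have "insert e (\<Union>(\<phi> ` X)) = insert e' (\<Union>(\<phi> ` X))"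
    using 1(2) 2(2) X(4) by simp
  moreover have "\<Union>(\<phi> ` X) \<noteq> insert e (\<Union>(\<phi> ` X))"
    using 1 X(3) phi_eq_iff by metis
  ultimately have "e = e'"
    by blast
  then show ?thesis
    using i' by (auto simp: irrs_of_def)
qed

lemma interchangeable_consistent:
  assumes i: "i \<in> D" "\<phi> i = insert e M" "min_enables S M e"
    and i': "i' \<in> D" "\<phi> i' = insert e M'" "min_enables S M' e"
    and c: "es_consistent S (M \<union> M' \<union> {e})"
  shows "(i, i') \<in> interchangeable D"
proof -
  have irr: "i \<in> irreducibles D" "i' \<in> irreducibles D"
    using i i' irreducible_iff by auto
  \<comment> \<open>Equality of the joins is automatic: both add \<open>e\<close> to the same
    union.\<close>
  have 1: "join D (X \<union> {i}) = join D (X \<union> {i'})"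
    if X: "closed_consistent_irrs D (X \<union> {i})" "closed_consistent_irrs D (X \<union> {i'})" for X
    using closed_irrs_join(1,2)[OF i X(1)] closed_irrs_join(1,2)[OF i' X(2)] phi_eq_iff by metis
  \<comment> \<open>All irreducibles inside \<open>M \<union> M'\<close>: enough to be downward
    closed together with either of \<open>i\<close> and \<open>i'\<close>, and still missing
    \<open>e\<close>, so that adding \<open>i\<close> changes the join.\<close>
  define X where "X = {j \<in> irreducibles D. \<phi> j \<subseteq> M \<union> M'}"
  have XD: "X \<subseteq> irreducibles D" "X \<subseteq> D"
    using irreducible_iff by (auto simp: X_def)
  \<comment> \<open>The element \<open>d\<close> of this configuration bounds \<open>X\<close>,
    \<open>i\<close> and \<open>i'\<close> together; this is where \<open>M\<close> and
    \<open>M'\<close> must be compatible.\<close>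
  have "configuration S (insert e M \<union> insert e M')"
    by (rule configuration_Un) (use i i' c min_enables_configuration in \<open>auto simp: insert_commute Un_commute\<close>)
  then obtain d where d: "d \<in> D" "\<phi> d = insert e M \<union> insert e M'"
    using phi_surj by blast
  have cc: "closed_consistent_irrs D (X \<union> {k})"
    if k: "k \<in> D" "\<phi> k = insert e N" "min_enables S N e" "N = M \<or> N = M'" for k N
    unfolding closed_consistent_irrs_def
  proof (intro conjI ballI impI)
    have kirr: "k \<in> irreducibles D"
      using k irreducible_iff by auto
    then show "X \<union> {k} \<subseteq> irreducibles D"
      using XD(1) by simp
    show "consistent_in D (X \<union> {k})"
      unfolding consistent_in_def
    proof (rule bexI[OF _ d(1)], rule ballI)
      fix x assume x: "x \<in> X \<union> {k}"
      then have "\<phi> x \<subseteq> \<phi> d"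
        using d k by (auto simp: X_def)
      then show "x \<le> d"
        using x XD k(1) d(1) le_iff by auto
    qed
    fix x j assume x: "x \<in> X \<union> {k}" and j: "j \<in> irreducibles D" "j \<le> x"
    have jD: "j \<in> D"
      using j(1) irreducible_iff by auto
    show "j \<in> X \<union> {k}"
    proof (cases "x \<in> X")
      case True
      then have "\<phi> j \<subseteq> M \<union> M'"
        using j(2) jD XD le_iff[of j x] by (auto simp: X_def)
      then show ?thesis
        using j(1) by (simp add: X_def)
    next
      case False
      then have "x = k"
        using x by simp
      then show ?thesis
        using irr_lessD[OF k(1-3) j(1)] j k(4) by (auto simp: X_def)
    qed
  qed
  have X: "closed_consistent_irrs D (X \<union> {i})" "closed_consistent_irrs D (X \<union> {i'})"
    using cc i i' by blast+
  have "e \<notin> \<Union>(\<phi> ` X)"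
    using i i' min_enables_not_mem by (auto simp: X_def)
  then have "join D X \<noteq> join D (X \<union> {i})"
    using closed_irrs_join[OF i X(1)] by auto
  then show ?thesis
    using irr 1 X XD(1) unfolding interchangeable_def by blast
qed

text \<open>By \<open>interchangeable_same_event\<close> a class cannot leave
  \<open>irrs_of e\<close>; for the other inclusion, a chain of minimal enablings of
  \<open>e\<close> becomes a chain of interchangeable irreducibles.\<close>

lemma irr_class_eq:
  assumes "i \<in> irrs_of e"
  shows "irr_class D i = irrs_of e"
proof
  have "i' \<in> irrs_of e" if "(i, i') \<in> (interchangeable D)\<^sup>+" for i'
    using that by induction (use assms interchangeable_same_event in blast)+
  then show "irr_class D i \<subseteq> irrs_of e"
    by (auto simp: irr_class_def)
  obtain M where i: "i \<in> D" "\<phi> i = insert e M" "min_enables S M e"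
    using assms by (auto simp: irrs_of_def)
  show "irrs_of e \<subseteq> irr_class D i"
  proof
    fix i' assume "i' \<in> irrs_of e"
    then obtain M' where i': "i' \<in> D" "\<phi> i' = insert e M'" "min_enables S M' e"
      by (auto simp: irrs_of_def)
    have "(\<lambda>A B. min_enables S A e \<and> min_enables S B e \<and> es_consistent S (A \<union> B \<union> {e}))\<^sup>*\<^sup>* M M'"
      using conn i i' unfolding connected_es_def by blast
    then have "\<forall>k\<in>D. \<phi> k = insert e M' \<longrightarrow> (i, k) \<in> (interchangeable D)\<^sup>+"
    proof (induction rule: rtranclp_induct)
      case base
      \<comment> \<open>The closure is transitive but not reflexive by definition, so
        \<open>i\<close> must be shown interchangeable with itself.\<close>
      have "es_consistent S (M \<union> M \<union> {e})"
        using min_enables_consistent[OF i(3)] by simp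
      then show ?case
        using interchangeable_consistent[OF i _ _ i(3)] by blast
    next
      case (step A B)
      obtain j where j: "j \<in> D" "\<phi> j = insert e A"
        using step(2) phi_surj min_enables_configuration by blast
      have "(j, k) \<in> interchangeable D" if "k \<in> D" "\<phi> k = insert e B" for k
        using interchangeable_consistent[of j e A k B] j that step(2) by simp
      then show ?case
        using step.IH j by (blast intro: trancl_into_trancl)
    qed
    then show "i' \<in> irr_class D i"
      using i' by (simp add: irr_class_def)
  qed
qed

section \<open>Events, conflict and enabling recovered from the domain\<close>

lemma irrs_of_nonempty:
  assumes "e \<in> events S" obtains i where "i \<in> irrs_of e"
proof -
  obtain C where C: "configuration S C" "e \<in> C"
    using event_in_configuration[OF assms] by blast
  obtain d where "d \<in> D" "\<phi> d = C"
    using phi_surj[OF C(1)] by blast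
  then show ?thesis
    using irreducible_below[of d e] C(2) that by auto
qed

lemma irrs_of_event: "i \<in> irrs_of e \<Longrightarrow> e \<in> events S"
  using min_enablesD(5) by (auto simp: irrs_of_def)

lemma irreducible_irrs_of:
  assumes "i \<in> irreducibles D" obtains e where "i \<in> irrs_of e"
  using assms irreducible_iff that by (auto simp: irrs_of_def)

lemma irr_classes: "irr_class D ` irreducibles D = irrs_of ` events S"
proof
  show "irr_class D ` irreducibles D \<subseteq> irrs_of ` events S"
  proof clarify
    fix i assume "i \<in> irreducibles D"
    then obtain e where e: "i \<in> irrs_of e"
      by (rule irreducible_irrs_of)
    then show "irr_class D i \<in> irrs_of ` events S"
      using irr_class_eq[OF e] irrs_of_event[OF e] by simp
  qed
  show "irrs_of ` events S \<subseteq> irr_class D ` irreducibles D"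
  proof clarify
    fix e assume "e \<in> events S"
    then obtain i where i: "i \<in> irrs_of e"
      by (rule irrs_of_nonempty)
    then show "irrs_of e \<in> irr_class D ` irreducibles D"
      using irr_class_eq[OF i] irrs_of_irreducible[OF i] by blast
  qed
qed

lemma inj_irrs_of: "inj_on irrs_of (events S)"
proof (rule inj_onI)
  fix e e' assume "e \<in> events S" and eq: "irrs_of e = irrs_of e'"
  then obtain i where "i \<in> irrs_of e"
    using irrs_of_nonempty by blast
  then show "e = e'"
    using irrs_of_unique eq by simp
qed

lemma irr_classes_below:
  assumes "d \<in> D"
  shows "irr_class D ` {j \<in> irreducibles D. j \<le> d} = irrs_of ` \<phi> d"
proof
  show "irr_class D ` {j \<in> irreducibles D. j \<le> d} \<subseteq> irrs_of ` \<phi> d"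
  proof clarify
    fix j assume j: "j \<in> irreducibles D" "j \<le> d"
    then obtain e where e: "j \<in> irrs_of e"
      using irreducible_irrs_of by blast
    then have "e \<in> \<phi> d"
      using j(2) assms le_iff by (auto simp: irrs_of_def)
    then show "irr_class D j \<in> irrs_of ` \<phi> d"
      using irr_class_eq[OF e] by simp
  qed
  show "irrs_of ` \<phi> d \<subseteq> irr_class D ` {j \<in> irreducibles D. j \<le> d}"
  proof clarify
    fix e assume "e \<in> \<phi> d"
    then obtain j where j: "j \<in> irrs_of e" "j \<le> d"
      using assms irreducible_below by blast
    then have "irrs_of e = irr_class D j" "j \<in> irreducibles D"
      using irr_class_eq irrs_of_irreducible by auto
    then show "irrs_of e \<in> irr_class D ` {j \<in> irreducibles D. j \<le> d}"
      using j(2) by blast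
  qed
qed

text \<open>By \<open>irr_lessD\<close>, being strictly below \<open>i\<close> amounts to being
  below the element for \<open>M\<close>; so what \<open>i\<close> demands of an enabling set is
  exactly \<open>M\<close>.\<close>

lemma irr_classes_strictly_below:
  assumes i: "i \<in> D" "\<phi> i = insert e M" "min_enables S M e"
  shows "irr_class D ` {j \<in> irreducibles D. j < i} = irrs_of ` M"
proof -
  obtain m where m: "m \<in> D" "\<phi> m = M"
    using phi_surj min_enablesD(1)[OF i(3)] by blast
  have "j < i \<longleftrightarrow> j \<le> m" if j: "j \<in> irreducibles D" for j
  proof -
    have jD: "j \<in> D"
      using j irreducible_iff by auto
    show ?thesis
      using irr_lessD[OF i j] min_enables_not_mem[OF i(3)] i m jD le_iff less_iff
      by (auto simp: less_le)
  qed
  then have "{j \<in> irreducibles D. j < i} = {j \<in> irreducibles D. j \<le> m}"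
    by blast
  then show ?thesis
    using irr_classes_below[OF m(1)] m(2) by simp
qed

lemma conflict_es_of_domain:
  assumes "e \<in> events S" "e' \<in> events S"
  shows "conflict (es_of_domain D) (irrs_of e) (irrs_of e') \<longleftrightarrow> conflict S e e'"
proof -
  have mem: "irrs_of a \<in> irrs_of ` \<phi> d \<longleftrightarrow> a \<in> \<phi> d" if "a \<in> events S" "d \<in> D" for a d
    using that inj_irrs_of conf configurationD(1) by (simp add: inj_on_image_mem_iff)
  have "(\<exists>d\<in>compacts D. {irrs_of e, irrs_of e'} \<subseteq> irr_class D ` {j \<in> irreducibles D. j \<le> d}) \<longleftrightarrow>
      (\<exists>d\<in>compacts D. e \<in> \<phi> d \<and> e' \<in> \<phi> d)"
    using assms mem compacts_iff irr_classes_below by (intro bex_cong) auto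
  also have "\<dots> \<longleftrightarrow> (\<exists>C. configuration S C \<and> e \<in> C \<and> e' \<in> C)"
  proof
    show "\<exists>d\<in>compacts D. e \<in> \<phi> d \<and> e' \<in> \<phi> d \<Longrightarrow> \<exists>C. configuration S C \<and> e \<in> C \<and> e' \<in> C"
      using compacts_iff conf by blast
    assume "\<exists>C. configuration S C \<and> e \<in> C \<and> e' \<in> C"
    then obtain C where C: "configuration S C" "e \<in> C" "e' \<in> C"
      by blast
    \<comment> \<open>Conflict in the domain is decided by compact elements, so \<open>C\<close> is
      cut down to a finite configuration around \<open>e\<close> and \<open>e'\<close>.\<close>
    then obtain M M' where M: "min_enables S M e" "M \<subseteq> C - {e}" "min_enables S M' e'" "M' \<subseteq> C - {e'}"
      using configuration_min_enables by metis
    have "configuration S (insert e M \<union> insert e' M')"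
    proof (rule configuration_Un)
      show "es_consistent S (insert e M \<union> insert e' M')"
        by (rule es_consistent_subset[OF configurationD(3)[OF C(1)]]) (use C M in auto)
    qed (use M min_enables_configuration in auto)
    then obtain d where d: "d \<in> D" "\<phi> d = insert e M \<union> insert e' M'"
      using phi_surj by blast
    then have "d \<in> compacts D"
      using compacts_iff M min_enablesD(3) by auto
    then show "\<exists>d\<in>compacts D. e \<in> \<phi> d \<and> e' \<in> \<phi> d"
      using d(2) by blast
  qed
  finally have "\<not> (\<exists>d\<in>compacts D.
      {irrs_of e, irrs_of e'} \<subseteq> irr_class D ` {j \<in> irreducibles D. j \<le> d}) \<longleftrightarrow> conflict S e e'"
    using conflict_iff[OF assms] by blast
  then show ?thesis
    using assms by (simp only: es_of_domain_def es.simps irr_classes imageI simp_thms)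
qed

text \<open>Each irreducible with top event \<open>e\<close> demands one minimal enabling. So
  enabling in the domain is generated by minimal enablings; in \<open>S\<close> one is guaranteed
  only inside configurations, by \<open>min_enables_exists\<close>.\<close>

lemma enables_es_of_domain:
  assumes C: "C \<subseteq> events S" and e: "e \<in> events S"
  shows "enables (es_of_domain D) (irrs_of ` C) (irrs_of e) \<longleftrightarrow>
    finite C \<and> (\<exists>M. min_enables S M e \<and> M \<subseteq> C)"
proof -
  have fin: "finite (irrs_of ` C) \<longleftrightarrow> finite C"
    using C inj_irrs_of by (meson finite_image_iff inj_on_subset)
  have "(\<exists>i\<in>irrs_of e. irr_class D ` {j \<in> irreducibles D. j < i} \<subseteq> irrs_of ` C) \<longleftrightarrow>
      (\<exists>M. min_enables S M e \<and> M \<subseteq> C)"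
  proof
    assume "\<exists>i\<in>irrs_of e. irr_class D ` {j \<in> irreducibles D. j < i} \<subseteq> irrs_of ` C"
    then obtain i M where i: "i \<in> D" "\<phi> i = insert e M" "min_enables S M e"
      and sub: "irr_class D ` {j \<in> irreducibles D. j < i} \<subseteq> irrs_of ` C"
      by (auto simp: irrs_of_def)
    then have sub': "irrs_of ` M \<subseteq> irrs_of ` C"
      using irr_classes_strictly_below[OF i] by simp
    have "M \<subseteq> C"
    proof
      fix a assume a: "a \<in> M"
      then have "a \<in> events S" "irrs_of a \<in> irrs_of ` C"
        using sub' min_enablesD(4)[OF i(3)] by auto
      then show "a \<in> C"
        using inj_on_image_mem_iff[OF inj_irrs_of _ C] by simp
    qed
    then show "\<exists>M. min_enables S M e \<and> M \<subseteq> C"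
      using i(3) by blast
  next
    assume "\<exists>M. min_enables S M e \<and> M \<subseteq> C"
    then obtain M where M: "min_enables S M e" "M \<subseteq> C"
      by blast
    then obtain i where i: "i \<in> D" "\<phi> i = insert e M"
      using phi_surj min_enables_configuration by blast
    then have "i \<in> irrs_of e"
      using M by (auto simp: irrs_of_def)
    then show "\<exists>i\<in>irrs_of e. irr_class D ` {j \<in> irreducibles D. j < i} \<subseteq> irrs_of ` C"
      using irr_classes_strictly_below[OF i M(1)] M(2) by (intro bexI[of _ i]) auto
  qed
  then show ?thesis
    using fin C e unfolding es_of_domain_def by (auto simp: irr_classes)
qed

theorem es_isomorphic_es_of_domain: "es_isomorphic S (es_of_domain D)"
  unfolding es_isomorphic_def
proof
  show "es_iso S (es_of_domain D) irrs_of"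
    unfolding es_iso_def
  proof (intro conjI ballI allI impI)
    have "events (es_of_domain D) = irrs_of ` events S"
      using irr_classes by (simp add: es_of_domain_def)
    then show "bij_betw irrs_of (events S) (events (es_of_domain D))"
      using inj_irrs_of by (simp add: bij_betw_def)
  next
    fix e e' assume "e \<in> events S" "e' \<in> events S"
    then show "conflict S e e' = conflict (es_of_domain D) (irrs_of e) (irrs_of e')"
      using conflict_es_of_domain by simp
  next
    fix C e assume e: "e \<in> events S" and "configuration S C \<and> enables S C e"
    then have C: "configuration S C" "enables S C e"
      by auto
    then obtain M where "min_enables S M e" "M \<subseteq> C"
      using min_enables_exists by blast
    then show "enables (es_of_domain D) (irrs_of ` C) (irrs_of e)"
      using enables_es_of_domain[OF configurationD(1)[OF C(1)] e] enables_finite[OF C(2)] by blast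
  next
    fix C e assume C: "C \<subseteq> events S" and e: "e \<in> events S"
      and "configuration (es_of_domain D) (irrs_of ` C) \<and>
        enables (es_of_domain D) (irrs_of ` C) (irrs_of e)"
    then obtain M where M: "finite C" "min_enables S M e" "M \<subseteq> C"
      using enables_es_of_domain by blast
    then show "enables S C e"
      using enables_mono C min_enablesD(2) by blast
  qed
qed

end

section \<open>Typed graphs and pushouts\<close>

lemma fst_mor_comp [simp]: "fst (g \<odot> f) v = fst g (fst f v)"
  and snd_mor_comp [simp]: "snd (g \<odot> f) a = snd g (snd f a)"
  by (simp_all add: mor_comp_def)

lemma typed_morD:
  assumes "typed_mor G H f"
  shows "v \<in> nodes G \<Longrightarrow> fst f v \<in> nodes H" "v \<in> nodes G \<Longrightarrow> ntype H (fst f v) = ntype G v"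
    "a \<in> edges G \<Longrightarrow> snd f a \<in> edges H" "a \<in> edges G \<Longrightarrow> etype H (snd f a) = etype G a"
    "a \<in> edges G \<Longrightarrow> src H (snd f a) = fst f (src G a)"
    "a \<in> edges G \<Longrightarrow> tgt H (snd f a) = fst f (tgt G a)"
  using assms by (simp_all add: typed_mor_def)

lemma typed_graphD:
  assumes "typed_graph T G"
  shows "a \<in> edges G \<Longrightarrow> src G a \<in> nodes G" "a \<in> edges G \<Longrightarrow> tgt G a \<in> nodes G"
    "v \<in> nodes G \<Longrightarrow> ntype G v \<in> nodes T" "a \<in> edges G \<Longrightarrow> etype G a \<in> edges T"
    "a \<in> edges G \<Longrightarrow> src T (etype G a) = ntype G (src G a)"
    "a \<in> edges G \<Longrightarrow> tgt T (etype G a) = ntype G (tgt G a)"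
  using assms by (simp_all add: typed_graph_def is_graph_def)

lemma mor_eq_refl [simp]: "mor_eq G f f"
  by (simp add: mor_eq_def)

lemma mor_eq_sym: "mor_eq G f g \<Longrightarrow> mor_eq G g f"
  by (simp add: mor_eq_def)

lemma mor_eq_trans: "mor_eq G f g \<Longrightarrow> mor_eq G g h \<Longrightarrow> mor_eq G f h"
  by (simp add: mor_eq_def)

lemma mor_eq_comp_left: "mor_eq G f g \<Longrightarrow> mor_eq G (h \<odot> f) (h \<odot> g)"
  by (simp add: mor_eq_def)

lemma mor_comp_assoc: "h \<odot> (g \<odot> f) = h \<odot> g \<odot> f"
  by (simp add: mor_comp_def comp_assoc)

lemma typed_mor_id [simp]: "typed_mor G G (id, id)"
  by (simp add: typed_mor_def)

lemma typed_mor_comp: "typed_mor F G f \<Longrightarrow> typed_mor G H g \<Longrightarrow> typed_mor F H (g \<odot> f)"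
  by (simp add: typed_mor_def)

lemma typed_iso_mor: "typed_iso G H f \<Longrightarrow> typed_mor G H f"
  by (simp add: typed_iso_def)

lemma typed_iso_comp: "typed_iso F G f \<Longrightarrow> typed_iso G H g \<Longrightarrow> typed_iso F H (g \<odot> f)"
  by (auto simp: typed_iso_def mor_comp_def typed_mor_def intro: bij_betw_trans)

lemma typed_iso_id [simp]: "typed_iso G G (id, id)"
  by (simp add: typed_iso_def)

lemma mor_inv_left:
  assumes "typed_iso G H f"
  shows "mor_eq G (mor_inv G f \<odot> f) (id, id)"
  using assms by (auto simp: mor_eq_def mor_inv_def typed_iso_def intro: bij_betw_inv_into_left)

lemma mor_inv_right:
  assumes "typed_iso G H f"
  shows "mor_eq H (f \<odot> mor_inv G f) (id, id)"
  using assms by (auto simp: mor_eq_def mor_inv_def typed_iso_def intro: bij_betw_inv_into_right)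

lemma typed_iso_inv:
  assumes "typed_graph T G" "typed_iso G H f"
  shows "typed_iso H G (mor_inv G f)"
proof -
  have m: "typed_mor G H f" and bn: "bij_betw (fst f) (nodes G) (nodes H)"
    and be: "bij_betw (snd f) (edges G) (edges H)"
    using assms(2) by (auto simp: typed_iso_def)
  let ?n = "inv_into (nodes G) (fst f)" and ?e = "inv_into (edges G) (snd f)"
  have n: "?n v \<in> nodes G" "fst f (?n v) = v" if "v \<in> nodes H" for v
    using bn that bij_betw_inv_into_right bij_betw_apply[OF bij_betw_inv_into] by fastforce+
  have e: "?e a \<in> edges G" "snd f (?e a) = a" if "a \<in> edges H" for a
    using be that bij_betw_inv_into_right bij_betw_apply[OF bij_betw_inv_into] by fastforce+
  have nn: "?n (fst f v) = v" if "v \<in> nodes G" for v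
    using bn that by (rule bij_betw_inv_into_left)
  have "typed_mor H G (?n, ?e)"
    unfolding typed_mor_def
  proof (intro conjI ballI)
    fix v assume "v \<in> nodes H"
    then show "fst (?n, ?e) v \<in> nodes G" "ntype G (fst (?n, ?e) v) = ntype H v"
      using n[of v] typed_morD(2)[OF m, of "?n v"] by auto
  next
    fix a assume a: "a \<in> edges H"
    note m' = typed_morD[OF m]
    show "snd (?n, ?e) a \<in> edges G" "etype G (snd (?n, ?e) a) = etype H a"
      using e[OF a] m'(4)[of "?e a"] by auto
    show "src G (snd (?n, ?e) a) = fst (?n, ?e) (src H a)"
      "tgt G (snd (?n, ?e) a) = fst (?n, ?e) (tgt H a)"
      using e[OF a] m'(5,6)[of "?e a"] nn typed_graphD(1,2)[OF assms(1)] by (metis fst_conv snd_conv)+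
  qed
  then show ?thesis
    using bn be by (simp add: typed_iso_def mor_inv_def bij_betw_inv_into)
qed

text \<open>The choice is not vacuous: \<open>G\<close> itself is a candidate.\<close>

lemma can_typed_iso:
  assumes "typed_graph T G"
  shows "typed_graph T (can T G)" "\<exists>f. typed_iso (can T G) G f"
proof -
  have "\<exists>C. typed_graph T C \<and> (\<exists>f. typed_iso C G f)"
    using assms typed_iso_id by blast
  then have "typed_graph T (can T G) \<and> (\<exists>f. typed_iso (can T G) G f)"
    unfolding can_def by (rule someI_ex)
  then show "typed_graph T (can T G)" "\<exists>f. typed_iso (can T G) G f"
    by auto
qed

text \<open>Isomorphic graphs have the same candidates, so the choice operator returns literally the
  same graph.\<close>

lemma can_cong:
  assumes "typed_graph T G" "typed_iso G H f"
  shows "can T G = can T H"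
proof -
  have "(\<exists>g. typed_iso C G g) \<longleftrightarrow> (\<exists>g. typed_iso C H g)" for C
    using assms(2) typed_iso_inv[OF assms] typed_iso_comp by blast
  then show ?thesis
    by (simp add: can_def)
qed

text \<open>A subgraph is determined up to isomorphism by its image. This identifies the context of
  a given step with the standard one.\<close>

lemma typed_iso_same_image:
  assumes c: "typed_mor D G c" "inj_on (fst c) (nodes D)" "inj_on (snd c) (edges D)"
    and c0: "typed_mor D0 G c0" "inj_on (fst c0) (nodes D0)" "inj_on (snd c0) (edges D0)"
    and im: "fst c ` nodes D = fst c0 ` nodes D0" "snd c ` edges D = snd c0 ` edges D0"
    and D: "typed_graph T D"
  shows "typed_iso D0 D (mor_inv D c \<odot> c0)"
proof -
  let ?n = "inv_into (nodes D) (fst c)" and ?e = "inv_into (edges D) (snd c)"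
  have n: "?n (fst c0 v) \<in> nodes D" "fst c (?n (fst c0 v)) = fst c0 v" if "v \<in> nodes D0" for v
    using im(1) that by (metis image_eqI inv_into_into f_inv_into_f)+
  have e: "?e (snd c0 a) \<in> edges D" "snd c (?e (snd c0 a)) = snd c0 a" if "a \<in> edges D0" for a
    using im(2) that by (metis image_eqI inv_into_into f_inv_into_f)+
  have "typed_mor D0 D (mor_inv D c \<odot> c0)"
    unfolding typed_mor_def
  proof (intro conjI ballI)
    fix v assume v: "v \<in> nodes D0"
    show "fst (mor_inv D c \<odot> c0) v \<in> nodes D" "ntype D (fst (mor_inv D c \<odot> c0) v) = ntype D0 v"
      using n[OF v] typed_morD(2)[OF c(1), of "?n (fst c0 v)"] typed_morD(2)[OF c0(1) v]
      by (auto simp: mor_inv_def)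
  next
    fix a assume a: "a \<in> edges D0"
    let ?b = "?e (snd c0 a)"
    show "snd (mor_inv D c \<odot> c0) a \<in> edges D" "etype D (snd (mor_inv D c \<odot> c0) a) = etype D0 a"
      using e[OF a] typed_morD(4)[OF c(1), of ?b] typed_morD(4)[OF c0(1) a]
      by (auto simp: mor_inv_def)
    have "?n (fst c w) = w" if "w \<in> nodes D" for w
      using c(2) that by simp
    then show "src D (snd (mor_inv D c \<odot> c0) a) = fst (mor_inv D c \<odot> c0) (src D0 a)"
      "tgt D (snd (mor_inv D c \<odot> c0) a) = fst (mor_inv D c \<odot> c0) (tgt D0 a)"
      using e[OF a] typed_morD(5,6)[OF c(1), of ?b] typed_morD(5,6)[OF c0(1) a]
        typed_graphD(1,2)[OF D, of ?b] by (auto simp: mor_inv_def)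
  qed
  moreover have "bij_betw (\<lambda>v. ?n (fst c0 v)) (nodes D0) (nodes D)"
    using bij_betw_trans[OF inj_on_imp_bij_betw[OF c0(2)] ] im(1)
      bij_betw_inv_into[OF inj_on_imp_bij_betw[OF c(2)]] by (fastforce simp: comp_def)
  moreover have "bij_betw (\<lambda>a. ?e (snd c0 a)) (edges D0) (edges D)"
    using bij_betw_trans[OF inj_on_imp_bij_betw[OF c0(3)] ] im(2)
      bij_betw_inv_into[OF inj_on_imp_bij_betw[OF c(3)]] by (fastforce simp: comp_def)
  ultimately show ?thesis
    by (simp add: typed_iso_def mor_inv_def mor_comp_def comp_def)
qed

section \<open>Pushouts: uniqueness, transport along isomorphisms, coverage and injectivity\<close>

lemma pushoutD:
  assumes "pushout T K A B C f g p q"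
  shows "typed_graph T K" "typed_graph T A" "typed_graph T B" "typed_graph T C"
    "typed_mor K A f" "typed_mor K B g" "typed_mor A C p" "typed_mor B C q"
    "mor_eq K (p \<odot> f) (q \<odot> g)"
  using assms by (simp_all add: pushout_def)

lemma pushout_universal:
  assumes "pushout T K A B C f g p q"
    and "typed_graph T X" "typed_mor A X p'" "typed_mor B X q'" "mor_eq K (p' \<odot> f) (q' \<odot> g)"
  obtains h where "typed_mor C X h" "mor_eq A (h \<odot> p) p'" "mor_eq B (h \<odot> q) q'"
  using assms unfolding pushout_def by metis

lemma pushout_unique:
  assumes po: "pushout T K A B C f g p q"
    and X: "typed_graph T X" "typed_mor C X h" "typed_mor C X h'"
    and "mor_eq A (h \<odot> p) (h' \<odot> p)" "mor_eq B (h \<odot> q) (h' \<odot> q)"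
  shows "mor_eq C h h'"
proof -
  have m: "typed_mor A X (h' \<odot> p)" "typed_mor B X (h' \<odot> q)"
    using pushoutD[OF po] X typed_mor_comp by blast+
  have "mor_eq K (h' \<odot> p \<odot> f) (h' \<odot> q \<odot> g)"
    using mor_eq_comp_left[OF pushoutD(9)[OF po], of h'] by (simp add: mor_comp_assoc)
  then obtain k where "\<forall>h0. typed_mor C X h0 \<and> mor_eq A (h0 \<odot> p) (h' \<odot> p) \<and>
      mor_eq B (h0 \<odot> q) (h' \<odot> q) \<longrightarrow> mor_eq C h0 k"
    using po X(1) m unfolding pushout_def by metis
  then have "mor_eq C h k" "mor_eq C h' k"
    using X assms(5,6) mor_eq_refl by blast+
  then show ?thesis
    using mor_eq_sym mor_eq_trans by blast
qed

text \<open>When \<open>A\<close> and \<open>B\<close> together cover \<open>C\<close>, the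
  mediating morphism is forced, so only its existence remains to be checked.\<close>

lemma pushoutI:
  assumes "typed_graph T K" "typed_graph T A" "typed_graph T B" "typed_graph T C"
    "typed_mor K A f" "typed_mor K B g" "typed_mor A C p" "typed_mor B C q"
    "mor_eq K (p \<odot> f) (q \<odot> g)"
    and ex: "\<And>X p' q'. typed_graph T X \<Longrightarrow> typed_mor A X p' \<Longrightarrow> typed_mor B X q' \<Longrightarrow>
      mor_eq K (p' \<odot> f) (q' \<odot> g) \<Longrightarrow>
      \<exists>h. typed_mor C X h \<and> mor_eq A (h \<odot> p) p' \<and> mor_eq B (h \<odot> q) q'"
    and n: "nodes C \<subseteq> fst p ` nodes A \<union> fst q ` nodes B"
    and e: "edges C \<subseteq> snd p ` edges A \<union> snd q ` edges B"
  shows "pushout T K A B C f g p q"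
proof -
  have u: "mor_eq C h' h"
    if "mor_eq A (h \<odot> p) p'" "mor_eq B (h \<odot> q) q'" "mor_eq A (h' \<odot> p) p'" "mor_eq B (h' \<odot> q) q'"
    for h h' p' q'
    unfolding mor_eq_def
  proof (intro conjI ballI)
    show "fst h' v = fst h v" if "v \<in> nodes C" for v
      using n that \<open>mor_eq A (h \<odot> p) p'\<close> \<open>mor_eq B (h \<odot> q) q'\<close> \<open>mor_eq A (h' \<odot> p) p'\<close>
        \<open>mor_eq B (h' \<odot> q) q'\<close> by (auto simp: mor_eq_def)
    show "snd h' v = snd h v" if "v \<in> edges C" for v
      using e that \<open>mor_eq A (h \<odot> p) p'\<close> \<open>mor_eq B (h \<odot> q) q'\<close> \<open>mor_eq A (h' \<odot> p) p'\<close>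
        \<open>mor_eq B (h' \<odot> q) q'\<close> by (auto simp: mor_eq_def)
  qed
  show ?thesis
    unfolding pushout_def
  proof (intro conjI allI impI)
    fix X p' q'
    assume "typed_graph T X \<and> typed_mor A X p' \<and> typed_mor B X q' \<and> mor_eq K (p' \<odot> f) (q' \<odot> g)"
    then obtain h where "typed_mor C X h \<and> mor_eq A (h \<odot> p) p' \<and> mor_eq B (h \<odot> q) q'"
      using ex by blast
    then show "\<exists>h. typed_mor C X h \<and> mor_eq A (h \<odot> p) p' \<and> mor_eq B (h \<odot> q) q' \<and>
        (\<forall>h'. typed_mor C X h' \<and> mor_eq A (h' \<odot> p) p' \<and> mor_eq B (h' \<odot> q) q' \<longrightarrow> mor_eq C h' h)"
      using u by (intro exI[of _ h]) blast
  qed (fact assms)+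
qed

text \<open>Serves composition of derivations, where the first graph of a step is replaced along the
  decorations.\<close>

lemma pushout_iso_result:
  assumes po: "pushout T K A B C f g p q" and iso: "typed_iso C C' \<iota>" and C': "typed_graph T C'"
  shows "pushout T K A B C' f g (\<iota> \<odot> p) (\<iota> \<odot> q)"
proof -
  note C = pushoutD(4)[OF po]
  note inv = typed_iso_mor[OF typed_iso_inv[OF C iso]]
  let ?j = "mor_inv C \<iota>"
  show ?thesis
    unfolding pushout_def
  proof (intro conjI allI impI)
    show "typed_mor A C' (\<iota> \<odot> p)" "typed_mor B C' (\<iota> \<odot> q)"
      using pushoutD[OF po] iso typed_iso_mor typed_mor_comp by blast+
    show "mor_eq K (\<iota> \<odot> p \<odot> f) (\<iota> \<odot> q \<odot> g)"
      using mor_eq_comp_left[OF pushoutD(9)[OF po], of \<iota>] by (simp add: mor_comp_assoc)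
    fix X p' q'
    assume X: "typed_graph T X \<and> typed_mor A X p' \<and> typed_mor B X q' \<and> mor_eq K (p' \<odot> f) (q' \<odot> g)"
    then obtain h where h: "typed_mor C X h" "mor_eq A (h \<odot> p) p'" "mor_eq B (h \<odot> q) q'"
      using pushout_universal[OF po] by metis
    have jl: "fst ?j (fst \<iota> v) = v" if "v \<in> nodes C" for v
      using mor_inv_left[OF iso] that by (simp add: mor_eq_def)
    have jle: "snd ?j (snd \<iota> a) = a" if "a \<in> edges C" for a
      using mor_inv_left[OF iso] that by (simp add: mor_eq_def)
    have jr: "fst ?j v \<in> nodes C" "fst \<iota> (fst ?j v) = v" if "v \<in> nodes C'" for v
      using mor_inv_right[OF iso] typed_morD[OF inv] that by (simp_all add: mor_eq_def)
    have jre: "snd ?j a \<in> edges C" "snd \<iota> (snd ?j a) = a" if "a \<in> edges C'" for a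
      using mor_inv_right[OF iso] typed_morD[OF inv] that by (simp_all add: mor_eq_def)
    show "\<exists>h. typed_mor C' X h \<and> mor_eq A (h \<odot> (\<iota> \<odot> p)) p' \<and> mor_eq B (h \<odot> (\<iota> \<odot> q)) q' \<and>
      (\<forall>h'. typed_mor C' X h' \<and> mor_eq A (h' \<odot> (\<iota> \<odot> p)) p' \<and> mor_eq B (h' \<odot> (\<iota> \<odot> q)) q' \<longrightarrow>
        mor_eq C' h' h)"
    proof (intro exI[of _ "h \<odot> ?j"] conjI allI impI)
      show "typed_mor C' X (h \<odot> ?j)"
        using inv h(1) by (rule typed_mor_comp)
      show "mor_eq A (h \<odot> ?j \<odot> (\<iota> \<odot> p)) p'" "mor_eq B (h \<odot> ?j \<odot> (\<iota> \<odot> q)) q'"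
        using h(2,3) jl jle typed_morD(1,3)[OF pushoutD(7)[OF po]] typed_morD(1,3)[OF pushoutD(8)[OF po]]
        by (simp_all add: mor_eq_def)
      fix h' assume h': "typed_mor C' X h' \<and> mor_eq A (h' \<odot> (\<iota> \<odot> p)) p' \<and> mor_eq B (h' \<odot> (\<iota> \<odot> q)) q'"
      have "mor_eq C (h' \<odot> \<iota>) h"
      proof (rule pushout_unique[OF po])
        show "typed_mor C X (h' \<odot> \<iota>)"
          using h' iso typed_iso_mor typed_mor_comp by blast
        show "mor_eq A (h' \<odot> \<iota> \<odot> p) (h \<odot> p)" "mor_eq B (h' \<odot> \<iota> \<odot> q) (h \<odot> q)"
          using h' h(2,3) by (simp_all add: mor_eq_def)
      qed (use X h in auto)
      then show "mor_eq C' h' (h \<odot> ?j)"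
        using jr jre unfolding mor_eq_def by simp (metis (lifting))
    qed
  qed (use pushoutD[OF po] C' in auto)
qed

text \<open>Serves to exchange the context of a given step for the standard one, so that two
  right-hand squares get the same span.\<close>

lemma pushout_iso_context:
  assumes po: "pushout T K A B C f g p q" and iso: "typed_iso B' B \<delta>"
    and B': "typed_graph T B'" "typed_mor K B' g'" "mor_eq K (\<delta> \<odot> g') g"
  shows "pushout T K A B' C f g' p (q \<odot> \<delta>)"
  unfolding pushout_def
proof (intro conjI allI impI)
  note inv = typed_iso_mor[OF typed_iso_inv[OF B'(1) iso]]
  let ?j = "mor_inv B' \<delta>"
  show "typed_mor B' C (q \<odot> \<delta>)"
    using pushoutD[OF po] iso typed_iso_mor typed_mor_comp by blast
  show "mor_eq K (p \<odot> f) (q \<odot> \<delta> \<odot> g')"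
    using pushoutD(9)[OF po] B'(3) by (simp add: mor_eq_def)
  fix X p' q'
  assume X: "typed_graph T X \<and> typed_mor A X p' \<and> typed_mor B' X q' \<and> mor_eq K (p' \<odot> f) (q' \<odot> g')"
  have jl: "fst ?j (fst \<delta> v) = v" if "v \<in> nodes B'" for v
    using mor_inv_left[OF iso] that by (simp add: mor_eq_def)
  have jle: "snd ?j (snd \<delta> a) = a" if "a \<in> edges B'" for a
    using mor_inv_left[OF iso] that by (simp add: mor_eq_def)
  have jr: "fst ?j v \<in> nodes B'" "fst \<delta> (fst ?j v) = v" if "v \<in> nodes B" for v
    using mor_inv_right[OF iso] typed_morD[OF inv] that by (simp_all add: mor_eq_def)
  have jre: "snd ?j a \<in> edges B'" "snd \<delta> (snd ?j a) = a" if "a \<in> edges B" for a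
    using mor_inv_right[OF iso] typed_morD[OF inv] that by (simp_all add: mor_eq_def)
  have "mor_eq K (p' \<odot> f) (q' \<odot> ?j \<odot> g)"
    using X B'(3) jl jle typed_morD(1,3)[OF B'(2)] by (simp add: mor_eq_def) metis
  moreover have "typed_mor B X (q' \<odot> ?j)"
    using X inv typed_mor_comp by blast
  ultimately obtain h where h: "typed_mor C X h" "mor_eq A (h \<odot> p) p'" "mor_eq B (h \<odot> q) (q' \<odot> ?j)"
    using pushout_universal[OF po, of X p' "q' \<odot> ?j"] X by blast
  show "\<exists>h. typed_mor C X h \<and> mor_eq A (h \<odot> p) p' \<and> mor_eq B' (h \<odot> (q \<odot> \<delta>)) q' \<and>
      (\<forall>h'. typed_mor C X h' \<and> mor_eq A (h' \<odot> p) p' \<and> mor_eq B' (h' \<odot> (q \<odot> \<delta>)) q' \<longrightarrow>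
        mor_eq C h' h)"
  proof (intro exI[of _ h] conjI allI impI)
    show "mor_eq B' (h \<odot> (q \<odot> \<delta>)) q'"
      using h(3) jl jle typed_morD(1,3)[OF typed_iso_mor[OF iso]] by (simp add: mor_eq_def)
    fix h' assume h': "typed_mor C X h' \<and> mor_eq A (h' \<odot> p) p' \<and> mor_eq B' (h' \<odot> (q \<odot> \<delta>)) q'"
    show "mor_eq C h' h"
    proof (rule pushout_unique[OF po])
      show "mor_eq A (h' \<odot> p) (h \<odot> p)"
        using h' h(2) mor_eq_sym mor_eq_trans by blast
      have "fst h' (fst q v) = fst q' (fst ?j v)" if "v \<in> nodes B" for v
        using h' jr[OF that] by (auto simp: mor_eq_def)
      moreover have "snd h' (snd q a) = snd q' (snd ?j a)" if "a \<in> edges B" for a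
        using h' jre[OF that] by (auto simp: mor_eq_def)
      ultimately show "mor_eq B (h' \<odot> q) (h \<odot> q)"
        using h(3) by (simp add: mor_eq_def)
    qed (use X h h' in auto)
  qed (use h in auto)
qed (use pushoutD[OF po] B' in auto)

lemma pushout_iso_unique:
  assumes po: "pushout T K A B C f g p q" and po': "pushout T K A B C' f g p' q'"
  obtains h where "typed_iso C C' h"
proof -
  obtain h where h: "typed_mor C C' h" "mor_eq A (h \<odot> p) p'" "mor_eq B (h \<odot> q) q'"
    using pushout_universal[OF po] pushoutD[OF po'] by metis
  obtain k where k: "typed_mor C' C k" "mor_eq A (k \<odot> p') p" "mor_eq B (k \<odot> q') q"
    using pushout_universal[OF po'] pushoutD[OF po] by metis
  have kh: "mor_eq C (k \<odot> h) (id, id)"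
  proof (rule pushout_unique[OF po pushoutD(4)[OF po] typed_mor_comp[OF h(1) k(1)]])
    show "mor_eq A (k \<odot> h \<odot> p) ((id, id) \<odot> p)" "mor_eq B (k \<odot> h \<odot> q) ((id, id) \<odot> q)"
      using h k by (simp_all add: mor_eq_def)
  qed simp
  have hk: "mor_eq C' (h \<odot> k) (id, id)"
  proof (rule pushout_unique[OF po' pushoutD(4)[OF po'] typed_mor_comp[OF k(1) h(1)]])
    show "mor_eq A (h \<odot> k \<odot> p') ((id, id) \<odot> p')" "mor_eq B (h \<odot> k \<odot> q') ((id, id) \<odot> q')"
      using h k by (simp_all add: mor_eq_def)
  qed simp
  have "bij_betw (fst h) (nodes C) (nodes C')"
    by (rule bij_betw_byWitness[of _ "fst k"])
      (use kh hk typed_morD(1)[OF h(1)] typed_morD(1)[OF k(1)] in \<open>auto simp: mor_eq_def\<close>)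
  moreover have "bij_betw (snd h) (edges C) (edges C')"
    by (rule bij_betw_byWitness[of _ "snd k"])
      (use kh hk typed_morD(3)[OF h(1)] typed_morD(3)[OF k(1)] in \<open>auto simp: mor_eq_def\<close>)
  ultimately show ?thesis
    using that h(1) by (simp add: typed_iso_def)
qed

lemma pushout_jointly_surjective:
  assumes po: "pushout T K A B C f g p q"
  shows "nodes C = fst p ` nodes A \<union> fst q ` nodes B" "edges C = snd p ` edges A \<union> snd q ` edges B"
proof -
  \<comment> \<open>The subgraph \<open>C'\<close> of \<open>C\<close> covered by \<open>A\<close>
    and \<open>B\<close> receives the same two morphisms. The mediating morphism into it, followed
    by the inclusion, is the identity of \<open>C\<close> by uniqueness, so nothing lies outside
    \<open>C'\<close>.\<close>
  define N where "N = fst p ` nodes A \<union> fst q ` nodes B"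
  define E where "E = snd p ` edges A \<union> snd q ` edges B"
  define C' where "C' = C\<lparr>nodes := N, edges := E\<rparr>"
  note d = pushoutD[OF po]
  have sub: "N \<subseteq> nodes C" "E \<subseteq> edges C"
    using typed_morD(1,3)[OF d(7)] typed_morD(1,3)[OF d(8)] by (auto simp: N_def E_def)
  have "src C a \<in> N \<and> tgt C a \<in> N" if "a \<in> E" for a
    using that typed_morD(5,6)[OF d(7)] typed_morD(5,6)[OF d(8)] typed_graphD(1,2)[OF d(2)]
      typed_graphD(1,2)[OF d(3)] by (auto simp: N_def E_def)
  then have C': "typed_graph T C'"
    using d(4) sub by (auto simp: typed_graph_def is_graph_def C'_def)
  have "typed_mor A C' p" "typed_mor B C' q"
    using d(7,8) by (auto simp: typed_mor_def C'_def N_def E_def)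
  then obtain h where h: "typed_mor C C' h" "mor_eq A (h \<odot> p) p" "mor_eq B (h \<odot> q) q"
    using pushout_universal[OF po C' _ _ d(9)] by blast
  have "typed_mor C' C (id, id)"
    using sub by (auto simp: typed_mor_def C'_def)
  then have "typed_mor C C ((id, id) \<odot> h)"
    using h(1) typed_mor_comp by blast
  then have "mor_eq C ((id, id) \<odot> h) (id, id)"
    by (rule pushout_unique[OF po d(4)]) (use h in \<open>auto simp: mor_eq_def\<close>)
  then have "nodes C \<subseteq> N" "edges C \<subseteq> E"
    using typed_morD(1,3)[OF h(1)] by (auto simp: mor_eq_def C'_def)
  then show "nodes C = fst p ` nodes A \<union> fst q ` nodes B" "edges C = snd p ` edges A \<union> snd q ` edges B"
    using sub by (auto simp: N_def E_def)
qed

text \<open>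
  The universal property is applied to the disjoint union of \<open>B\<close> and \<open>A - f(K)\<close>; an infinite item type has
  room for it.
\<close>

lemma pushout_mono:
  fixes A :: "('n, 'a, 'tn, 'ta) tgraph"
  assumes po: "pushout T K A B C f g p q"
    and inj: "inj_on (fst f) (nodes K)" and surj: "snd f ` edges K = edges A"
    and inje: "inj_on (snd f) (edges K)"
    and inf: "infinite (UNIV :: 'n set)"
  shows "inj_on (fst q) (nodes B)" "inj_on (snd q) (edges B)"
    "fst q ` nodes B \<inter> fst p ` (nodes A - fst f ` nodes K) = {}"
proof -
  note d = pushoutD[OF po]
  have "\<exists>\<iota> :: 'n + 'n \<Rightarrow> 'n. bij \<iota>"
    using card_of_ordIso[THEN iffD2, OF card_of_Plus_infinite1[OF inf card_of_mono1[OF subset_refl]]]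
    by (simp only: UNIV_Plus_UNIV)
  then obtain \<iota> :: "'n + 'n \<Rightarrow> 'n" where \<iota>: "inj \<iota>"
    using bij_is_inj by blast
  have \<iota>_eq: "\<iota> x = \<iota> y \<longleftrightarrow> x = y" for x y
    using \<iota> by (simp add: inj_eq)
  let ?L = "\<lambda>v. \<iota> (Inl v)" and ?R = "\<lambda>v. \<iota> (Inr v)"
  \<comment> \<open>The edges are those of \<open>B\<close> alone: every edge of \<open>A\<close>
    comes from \<open>K\<close> and is sent to \<open>B\<close> through \<open>g\<close>. Only the
    nodes need two disjoint copies.\<close>
  define X where "X = \<lparr>nodes = ?L ` nodes B \<union> ?R ` (nodes A - fst f ` nodes K), edges = edges B,
    src = (\<lambda>a. ?L (src B a)), tgt = (\<lambda>a. ?L (tgt B a)),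
    ntype = (\<lambda>v. case inv \<iota> v of Inl w \<Rightarrow> ntype B w | Inr w \<Rightarrow> ntype A w), etype = etype B\<rparr>"
  have X: "typed_graph T X"
    using d(2,3) \<iota> by (auto simp: X_def typed_graph_def is_graph_def)
  define fi where "fi = (inv_into (nodes K) (fst f), inv_into (edges K) (snd f))"
  define p' where "p' = ((\<lambda>v. if v \<in> fst f ` nodes K then ?L (fst g (fst fi v)) else ?R v),
    (\<lambda>a. snd g (snd fi a)))"
  define q' where "q' = (?L, id :: 'a \<Rightarrow> 'a)"
  have fin: "fst fi (fst f v) = v" if "v \<in> nodes K" for v
    using inj that by (simp add: fi_def)
  have fie: "snd fi (snd f a) = a" if "a \<in> edges K" for a
    using inje that by (simp add: fi_def)
  have q': "typed_mor B X q'"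
    using \<iota> by (auto simp: typed_mor_def X_def q'_def)
  have p': "typed_mor A X p'"
    unfolding typed_mor_def
  proof (intro conjI ballI)
    fix v assume v: "v \<in> nodes A"
    show "fst p' v \<in> nodes X"
      using v typed_morD(1)[OF d(6)] fin by (auto simp: p'_def X_def)
    show "ntype X (fst p' v) = ntype A v"
      using \<iota> typed_morD(2)[OF d(5)] typed_morD(2)[OF d(6)] fin by (auto simp: p'_def X_def)
  next
    fix a assume "a \<in> edges A"
    then obtain b where b: "b \<in> edges K" "a = snd f b"
      using surj by auto
    have s: "src K b \<in> nodes K" "tgt K b \<in> nodes K"
      using typed_graphD(1,2)[OF d(1) b(1)] by auto
    note k = typed_morD[OF d(5)] typed_morD[OF d(6)]
    show "snd p' a \<in> edges X" "etype X (snd p' a) = etype A a"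
      using b fie k by (auto simp: p'_def X_def)
    show "src X (snd p' a) = fst p' (src A a)" "tgt X (snd p' a) = fst p' (tgt A a)"
      using b s fie fin k by (auto simp: p'_def X_def)
  qed
  have "mor_eq K (p' \<odot> f) (q' \<odot> g)"
    using fin fie by (auto simp: mor_eq_def p'_def q'_def)
  then obtain h where h: "mor_eq A (h \<odot> p) p'" "mor_eq B (h \<odot> q) q'"
    using pushout_universal[OF po X p' q'] by metis
  \<comment> \<open>On nodes the mediating morphism undoes \<open>q\<close> up to the embedding of
    the first copy, on edges it undoes \<open>q\<close> outright; this gives injectivity. It sends
    the nodes of \<open>A\<close> outside the image of \<open>f\<close> into the other copy, which
    gives disjointness.\<close>
  then have hq: "fst h (fst q v) = ?L v" if "v \<in> nodes B" for v
    using that by (simp add: mor_eq_def q'_def)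
  have hqe: "snd h (snd q a) = a" if "a \<in> edges B" for a
    using that h by (simp add: mor_eq_def q'_def)
  have hp: "fst h (fst p v) = ?R v" if "v \<in> nodes A - fst f ` nodes K" for v
    using that h by (simp add: mor_eq_def p'_def)
  show "inj_on (fst q) (nodes B)"
    by (rule inj_onI) (metis hq \<iota>_eq sum.inject(1))
  show "inj_on (snd q) (edges B)"
    by (rule inj_onI) (metis hqe)
  show "fst q ` nodes B \<inter> fst p ` (nodes A - fst f ` nodes K) = {}"
  proof (rule ccontr)
    assume "fst q ` nodes B \<inter> fst p ` (nodes A - fst f ` nodes K) \<noteq> {}"
    then obtain v w where "v \<in> nodes B" "w \<in> nodes A - fst f ` nodes K" "fst q v = fst p w"
      by auto
    then show False
      using hq[of v] hp[of w] \<iota>_eq by simp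
  qed
qed

section \<open>Graphs reachable in the grammar of an event structure\<close>

text \<open>Rigidity is split between source and target. On the source, every node has an edge
  leaving it or a type that a \<open>simply_typed\<close> target realises at most once.\<close>

definition looped :: "('n, 'a, 'e tnode, 'ta) tgraph \<Rightarrow> bool" where
  "looped F \<longleftrightarrow> (\<forall>v\<in>nodes F. v \<in> src F ` edges F \<or> (\<forall>e. ntype F v \<noteq> TE e))"

definition simply_typed :: "('n, 'a, 'e tnode, 'ta) tgraph \<Rightarrow> bool" where
  "simply_typed G \<longleftrightarrow> inj_on (etype G) (edges G) \<and>
     (\<forall>w\<in>nodes G. \<forall>w'\<in>nodes G. ntype G w = ntype G w' \<and> (\<forall>e. ntype G w \<noteq> TE e) \<longrightarrow> w = w')"

text \<open>Edges go where their type says, nodes follow the edges that leave them, and the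
  remaining nodes follow their own type. All equations between a given and a standard derivation are
  instances.\<close>

lemma typed_mor_unique:
  assumes "looped F" "simply_typed G" "typed_mor F G f" "typed_mor F G g"
  shows "mor_eq F f g"
  unfolding mor_eq_def
proof (intro conjI ballI)
  note f = typed_morD[OF assms(3)] and g = typed_morD[OF assms(4)]
  show e: "snd f a = snd g a" if "a \<in> edges F" for a
    using assms(2) f(3,4)[OF that] g(3,4)[OF that] unfolding simply_typed_def inj_on_def by metis
  fix v assume v: "v \<in> nodes F"
  show "fst f v = fst g v"
  proof (cases "v \<in> src F ` edges F")
    case True
    then obtain a where a: "a \<in> edges F" "v = src F a"
      by blast
    then show ?thesis
      using f(5)[OF a(1)] g(5)[OF a(1)] e[OF a(1)] by simp
  next
    case False
    then have "\<forall>e. ntype F v \<noteq> TE e"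
      using assms(1) v unfolding looped_def by blast
    then show ?thesis
      using assms(2) f(1,2)[OF v] g(1,2)[OF v] unfolding simply_typed_def by metis
  qed
qed

lemma looped_iso:
  assumes "typed_iso G H f" "looped G"
  shows "looped H"
  unfolding looped_def
proof
  fix w assume "w \<in> nodes H"
  moreover have "nodes H = fst f ` nodes G"
    using assms(1) by (simp add: typed_iso_def bij_betw_def)
  ultimately obtain v where v: "v \<in> nodes G" "w = fst f v"
    by blast
  note m = typed_morD[OF typed_iso_mor[OF assms(1)]]
  from assms(2) v(1) consider a where "a \<in> edges G" "v = src G a" | "\<forall>e. ntype G v \<noteq> TE e"
    unfolding looped_def by blast
  then show "w \<in> src H ` edges H \<or> (\<forall>e. ntype H w \<noteq> TE e)"
  proof cases
    case 1
    then have "w = src H (snd f a)" "snd f a \<in> edges H"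
      using v(2) m by auto
    then show ?thesis by blast
  next
    case 2
    then show ?thesis using v m(2) by simp
  qed
qed

lemma simply_typed_iso:
  assumes "typed_iso G H f" "simply_typed G"
  shows "simply_typed H"
  unfolding simply_typed_def
proof (intro conjI ballI impI)
  note m = typed_morD[OF typed_iso_mor[OF assms(1)]]
  have bn: "nodes H = fst f ` nodes G" and be: "edges H = snd f ` edges G"
    using assms(1) by (auto simp: typed_iso_def bij_betw_def)
  show "inj_on (etype H) (edges H)"
    using assms(2) m(4) unfolding be simply_typed_def inj_on_def by auto
  fix w w' assume w: "w \<in> nodes H" "w' \<in> nodes H" "ntype H w = ntype H w' \<and> (\<forall>e. ntype H w \<noteq> TE e)"
  then obtain v v' where v: "v \<in> nodes G" "v' \<in> nodes G" "w = fst f v" "w' = fst f v'"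
    unfolding bn by blast
  then have "v = v'"
    using w(3) m(2) assms(2) unfolding simply_typed_def by metis
  then show "w = w'"
    using v by simp
qed

section \<open>Explicit representatives of the reachable graphs\<close>

lemma loop_graph_simps [simp]:
  "nodes (loop_graph N A at) = N" "edges (loop_graph N A at) = Loop ` A"
  "src (loop_graph N A at) = (\<lambda>a. at (edge_type a))" "tgt (loop_graph N A at) = (\<lambda>a. at (edge_type a))"
  "ntype (loop_graph N A at) = node_type" "etype (loop_graph N A at) = edge_type"
  by (simp_all add: loop_graph_def)

definition merge_node :: "'e gnode \<Rightarrow> 'e gnode" where
  "merge_node v = (case v of NL e u \<Rightarrow> NS e | _ \<Rightarrow> v)"

lemma merge_node_simps [simp]:
  "merge_node (NI e) = NI e" "merge_node (NS e) = NS e" "merge_node (NL e u) = NS e"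
  "merge_node (NC c) = NC c"
  by (simp_all add: merge_node_def)

context live_es
begin

definition arcs :: "'e tedge set" where
  "arcs = Ev ` events S \<union> {Ch e u | e u. e \<in> events S \<and> u \<in> choices S e}"

definition site :: "'e tedge \<Rightarrow> 'e gnode" where
  "site x = (case x of Ev e \<Rightarrow> NS e | Ch e u \<Rightarrow> NL e u)"

text \<open>The quotient map from the nodes of the start graph to those after firing
  \<open>A\<close>, with \<open>NS e\<close> as the representative of a fused class.\<close>

definition fuse :: "'e set \<Rightarrow> 'e gnode \<Rightarrow> 'e gnode" where
  "fuse A v = (case v of NL e u \<Rightarrow> if \<exists>a\<in>A. occurs_in S a e u then NS e else v | _ \<Rightarrow> v)"

text \<open>The nodes \<open>M\<close> without loops are a separate parameter because the context of
  a step has the merging of \<open>A\<close> but only the resources of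
  \<open>insert e A\<close>.\<close>

definition state_graph :: "'e set \<Rightarrow> 'e gnode set \<Rightarrow> ('e gnode, 'e gedge, 'e tnode, 'e tedge) tgraph" where
  "state_graph A M = loop_graph (M \<union> fuse A ` site ` arcs) arcs (\<lambda>x. fuse A (site x))"

definition resources :: "'e set \<Rightarrow> 'e gnode set" where
  "resources A = {NI e | e. e \<in> events S - A} \<union> {NC {e, e'} | e e'. conflict S e e' \<and> e \<notin> A \<and> e' \<notin> A}"

definition consumed :: "'e \<Rightarrow> 'e gnode set" where
  "consumed e = {NI e} \<union> {NC {e, e'} | e'. conflict S e e'}"

text \<open>After fusing, all loops of \<open>e\<close> share the node \<open>NS e\<close>, as the
  one-node component of the left-hand side requires.\<close>

definition ready :: "'e set \<Rightarrow> 'e \<Rightarrow> bool" where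
  "ready A e \<longleftrightarrow> (\<forall>u\<in>choices S e. \<exists>a\<in>A. occurs_in S a e u)"

definition fires :: "'e set \<Rightarrow> 'e \<Rightarrow> bool" where
  "fires A e \<longleftrightarrow> e \<in> events S \<and> consumed e \<subseteq> resources A \<and> ready A e"

lemma site_simps [simp]: "site (Ev e) = NS e" "site (Ch e u) = NL e u"
  by (simp_all add: site_def)

lemma fuse_simps [simp]:
  "fuse A (NI e) = NI e" "fuse A (NS e) = NS e" "fuse A (NC c) = NC c"
  "fuse A (NL e u) = (if \<exists>a\<in>A. occurs_in S a e u then NS e else NL e u)"
  by (simp_all add: fuse_def)

text \<open>Merging only accumulates, and \<open>NS e\<close> is fixed by every
  \<open>fuse B\<close>. The standard squares commute by this identity.\<close>

lemma fuse_fuse: "A \<subseteq> B \<Longrightarrow> fuse B (fuse A v) = fuse B v"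
  by (auto simp: fuse_def split: gnode.split)

lemma fuse_comp: "A \<subseteq> B \<Longrightarrow> (fuse B, id) \<odot> (fuse A, id) = (fuse B, id)"
  by (simp add: mor_comp_def fuse_fuse fun_eq_iff)

lemma fuse_empty: "fuse {} v = v"
  by (simp add: fuse_def split: gnode.split)

lemma node_type_fuse [simp]: "node_type (fuse A v) = node_type v"
  by (simp add: fuse_def split: gnode.split)

lemma arcs_cases:
  assumes "x \<in> arcs"
  obtains e where "x = Ev e" "e \<in> events S" | e u where "x = Ch e u" "e \<in> events S" "u \<in> choices S e"
  using assms by (auto simp: arcs_def)

lemma state_graph_simps [simp]:
  "nodes (state_graph A M) = M \<union> fuse A ` site ` arcs" "edges (state_graph A M) = Loop ` arcs"
  "src (state_graph A M) = (\<lambda>a. fuse A (site (edge_type a)))"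
  "tgt (state_graph A M) = (\<lambda>a. fuse A (site (edge_type a)))"
  "ntype (state_graph A M) = node_type" "etype (state_graph A M) = edge_type"
  by (simp_all add: state_graph_def)

lemma resource_cases:
  assumes "v \<in> resources A"
  obtains e where "v = NI e" "e \<in> events S" "e \<notin> A"
  | e e' where "v = NC {e, e'}" "conflict S e e'" "e \<notin> A" "e' \<notin> A"
  using assms by (auto simp: resources_def)

lemma resources_antimono: "A \<subseteq> B \<Longrightarrow> resources B \<subseteq> resources A"
  unfolding resources_def by blast

lemma resources_subset: "resources A \<subseteq> resources {}"
  by (rule resources_antimono) simp

lemma consumed_subset: "e \<in> events S \<Longrightarrow> consumed e \<subseteq> resources {}"
  by (auto simp: resources_def consumed_def)

lemma fuse_resource: "v \<in> resources A \<Longrightarrow> fuse B v = v"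
  by (auto simp: resources_def)

lemma site_not_resource: "x \<in> arcs \<Longrightarrow> fuse A (site x) \<notin> resources B"
  by (auto elim!: arcs_cases simp: resources_def split: if_splits)

text \<open>Conflict nodes are indexed by unordered pairs and conflict is symmetric, so
  \<open>e\<close> consumes every pair that contains it, on whichever side it was written.\<close>

lemma resources_insert: "resources (insert e A) = resources A - consumed e"
proof
  show "resources (insert e A) \<subseteq> resources A - consumed e"
  proof
    fix v assume v: "v \<in> resources (insert e A)"
    then have "v \<in> resources A"
      using resources_antimono[of A "insert e A"] by blast
    moreover have "v \<notin> consumed e"
      using v by (cases rule: resource_cases) (auto simp: consumed_def doubleton_eq_iff)
    ultimately show "v \<in> resources A - consumed e"
      by simp
  qed
  show "resources A - consumed e \<subseteq> resources (insert e A)"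
  proof
    fix v assume v: "v \<in> resources A - consumed e"
    then have "v \<in> resources A"
      by simp
    then show "v \<in> resources (insert e A)"
    proof (cases rule: resource_cases)
      case (1 e')
      then show ?thesis
        using v by (auto simp: consumed_def resources_def)
    next
      case (2 a b)
      have "a \<noteq> e"
        using v 2 by (auto simp: consumed_def)
      moreover have "b \<noteq> e"
        using v 2 conflict_sym[of a b] by (auto simp: consumed_def insert_commute)
      ultimately show ?thesis
        using 2 unfolding resources_def by blast
    qed
  qed
qed

lemma fires_resources: "fires A e \<Longrightarrow> resources A = resources (insert e A) \<union> consumed e"
  by (auto simp: fires_def resources_insert)

lemma typed_graph_state_graph:
  assumes "M \<subseteq> resources {}"
  shows "typed_graph (es_type_graph S) (state_graph A M)"
  using assms unfolding typed_graph_def is_graph_def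
  by (auto simp: es_type_graph_def Let_def arcs_def resources_def)

lemma es_start_graph_eq: "es_start_graph S = state_graph {} (resources {})"
proof -
  have "(\<lambda>x. fuse {} (site x)) = (\<lambda>x. case x of Ev e \<Rightarrow> NS e | Ch e u \<Rightarrow> NL e u)"
    by (simp add: fuse_empty site_def fun_eq_iff)
  moreover have "NL e u \<in> site ` arcs" if "e \<in> events S" "u \<in> choices S e" for e u
    using that by (intro image_eqI[of _ _ "Ch e u"]) (auto simp: arcs_def)
  then have "resources {} \<union> fuse {} ` site ` arcs = NI ` events S \<union> NS ` events S \<union>
      {NL e u | e u. e \<in> events S \<and> u \<in> choices S e} \<union> {NC {e, e'} | e e'. conflict S e e'}"
    by (auto simp: resources_def arcs_def fuse_empty image_Un image_image)
  ultimately show ?thesis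
    unfolding es_start_graph_def state_graph_def arcs_def by simp
qed

lemma looped_state_graph: "M \<subseteq> resources {} \<Longrightarrow> looped (state_graph A M)"
  by (auto simp: looped_def resources_def image_iff)

text \<open>Loops are named by their type. A node whose type is no \<open>TE e\<close> can only be a
  resource, and a resource is determined by its type.\<close>

lemma simply_typed_state_graph:
  assumes "M \<subseteq> resources {}"
  shows "simply_typed (state_graph A M)"
proof -
  have "v \<in> resources {}" if "v \<in> nodes (state_graph A M)" "\<forall>e. node_type v \<noteq> TE e" for v
    using that assms by (auto elim!: arcs_cases split: if_splits)
  moreover have "v = w" if "v \<in> resources {}" "w \<in> resources {}" "node_type v = node_type w" for v w
    using that by (auto simp: resources_def)
  moreover have "inj_on (etype (state_graph A M)) (edges (state_graph A M))"
    by (auto simp: inj_on_def)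
  ultimately show ?thesis
    unfolding simply_typed_def by (metis state_graph_simps(5))
qed

section \<open>The rules, expressed through fusing\<close>

definition rule_arcs :: "'e \<Rightarrow> 'e tedge set" where
  "rule_arcs e = {Ev e} \<union> Ch e ` choices S e \<union>
     {Ev e' | e' u'. e' \<in> events S \<and> occurs_in S e e' u'} \<union>
     {Ch e' u' | e' u'. e' \<in> events S \<and> occurs_in S e e' u'}"

definition rule_site :: "'e \<Rightarrow> 'e tedge \<Rightarrow> 'e gnode" where
  "rule_site e x = (case x of Ev e' \<Rightarrow> NS e' | Ch e' u' \<Rightarrow> if e' = e then NS e else NL e' u')"

definition merged :: "'e \<Rightarrow> 'e gnode set" where
  "merged e = {NS e} \<union> {NS e' | e' u'. e' \<in> events S \<and> occurs_in S e e' u'}"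

definition kept :: "'e \<Rightarrow> 'e gnode set" where
  "kept e = merged e \<union> {NL e' u' | e' u'. e' \<in> events S \<and> occurs_in S e e' u'}"

lemma es_rule_simps:
  "lhs (es_rule S e) = loop_graph (kept e \<union> consumed e) (rule_arcs e) (rule_site e)"
  "interface (es_rule S e) = loop_graph (kept e) (rule_arcs e) (rule_site e)"
  "rhs (es_rule S e) = loop_graph (merged e) (rule_arcs e) (\<lambda>x. merge_node (rule_site e x))"
  "lmor (es_rule S e) = (id, id)" "rmor (es_rule S e) = (merge_node, id)"
  by (simp_all add: es_rule_def Let_def kept_def merged_def consumed_def rule_arcs_def
      rule_site_def [abs_def] merge_node_def [abs_def])

lemma occurs_in_choices: "occurs_in S e e' u \<Longrightarrow> u \<in> choices S e'"
  by (simp add: occurs_in_def)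

lemma rule_arcs_subset: "e \<in> events S \<Longrightarrow> rule_arcs e \<subseteq> arcs"
  by (auto simp: rule_arcs_def arcs_def dest: occurs_in_choices)

lemma occurs_in_neq: "occurs_in S e e' u \<Longrightarrow> e' \<noteq> e"
  using not_occurs_in_self by blast

lemma looped_rule:
  "looped (lhs (es_rule S e))" "looped (interface (es_rule S e))" "looped (rhs (es_rule S e))"
proof -
  have 1: "v \<in> rule_site e ` rule_arcs e" if v: "v \<in> kept e" for v
  proof -
    from v consider "v = NS e" | e' u' where "v = NS e'" "e' \<in> events S" "occurs_in S e e' u'"
      | e' u' where "v = NL e' u'" "e' \<in> events S" "occurs_in S e e' u'"
      by (auto simp: kept_def merged_def)
    then show ?thesis
    proof cases
      case 1
      then show ?thesis by (intro image_eqI[of _ _ "Ev e"]) (auto simp: rule_site_def rule_arcs_def)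
    next
      case 2
      then show ?thesis by (intro image_eqI[of _ _ "Ev e'"]) (auto simp: rule_site_def rule_arcs_def)
    next
      case 3
      \<comment> \<open>As \<open>e'\<close> differs from \<open>e\<close>, \<open>rule_site\<close>
        leaves this loop on \<open>NL e' u'\<close>.\<close>
      then show ?thesis using occurs_in_neq[OF 3(3)]
        by (intro image_eqI[of _ _ "Ch e' u'"]) (auto simp: rule_site_def rule_arcs_def)
    qed
  qed
  then show "looped (lhs (es_rule S e))" "looped (interface (es_rule S e))"
    by (auto simp: looped_def es_rule_simps image_image consumed_def)
  have "v \<in> (\<lambda>x. merge_node (rule_site e x)) ` rule_arcs e" if "v \<in> merged e" for v
  proof -
    have "merge_node v = v"
      using that by (auto simp: merged_def)
    moreover have "v \<in> rule_site e ` rule_arcs e"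
      using 1 that by (simp add: kept_def)
    ultimately show ?thesis
      by (metis (no_types, lifting) image_iff)
  qed
  then show "looped (rhs (es_rule S e))"
    by (auto simp: looped_def es_rule_simps image_image)
qed

text \<open>The left-hand side places the loops \<open>Ch e u\<close> on \<open>NS e\<close>, the
  start graph on \<open>NL e u\<close>; readiness makes \<open>fuse A\<close> identify the two. All
  other loops of the rule have the same place in both.\<close>

lemma fuse_rule_site:
  assumes "ready A e" "x \<in> rule_arcs e"
  shows "fuse A (rule_site e x) = fuse A (site x)"
  using assms by (auto simp: rule_arcs_def rule_site_def ready_def dest: occurs_in_neq)

lemma kept_sites:
  assumes "e \<in> events S" "v \<in> kept e"
  shows "\<exists>x\<in>arcs. v = site x"
proof -
  from assms(2) consider "v = NS e" | e' where "v = NS e'" "e' \<in> events S"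
    | e' u' where "v = NL e' u'" "e' \<in> events S" "occurs_in S e e' u'"
    by (auto simp: kept_def merged_def)
  then show ?thesis
  proof cases
    case 1
    then show ?thesis using assms(1) by (intro bexI[of _ "Ev e"]) (auto simp: arcs_def)
  next
    case 2
    then show ?thesis by (intro bexI[of _ "Ev e'"]) (auto simp: arcs_def)
  next
    case 3
    then show ?thesis
      by (intro bexI[of _ "Ch e' u'"]) (auto simp: arcs_def dest: occurs_in_choices)
  qed
qed

lemma fuse_kept: "v \<in> kept e \<Longrightarrow> fuse (insert e A) v = merge_node v"
  by (auto simp: kept_def merged_def)

lemma fuse_merged: "v \<in> merged e \<Longrightarrow> fuse A v = v"
  by (auto simp: merged_def)

lemma ready_mono: "ready A e \<Longrightarrow> A \<subseteq> B \<Longrightarrow> ready B e"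
  by (auto simp: ready_def)

lemma merge_rule_site:
  assumes "ready A e" "x \<in> rule_arcs e"
  shows "merge_node (rule_site e x) = fuse (insert e A) (site x)"
proof -
  have "rule_site e x \<in> kept e"
    using assms(2) by (auto simp: rule_arcs_def rule_site_def kept_def merged_def split: if_splits)
  then show ?thesis
    using fuse_kept fuse_rule_site[OF ready_mono[OF assms(1)] assms(2), of "insert e A"] by auto
qed

text \<open>A fused node gets the representative \<open>NS e'\<close>, already present as the place
  of \<open>Ev e'\<close>. So merging shrinks the node set, and a morphism out of the earlier graph
  can be reused on the later one in \<open>pushout_rhs\<close>.\<close>

lemma fuse_sites_mono: "fuse (insert e A) ` site ` arcs \<subseteq> fuse A ` site ` arcs"
proof clarify
  fix x assume "x \<in> arcs"
  then show "fuse (insert e A) (site x) \<in> fuse A ` site ` arcs"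
  proof (cases rule: arcs_cases)
    case (1 e')
    then show ?thesis
      by (auto simp: arcs_def image_image intro!: image_eqI[of _ _ "Ev e'"])
  next
    case (2 e' u)
    have "NS e' \<in> fuse A ` site ` arcs"
      using 2 by (auto simp: arcs_def image_image intro!: image_eqI[of _ _ "Ev e'"])
    moreover have "NL e' u \<in> fuse A ` site ` arcs" if "\<not> (\<exists>a\<in>insert e A. occurs_in S a e' u)"
      using 2 that by (auto simp: arcs_def image_image intro!: image_eqI[of _ _ "Ch e' u"])
    ultimately show ?thesis
      using 2 by auto
  qed
qed

lemma is_rule_es_rule: "e \<in> events S \<Longrightarrow> is_rule (es_type_graph S) (es_rule S e)"
  using graph_grammar_es_grammar[OF es] by (simp add: graph_grammar_def es_grammar_def)

section \<open>The two pushout squares of a firing\<close>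

lemma typed_mor_interface:
  assumes "e \<in> events S" "ready A e"
  shows "typed_mor (interface (es_rule S e)) (state_graph A M) (fuse A, id)"
  using kept_sites[OF assms(1)] rule_arcs_subset[OF assms(1)] fuse_rule_site[OF assms(2)]
  by (auto simp: typed_mor_def es_rule_simps)

lemma typed_mor_lhs:
  assumes "e \<in> events S" "ready A e" "consumed e \<subseteq> M"
  shows "typed_mor (lhs (es_rule S e)) (state_graph A M) (fuse A, id)"
proof -
  have "fuse A v \<in> M \<union> fuse A ` site ` arcs" if "v \<in> kept e \<union> consumed e" for v
  proof (cases "v \<in> kept e")
    case False
    then have "v \<in> consumed e"
      using that by simp
    then have "fuse A v = v" "v \<in> M"
      using fuse_resource consumed_subset[OF assms(1)] assms(3) by blast+
    then show ?thesis
      by simp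
  qed (use kept_sites[OF assms(1)] in blast)
  then show ?thesis
    using rule_arcs_subset[OF assms(1)] fuse_rule_site[OF assms(2)]
    by (auto simp: typed_mor_def es_rule_simps)
qed

lemma typed_mor_rhs:
  assumes "e \<in> events S" "ready A e"
  shows "typed_mor (rhs (es_rule S e)) (state_graph (insert e A) M) (fuse (insert e A), id)"
proof -
  have "fuse (insert e A) v \<in> fuse (insert e A) ` site ` arcs" if "v \<in> merged e" for v
    using kept_sites[OF assms(1), of v] that by (auto simp: kept_def)
  then show ?thesis
    using rule_arcs_subset[OF assms(1)] merge_rule_site[OF assms(2)]
      fuse_fuse[of "insert e A" "insert e A"] by (auto simp: typed_mor_def es_rule_simps)
qed

lemma typed_mor_state_graph:
  assumes "A \<subseteq> B" "M \<subseteq> N" "N \<subseteq> resources {}"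
  shows "typed_mor (state_graph A M) (state_graph B N) (fuse B, id)"
proof -
  have "fuse B v = v" "v \<in> N" if "v \<in> M" for v
    using that assms(2,3) fuse_resource by blast+
  then show ?thesis
    using fuse_fuse[OF assms(1)] by (auto simp: typed_mor_def)
qed

lemma pushout_lhs:
  assumes e: "e \<in> events S" "ready A e" and M: "M \<subseteq> resources {}" "M \<inter> consumed e = {}"
  shows "pushout (es_type_graph S) (interface (es_rule S e)) (lhs (es_rule S e))
    (state_graph A M) (state_graph A (M \<union> consumed e))
    (lmor (es_rule S e)) (fuse A, id) (fuse A, id) (fuse A, id)"
proof -
  note r = is_rule_es_rule[OF e(1), unfolded is_rule_def]
  have M': "M \<union> consumed e \<subseteq> resources {}"
    using M consumed_subset[OF e(1)] by simp
  have site_nc: "fuse A (site x) \<notin> consumed e" if "x \<in> arcs" for x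
    using site_not_resource[OF that] consumed_subset[OF e(1)] by blast
  have fc: "fuse A v = v" if "v \<in> consumed e" for v
    using that consumed_subset[OF e(1)] fuse_resource by blast
  have fM: "fuse A v = v" if "v \<in> M" for v
    using that M(1) fuse_resource by blast
  show ?thesis
  proof (rule pushoutI)
    show "typed_mor (state_graph A M) (state_graph A (M \<union> consumed e)) (fuse A, id)"
      by (rule typed_mor_state_graph) (use M' in auto)
    show "mor_eq (interface (es_rule S e)) ((fuse A, id) \<odot> lmor (es_rule S e)) ((fuse A, id) \<odot> (fuse A, id))"
      by (simp add: mor_eq_def es_rule_simps fuse_fuse)
    fix X p' q'
    assume X: "typed_graph (es_type_graph S) X" "typed_mor (lhs (es_rule S e)) X p'"
      "typed_mor (state_graph A M) X q'"
      "mor_eq (interface (es_rule S e)) (p' \<odot> lmor (es_rule S e)) (q' \<odot> (fuse A, id))"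
    \<comment> \<open>\<open>p'\<close> decides on the consumed nodes, which lie outside the context
      and carry no loops; \<open>q'\<close> decides on everything else.\<close>
    define h where "h = ((\<lambda>v. if v \<in> consumed e then fst p' v else fst q' v), snd q')"
    have K: "fst p' v = fst q' (fuse A v)" if "v \<in> kept e" for v
      using X(4) that by (simp add: mor_eq_def es_rule_simps)
    have Ke: "snd p' (Loop x) = snd q' (Loop x)" if "x \<in> rule_arcs e" for x
      using X(4) that by (simp add: mor_eq_def es_rule_simps)
    have p: "fst p' v \<in> nodes X" "ntype X (fst p' v) = node_type v" if "v \<in> consumed e" for v
      using typed_morD(1,2)[OF X(2), of v] that by (auto simp: es_rule_simps)
    have q: "fst q' v \<in> nodes X" "ntype X (fst q' v) = node_type v"
      if "v \<in> M \<union> fuse A ` site ` arcs" for v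
      using typed_morD(1,2)[OF X(3), of v] that by auto
    have qe: "snd q' (Loop x) \<in> edges X" "etype X (snd q' (Loop x)) = x"
      "src X (snd q' (Loop x)) = fst q' (fuse A (site x))"
      "tgt X (snd q' (Loop x)) = fst q' (fuse A (site x))" if "x \<in> arcs" for x
      using typed_morD(3-6)[OF X(3), of "Loop x"] that by auto
    have hs: "fst h (fuse A (site x)) = fst q' (fuse A (site x))" if "x \<in> arcs" for x
      using site_nc[OF that] by (simp add: h_def)
    have "typed_mor (state_graph A (M \<union> consumed e)) X h"
      unfolding typed_mor_def
    proof (intro conjI ballI)
      fix v assume "v \<in> nodes (state_graph A (M \<union> consumed e))"
      then have v: "v \<in> consumed e \<or> v \<in> M \<union> fuse A ` site ` arcs"
        by auto
      show "fst h v \<in> nodes X"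
        using v p(1)[of v] q(1)[of v] by (auto simp: h_def)
      show "ntype X (fst h v) = ntype (state_graph A (M \<union> consumed e)) v"
        using v p(2)[of v] q(2)[of v] by (auto simp: h_def)
    next
      fix a assume "a \<in> edges (state_graph A (M \<union> consumed e))"
      then obtain x where x: "x \<in> arcs" "a = Loop x"
        by auto
      show "snd h a \<in> edges X" "etype X (snd h a) = etype (state_graph A (M \<union> consumed e)) a"
        "src X (snd h a) = fst h (src (state_graph A (M \<union> consumed e)) a)"
        "tgt X (snd h a) = fst h (tgt (state_graph A (M \<union> consumed e)) a)"
        using qe[OF x(1)] hs[OF x(1)] x(2) by (auto simp: h_def)
    qed
    moreover have "mor_eq (lhs (es_rule S e)) (h \<odot> (fuse A, id)) p'"
      unfolding mor_eq_def
    proof (intro conjI ballI)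
      fix v assume "v \<in> nodes (lhs (es_rule S e))"
      then consider "v \<in> consumed e" | "v \<in> kept e"
        by (auto simp: es_rule_simps)
      then show "fst (h \<odot> (fuse A, id)) v = fst p' v"
      proof cases
        case 1
        then show ?thesis using fc by (simp add: h_def)
      next
        case 2
        then obtain x where "x \<in> arcs" "v = site x"
          using kept_sites[OF e(1)] by blast
        then show ?thesis
          using hs K[OF 2] by simp
      qed
    next
      fix a assume "a \<in> edges (lhs (es_rule S e))"
      then show "snd (h \<odot> (fuse A, id)) a = snd p' a"
        using Ke by (auto simp: es_rule_simps h_def)
    qed
    moreover have "mor_eq (state_graph A M) (h \<odot> (fuse A, id)) q'"
      unfolding mor_eq_def
    proof (intro conjI ballI)
      fix v assume v: "v \<in> nodes (state_graph A M)"
      then have "v \<notin> consumed e"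
        using M(2) site_nc by auto
      moreover have "fuse A v = v"
        using v fM fuse_fuse by auto
      ultimately show "fst (h \<odot> (fuse A, id)) v = fst q' v"
        by (simp add: h_def)
    qed (simp add: h_def)
    ultimately show "\<exists>h. typed_mor (state_graph A (M \<union> consumed e)) X h \<and>
        mor_eq (lhs (es_rule S e)) (h \<odot> (fuse A, id)) p' \<and>
        mor_eq (state_graph A M) (h \<odot> (fuse A, id)) q'"
      by blast
  next
    show "nodes (state_graph A (M \<union> consumed e)) \<subseteq>
        fst (fuse A, id) ` nodes (lhs (es_rule S e)) \<union> fst (fuse A, id) ` nodes (state_graph A M)"
    proof
      fix v assume "v \<in> nodes (state_graph A (M \<union> consumed e))"
      then have v: "v \<in> consumed e \<or> v \<in> nodes (state_graph A M)"
        by auto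
      have "fuse A v = v"
        using v fc fM fuse_fuse by auto
      then have "v = fst (fuse A, id) v"
        by simp
      then show "v \<in> fst (fuse A, id) ` nodes (lhs (es_rule S e)) \<union>
          fst (fuse A, id) ` nodes (state_graph A M)"
        using v by (auto simp: es_rule_simps simp del: state_graph_simps(1) intro: rev_image_eqI)
    qed
  qed (use r M M' e typed_graph_state_graph typed_mor_interface typed_mor_lhs in auto)
qed

lemma pushout_rhs:
  assumes e: "e \<in> events S" "ready A e" and M: "M \<subseteq> resources {}"
  shows "pushout (es_type_graph S) (interface (es_rule S e)) (rhs (es_rule S e))
    (state_graph A M) (state_graph (insert e A) M)
    (rmor (es_rule S e)) (fuse A, id) (fuse (insert e A), id) (fuse (insert e A), id)"
proof -
  note r = is_rule_es_rule[OF e(1), unfolded is_rule_def]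
  let ?A = "insert e A"
  have fM: "fuse B v = v" if "v \<in> M" for v B
    using that M(1) fuse_resource by blast
  have ff: "fuse ?A (fuse A v) = fuse ?A v" for v
    by (rule fuse_fuse) auto
  show ?thesis
  proof (rule pushoutI)
    show "typed_mor (state_graph A M) (state_graph ?A M) (fuse ?A, id)"
      by (rule typed_mor_state_graph) (use M in auto)
    show "mor_eq (interface (es_rule S e)) ((fuse ?A, id) \<odot> rmor (es_rule S e)) ((fuse ?A, id) \<odot> (fuse A, id))"
    proof -
      have "fuse ?A (merge_node v) = fuse ?A v" if "v \<in> kept e" for v
        using that by (auto simp: kept_def merged_def)
      then show ?thesis
        by (simp add: mor_eq_def es_rule_simps ff)
    qed
    fix X p' q'
    assume X: "typed_graph (es_type_graph S) X" "typed_mor (rhs (es_rule S e)) X p'"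
      "typed_mor (state_graph A M) X q'"
      "mor_eq (interface (es_rule S e)) (p' \<odot> rmor (es_rule S e)) (q' \<odot> (fuse A, id))"
    have K: "fst p' (merge_node v) = fst q' (fuse A v)" if "v \<in> kept e" for v
      using X(4) that by (simp add: mor_eq_def es_rule_simps)
    have Ke: "snd p' (Loop x) = snd q' (Loop x)" if "x \<in> rule_arcs e" for x
      using X(4) that by (simp add: mor_eq_def es_rule_simps)
    \<comment> \<open>\<open>q'\<close> itself will be the mediating morphism, so it must not
      separate nodes that \<open>e\<close> merges. Such a pair is some \<open>NL e' u\<close> and
      its \<open>NS e'\<close>; both are kept by the rule, and \<open>p'\<close> sees them through
      \<open>merge_node\<close> as one.\<close>
    have key: "fst q' (fuse ?A v) = fst q' (fuse A v)" if "v \<in> M \<union> site ` arcs" for v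
    proof (cases "fuse ?A v = fuse A v")
      case False
      have "v \<notin> M"
        using False fM[of v ?A] fM[of v A] by auto
      then obtain x where "x \<in> arcs" "v = site x"
        using \<open>v \<in> M \<union> site ` arcs\<close> by blast
      then obtain e' u where v: "v = NL e' u" "occurs_in S e e' u" "\<not> (\<exists>a\<in>A. occurs_in S a e' u)"
        using False by (cases x) (auto split: if_splits)
      have "e' \<in> events S"
        using that v(1) M by (auto simp: arcs_def resources_def)
      then have "v \<in> kept e" "NS e' \<in> kept e"
        using v by (auto simp: kept_def merged_def)
      from K[OF this(1)] K[OF this(2)] show ?thesis
        using v by simp
    qed simp
    have nsub: "nodes (state_graph ?A M) \<subseteq> nodes (state_graph A M)"
      using fuse_sites_mono[of e A] unfolding state_graph_simps by blast
    have "typed_mor (state_graph ?A M) X q'"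
      unfolding typed_mor_def
    proof (intro conjI ballI)
      fix v assume v: "v \<in> nodes (state_graph ?A M)"
      show "fst q' v \<in> nodes X" "ntype X (fst q' v) = ntype (state_graph ?A M) v"
        using typed_morD(1,2)[OF X(3) subsetD[OF nsub v]] by simp_all
    next
      fix a assume "a \<in> edges (state_graph ?A M)"
      then obtain x where x: "x \<in> arcs" "a = Loop x"
        by auto
      show "snd q' a \<in> edges X" "etype X (snd q' a) = etype (state_graph ?A M) a"
        "src X (snd q' a) = fst q' (src (state_graph ?A M) a)"
        "tgt X (snd q' a) = fst q' (tgt (state_graph ?A M) a)"
        using typed_morD(3-6)[OF X(3), of a] key[of "site x"] x by auto
    qed
    moreover have "mor_eq (rhs (es_rule S e)) (q' \<odot> (fuse ?A, id)) p'"
      unfolding mor_eq_def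
    proof (intro conjI ballI)
      fix v assume "v \<in> nodes (rhs (es_rule S e))"
      then have v: "v \<in> merged e"
        by (simp add: es_rule_simps)
      then have "merge_node v = v" "v \<in> kept e"
        by (auto simp: merged_def kept_def)
      then show "fst (q' \<odot> (fuse ?A, id)) v = fst p' v"
        using K[of v] fuse_merged[OF v] by simp
    next
      fix a assume "a \<in> edges (rhs (es_rule S e))"
      then show "snd (q' \<odot> (fuse ?A, id)) a = snd p' a"
        using Ke by (auto simp: es_rule_simps)
    qed
    moreover have "mor_eq (state_graph A M) (q' \<odot> (fuse ?A, id)) q'"
      unfolding mor_eq_def
    proof (intro conjI ballI)
      fix v assume "v \<in> nodes (state_graph A M)"
      then consider "v \<in> M" | x where "x \<in> arcs" "v = fuse A (site x)"
        by auto
      then show "fst (q' \<odot> (fuse ?A, id)) v = fst q' v"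
      proof cases
        case 1
        then show ?thesis using fM by simp
      next
        case 2
        then show ?thesis using key[of "site x"] ff by simp
      qed
    qed simp
    ultimately show "\<exists>h. typed_mor (state_graph ?A M) X h \<and>
        mor_eq (rhs (es_rule S e)) (h \<odot> (fuse ?A, id)) p' \<and>
        mor_eq (state_graph A M) (h \<odot> (fuse ?A, id)) q'"
      by blast
  next
    show "nodes (state_graph ?A M) \<subseteq>
        fst (fuse ?A, id) ` nodes (rhs (es_rule S e)) \<union> fst (fuse ?A, id) ` nodes (state_graph A M)"
    proof
      fix v assume "v \<in> nodes (state_graph ?A M)"
      then consider "v \<in> M" | x where "x \<in> arcs" "v = fuse ?A (site x)"
        by auto
      then have "\<exists>w\<in>nodes (state_graph A M). v = fuse ?A w"
      proof cases
        case 1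
        then show ?thesis using fM by (intro bexI[of _ v]) auto
      next
        case 2
        then show ?thesis using ff by (intro bexI[of _ "fuse A (site x)"]) auto
      qed
      then show "v \<in> fst (fuse ?A, id) ` nodes (rhs (es_rule S e)) \<union>
          fst (fuse ?A, id) ` nodes (state_graph A M)"
        by (auto simp del: state_graph_simps(1))
    qed
  qed (use r M e typed_graph_state_graph typed_mor_interface typed_mor_rhs in auto)
qed

end

section \<open>Derivations of the grammar of an event structure\<close>

lemma graph_at_0 [simp]: "graph_at G ss 0 = G"
  and graph_at_Suc [simp]: "graph_at G ss (Suc i) = result (ss ! i)"
  by (simp_all add: graph_at_def)

lemma graph_at_Cons: "graph_at G (s # ss) (Suc i) = graph_at (result s) ss i"
  by (cases i) simp_all

lemma derivation_append:
  "derivation \<G> G (ss @ ts) \<longleftrightarrow>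
    derivation \<G> G ss \<and> derivation \<G> (graph_at G ss (length ss)) ts"
proof (induction ss arbitrary: G)
  case Nil
  then show ?case
    by (cases ts) (auto simp: direct_derivation_def Let_def dest: pushoutD(4))
next
  case (Cons s ss)
  then show ?case
    by (simp add: graph_at_Cons del: graph_at_Suc)
qed

lemma direct_derivation_typed:
  assumes "direct_derivation \<G> G s" and r: "r = rule_of \<G> (pname s)"
  shows "typed_graph (type_graph \<G>) G" "typed_graph (type_graph \<G>) (ctx s)"
    "typed_graph (type_graph \<G>) (result s)"
    "typed_mor (lhs r) G (match s)" "typed_mor (interface r) (ctx s) (kmatch s)"
    "typed_mor (rhs r) (result s) (comatch s)" "typed_mor (ctx s) G (ctx_l s)"
    "typed_mor (ctx s) (result s) (ctx_r s)"
proof -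
  have "pushout (type_graph \<G>) (interface r) (lhs r) (ctx s) G (lmor r) (kmatch s) (match s) (ctx_l s)"
    "pushout (type_graph \<G>) (interface r) (rhs r) (ctx s) (result s) (rmor r) (kmatch s) (comatch s) (ctx_r s)"
    using assms by (simp_all add: direct_derivation_def Let_def)
  note po = pushoutD[OF this(1)] pushoutD[OF this(2)]
  show "typed_graph (type_graph \<G>) G" "typed_graph (type_graph \<G>) (ctx s)"
    "typed_graph (type_graph \<G>) (result s)"
    "typed_mor (lhs r) G (match s)" "typed_mor (interface r) (ctx s) (kmatch s)"
    "typed_mor (rhs r) (result s) (comatch s)" "typed_mor (ctx s) G (ctx_l s)"
    "typed_mor (ctx s) (result s) (ctx_r s)"
    by (fact po)+
qed

lemma derivation_nth:
  assumes "derivation \<G> G ss" "i < length ss"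
  shows "direct_derivation \<G> (graph_at G ss i) (ss ! i)"
  using assms
proof (induction ss arbitrary: G i)
  case (Cons s ss)
  then show ?case
    by (cases i) (simp_all add: graph_at_Cons del: graph_at_Suc)
qed simp

lemma derivation_typed_graph: "derivation \<G> G ss \<Longrightarrow> typed_graph (type_graph \<G>) G"
  by (cases ss) (auto dest: direct_derivation_typed(1))

lemma es_grammar_simps [simp]:
  "type_graph (es_grammar S) = es_type_graph S" "start_graph (es_grammar S) = es_start_graph S"
  "rule_names (es_grammar S) = events S" "rule_of (es_grammar S) = es_rule S"
  by (simp_all add: es_grammar_def)

text \<open>The spare nodes provide the room that \<open>pushout_mono\<close> asks for.\<close>

lemma infinite_gnode: "infinite (UNIV :: 'e gnode set)"
proof -
  have "inj (NSpare :: nat \<Rightarrow> 'e gnode)"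
    by (simp add: inj_def)
  then show ?thesis
    using finite_imageD[of NSpare "UNIV :: nat set"] finite_subset[OF subset_UNIV]
    by (metis infinite_UNIV_nat)
qed

section \<open>Standard steps and their interchange\<close>

context live_es
begin

abbreviation current :: "'e set \<Rightarrow> ('e gnode, 'e gedge, 'e tnode, 'e tedge) tgraph" where
  "current A \<equiv> state_graph A (resources A)"

definition std_step :: "'e set \<Rightarrow> 'e \<Rightarrow> ('e gnode, 'e gedge, 'e tnode, 'e tedge, 'e) step" where
  "std_step A e =
     \<lparr>pname = e, ctx = state_graph A (resources (insert e A)), result = current (insert e A),
      match = (fuse A, id), kmatch = (fuse A, id), comatch = (fuse (insert e A), id),
      ctx_l = (fuse A, id), ctx_r = (fuse (insert e A), id)\<rparr>"

lemma std_step_simps [simp]: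
  "pname (std_step A e) = e" "ctx (std_step A e) = state_graph A (resources (insert e A))"
  "result (std_step A e) = current (insert e A)" "match (std_step A e) = (fuse A, id)"
  "kmatch (std_step A e) = (fuse A, id)" "comatch (std_step A e) = (fuse (insert e A), id)"
  "ctx_l (std_step A e) = (fuse A, id)" "ctx_r (std_step A e) = (fuse (insert e A), id)"
  by (simp_all add: std_step_def)

lemma typed_graph_current: "typed_graph (es_type_graph S) (current A)"
  by (rule typed_graph_state_graph[OF resources_subset])

lemma rigid_state_graph:
  "looped (state_graph A (resources B))" "simply_typed (state_graph A (resources B))"
  by (rule looped_state_graph[OF resources_subset] simply_typed_state_graph[OF resources_subset])+

lemma firesD:
  assumes "fires A e"
  shows "e \<in> events S" "ready A e" "resources A = resources (insert e A) \<union> consumed e"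
    "resources (insert e A) \<inter> consumed e = {}"
proof -
  show "e \<in> events S" "ready A e"
    using assms by (simp_all add: fires_def)
  show "resources A = resources (insert e A) \<union> consumed e"
    by (rule fires_resources[OF assms])
  show "resources (insert e A) \<inter> consumed e = {}"
    unfolding resources_insert by blast
qed

lemma direct_derivation_std_step:
  assumes "fires A e"
  shows "direct_derivation (es_grammar S) (current A) (std_step A e)"
proof -
  note f = firesD[OF assms]
  have "pushout (es_type_graph S) (interface (es_rule S e)) (lhs (es_rule S e))
      (state_graph A (resources (insert e A))) (current A)
      (lmor (es_rule S e)) (fuse A, id) (fuse A, id) (fuse A, id)"
    using pushout_lhs[OF f(1,2) resources_subset f(4)] unfolding f(3)[symmetric] .
  then show ?thesis
    using pushout_rhs[OF f(1,2) resources_subset] f(1)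
    by (simp add: direct_derivation_def Let_def)
qed

primrec fire_seq :: "'e set \<Rightarrow> 'e list \<Rightarrow> bool" where
  "fire_seq A [] \<longleftrightarrow> True"
| "fire_seq A (e # es) \<longleftrightarrow> fires A e \<and> fire_seq (insert e A) es"

primrec std_steps :: "'e set \<Rightarrow> 'e list \<Rightarrow> ('e gnode, 'e gedge, 'e tnode, 'e tedge, 'e) step list" where
  "std_steps A [] = []"
| "std_steps A (e # es) = std_step A e # std_steps (insert e A) es"

lemma fire_seq_append: "fire_seq A (xs @ ys) \<longleftrightarrow> fire_seq A xs \<and> fire_seq (A \<union> set xs) ys"
  by (induction xs arbitrary: A) auto

lemma std_steps_append: "std_steps A (xs @ ys) = std_steps A xs @ std_steps (A \<union> set xs) ys"
  by (induction xs arbitrary: A) auto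

lemma length_std_steps [simp]: "length (std_steps A es) = length es"
  by (induction es arbitrary: A) auto

lemma map_pname_std_steps [simp]: "map pname (std_steps A es) = es"
  by (induction es arbitrary: A) auto

lemma graph_at_std_steps:
  "graph_at (current A) (std_steps A es) (length es) = current (A \<union> set es)"
proof (induction es arbitrary: A)
  case (Cons e es)
  then show ?case
    using graph_at_Cons[of "current A" "std_step A e" "std_steps (insert e A) es" "length es"] by simp
qed simp

lemma derivation_std_steps:
  "fire_seq A es \<Longrightarrow> derivation (es_grammar S) (current A) (std_steps A es)"
  by (induction es arbitrary: A) (auto simp: typed_graph_current direct_derivation_std_step)

lemma interchange_std:
  assumes x: "fires A x" "fires (insert y A) x" and y: "fires A y" "fires (insert x A) y"
  shows "interchange (es_grammar S) (current A) (fuse (insert x A), id) (fuse A, id)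
    (std_step A x) (std_step (insert x A) y) (std_step A y) (std_step (insert y A) x)"
proof -
  note fx = firesD[OF x(1)] firesD[OF x(2)] and fy = firesD[OF y(1)] firesD[OF y(2)]
  \<comment> \<open>The common part \<open>B\<close> of the contexts is the state graph with the
    merging of \<open>A\<close> and the resources left after both events. Each of the four contexts
    arises from it by restoring what one event consumes or by performing what one event
    merges.\<close>
  let ?M = "resources (insert x (insert y A))"
  have comm: "insert y (insert x A) = insert x (insert y A)"
    by auto
  note l = pushout_lhs[OF _ _ resources_subset]
  have 1: "pushout (es_type_graph S) (interface (es_rule S y)) (lhs (es_rule S y))
      (state_graph A ?M) (state_graph A (resources (insert x A)))
      (lmor (es_rule S y)) (fuse A, id) (fuse A, id) (fuse A, id)"
    using l[OF fy(1,2) fy(8)[unfolded comm]] unfolding fy(7)[unfolded comm, symmetric] .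
  have 2: "pushout (es_type_graph S) (interface (es_rule S x)) (lhs (es_rule S x))
      (state_graph A ?M) (state_graph A (resources (insert y A)))
      (lmor (es_rule S x)) (fuse A, id) (fuse A, id) (fuse A, id)"
    using l[OF fx(1,2,8)] unfolding fx(7)[symmetric] .
  note 3 = pushout_rhs[OF fx(1,2) resources_subset[of "insert x (insert y A)"]]
  note 4 = pushout_rhs[OF fy(1,2) resources_subset[of "insert x (insert y A)"]]
  have der: "derivation (es_grammar S) (current A) [std_step A x, std_step (insert x A) y]"
    "derivation (es_grammar S) (current A) [std_step A y, std_step (insert y A) x]"
    using assms by (simp_all add: direct_derivation_std_step typed_graph_current)
  have sub: "A \<subseteq> insert x A" "A \<subseteq> insert y A" "insert x A \<subseteq> insert x (insert y A)"
    "insert y A \<subseteq> insert x (insert y A)" "A \<subseteq> insert x (insert y A)"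
    by auto
  note comp = fuse_comp[OF subset_refl] sub[THEN fuse_comp]
  have ind: "independence_pair (es_grammar S) (std_step A x) (std_step (insert x A) y)
      (fuse (insert x A), id) (fuse A, id)"
    using pushoutD(7)[OF 3] pushoutD(7)[OF 1]
    by (simp add: independence_pair_def Let_def comp comm)
  show ?thesis
    unfolding interchange_def Let_def
    by (intro conjI der ind, simp_all only: std_step_simps es_grammar_simps comm,
        rule exI[of _ "state_graph A ?M"], rule exI[of _ "(fuse A, id)"], rule exI[of _ "(fuse A, id)"],
        rule exI[of _ "(fuse A, id)"], rule exI[of _ "(fuse (insert x A), id)"],
        rule exI[of _ "(fuse (insert y A), id)"], rule exI[of _ "(fuse A, id)"],
        rule exI[of _ "(fuse A, id)"], rule exI[of _ "(fuse (insert y A), id)"])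
      (simp add: 1 2 3 4 comp)
qed

section \<open>Arbitrary derivations compared with standard ones\<close>

lemma direct_derivation_fires:
  assumes iso: "typed_iso (current A) G \<theta>" and dd: "direct_derivation (es_grammar S) G s"
    and s: "pname s = e"
  shows "fires A e"
proof -
  note t = direct_derivation_typed[OF dd refl, unfolded s es_grammar_simps]
  have e: "e \<in> events S"
    using dd s by (simp add: direct_derivation_def)
  define m where "m = mor_inv (current A) \<theta> \<odot> match s"
  have m: "typed_mor (lhs (es_rule S e)) (current A) m"
    unfolding m_def
    by (rule typed_mor_comp[OF t(4) typed_iso_mor[OF typed_iso_inv[OF typed_graph_current iso]]])
  note m' = typed_morD[OF m, unfolded es_rule_simps loop_graph_simps state_graph_simps]
  have res: "w \<in> resources A" if "w \<in> resources A \<union> fuse A ` site ` arcs" "\<forall>e. node_type w \<noteq> TE e" for w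
    using that by (auto elim!: arcs_cases split: if_splits)
  \<comment> \<open>The type of a consumed node leaves only one possible image, the node itself,
    which therefore has to be present.\<close>
  have "consumed e \<subseteq> resources A"
  proof
    fix v assume v: "v \<in> consumed e"
    then have w: "fst m v \<in> resources A \<union> fuse A ` site ` arcs" "node_type (fst m v) = node_type v"
      using m'(1,2)[of v] by auto
    have "\<forall>e. node_type v \<noteq> TE e"
      using v by (auto simp: consumed_def)
    then have "fst m v \<in> resources A"
      using res[OF w(1)] w(2) by simp
    moreover from this have "fst m v = v"
      using w(2) v by (cases rule: resource_cases) (auto simp: consumed_def)
    ultimately show "v \<in> resources A"
      by simp
  qed
  \<comment> \<open>\<open>Ev e\<close> and \<open>Ch e u\<close> share a node in the left-hand
    side, so their images do as well; this forces \<open>NL e u\<close> to have been fused with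
    \<open>NS e\<close>.\<close>
  moreover have "ready A e"
    unfolding ready_def
  proof
    fix u assume u: "u \<in> choices S e"
    have E: "snd m (Loop x) = Loop x \<and> fuse A (site x) = fst m (rule_site e x)" if "x \<in> rule_arcs e" for x
      using m'(3-5)[of "Loop x"] that by auto
    have "Ev e \<in> rule_arcs e" "Ch e u \<in> rule_arcs e"
      using u by (auto simp: rule_arcs_def)
    then have "fuse A (NL e u) = NS e"
      using E[of "Ev e"] E[of "Ch e u"] by (simp add: rule_site_def del: fuse_simps(4))
    then show "\<exists>a\<in>A. occurs_in S a e u"
      by (simp split: if_splits)
  qed
  ultimately show ?thesis
    using e by (simp add: fires_def)
qed

text \<open>
  The context of a step is the pushout complement of \<open>l\<close>, hence the subgraph of \<open>G\<close> without the
  images of the consumed nodes; these images are determined by their types.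
\<close>

lemma direct_derivation_std_iso:
  assumes iso: "typed_iso (current A) G \<theta>" and dd: "direct_derivation (es_grammar S) G s"
    and s: "pname s = e"
  shows "\<exists>\<delta>. typed_iso (ctx (std_step A e)) (ctx s) \<delta>"
    and "\<exists>\<theta>'. typed_iso (current (insert e A)) (result s) \<theta>'"
proof -
  let ?r = "es_rule S e" and ?D0 = "state_graph A (resources (insert e A))"
  note t = direct_derivation_typed[OF dd refl, unfolded s es_grammar_simps]
  note f = firesD[OF direct_derivation_fires[OF assms]]
  have poL: "pushout (es_type_graph S) (interface ?r) (lhs ?r) (ctx s) G
      (lmor ?r) (kmatch s) (match s) (ctx_l s)"
    and poR: "pushout (es_type_graph S) (interface ?r) (rhs ?r) (ctx s) (result s)
      (rmor ?r) (kmatch s) (comatch s) (ctx_r s)"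
    using dd s by (simp_all add: direct_derivation_def Let_def)
  have inj: "inj_on (fst (ctx_l s)) (nodes (ctx s))" "inj_on (snd (ctx_l s)) (edges (ctx s))"
    and disj: "fst (ctx_l s) ` nodes (ctx s) \<inter>
      fst (match s) ` (nodes (lhs ?r) - fst (lmor ?r) ` nodes (interface ?r)) = {}"
    using pushout_mono[OF poL _ _ _ infinite_gnode] by (simp_all add: es_rule_simps)
  note surj = pushout_jointly_surjective[OF poL]
  have simpG: "simply_typed G"
    using simply_typed_iso[OF iso] rigid_state_graph by blast
  \<comment> \<open>By rigidity the match is the standard one transported along
    \<open>\<theta>\<close>.\<close>
  have m: "mor_eq (lhs ?r) (match s) (\<theta> \<odot> (fuse A, id))"
  proof (rule typed_mor_unique[OF looped_rule(1) simpG t(4)])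
    have "consumed e \<subseteq> resources A"
      using f(3) by blast
    then show "typed_mor (lhs ?r) G (\<theta> \<odot> (fuse A, id))"
      using typed_mor_comp[OF typed_mor_lhs[OF f(1,2)] typed_iso_mor[OF iso]] by blast
  qed
  have \<theta>: "inj_on (fst \<theta>) (nodes (current A))" "fst \<theta> ` nodes (current A) = nodes G"
    "inj_on (snd \<theta>) (edges (current A))" "snd \<theta> ` edges (current A) = edges G"
    using iso by (auto simp: typed_iso_def bij_betw_def)
  have kept_consumed: "kept e \<inter> consumed e = {}"
    by (auto simp: kept_def merged_def consumed_def)
  have ns: "nodes (current A) = nodes ?D0 \<union> consumed e" "nodes ?D0 \<inter> consumed e = {}"
  proof -
    show "nodes (current A) = nodes ?D0 \<union> consumed e"
      using f(3) by auto
    have "fuse A ` site ` arcs \<inter> consumed e = {}"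
      using site_not_resource consumed_subset[OF f(1)] by blast
    then show "nodes ?D0 \<inter> consumed e = {}"
      using f(4) by auto
  qed
  have mc: "fst (match s) ` consumed e = fst \<theta> ` consumed e"
  proof (rule image_cong[OF refl])
    fix v assume v: "v \<in> consumed e"
    then have "fuse A v = v"
      using consumed_subset[OF f(1)] fuse_resource by blast
    then show "fst (match s) v = fst \<theta> v"
      using m v by (simp add: mor_eq_def es_rule_simps)
  qed
  have mk: "fst (match s) ` kept e \<subseteq> fst (ctx_l s) ` nodes (ctx s)"
  proof clarify
    fix v assume v: "v \<in> kept e"
    have "fst (match s) v = fst (ctx_l s) (fst (kmatch s) v)"
      using pushoutD(9)[OF poL] v by (simp add: mor_eq_def es_rule_simps)
    moreover have "fst (kmatch s) v \<in> nodes (ctx s)"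
      using typed_morD(1)[OF t(5)] v by (simp add: es_rule_simps)
    ultimately show "fst (match s) v \<in> fst (ctx_l s) ` nodes (ctx s)"
      by simp
  qed
  \<comment> \<open>Joint surjectivity says that at most the consumed nodes are missing from the
    context, disjointness that all of them are.\<close>
  have "fst (ctx_l s) ` nodes (ctx s) = nodes G - fst \<theta> ` consumed e"
  proof -
    have "nodes (lhs ?r) - fst (lmor ?r) ` nodes (interface ?r) = consumed e"
      using kept_consumed by (auto simp: es_rule_simps)
    then have "fst (ctx_l s) ` nodes (ctx s) \<inter> fst \<theta> ` consumed e = {}"
      using disj mc by simp
    moreover have "nodes G = fst \<theta> ` consumed e \<union> fst (ctx_l s) ` nodes (ctx s)"
      using surj(1) mc mk by (auto simp: es_rule_simps image_Un)
    ultimately show ?thesis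
      by blast
  qed
  also have "\<dots> = fst \<theta> ` nodes ?D0"
  proof -
    have "fst \<theta> ` nodes ?D0 \<inter> fst \<theta> ` consumed e = {}"
      using inj_on_image_Int[OF \<theta>(1), of "nodes ?D0" "consumed e"] ns by auto
    moreover have "nodes G = fst \<theta> ` nodes ?D0 \<union> fst \<theta> ` consumed e"
      unfolding \<theta>(2)[symmetric] ns(1) by (rule image_Un)
    ultimately show ?thesis
      by blast
  qed
  finally have imn: "fst (ctx_l s) ` nodes (ctx s) = fst \<theta> ` nodes ?D0" .
  \<comment> \<open>The rule deletes no edge, so the context has all edges of
    \<open>G\<close>.\<close>
  have ime: "snd (ctx_l s) ` edges (ctx s) = snd \<theta> ` edges ?D0"
  proof -
    have "snd (match s) a \<in> snd (ctx_l s) ` edges (ctx s)" if a: "a \<in> edges (lhs ?r)" for a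
    proof -
      have "a \<in> edges (interface ?r)"
        using a by (simp add: es_rule_simps)
      then have "snd (match s) a = snd (ctx_l s) (snd (kmatch s) a)" "snd (kmatch s) a \<in> edges (ctx s)"
        using pushoutD(9)[OF poL] typed_morD(3)[OF t(5)] by (auto simp: mor_eq_def es_rule_simps)
      then show ?thesis
        by simp
    qed
    then have "snd (ctx_l s) ` edges (ctx s) = edges G"
      unfolding surj(2) by blast
    then show ?thesis
      using \<theta>(4) by simp
  qed
  have D0mor: "typed_mor ?D0 G \<theta>"
    using typed_iso_mor[OF iso] ns(1) by (auto simp: typed_mor_def)
  have D0inj: "inj_on (fst \<theta>) (nodes ?D0)" "inj_on (snd \<theta>) (edges ?D0)"
    using \<theta>(1,3) ns(1) by (auto intro: inj_on_subset)
  obtain \<delta> where \<delta>: "typed_iso ?D0 (ctx s) \<delta>"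
    using typed_iso_same_image[OF t(7) inj D0mor D0inj imn ime t(2)] by blast
  then show "\<exists>\<delta>. typed_iso (ctx (std_step A e)) (ctx s) \<delta>"
    unfolding std_step_simps by blast
  have D0: "typed_graph (es_type_graph S) ?D0"
    by (rule typed_graph_state_graph[OF resources_subset])
  have k: "typed_mor (interface ?r) ?D0 (fuse A, id)"
    by (rule typed_mor_interface[OF f(1,2)])
  have "mor_eq (interface ?r) (\<delta> \<odot> (fuse A, id)) (kmatch s)"
    by (rule typed_mor_unique[OF looped_rule(2) simply_typed_iso[OF \<delta> rigid_state_graph(2)]
          typed_mor_comp[OF k typed_iso_mor[OF \<delta>]] t(5)])
  \<comment> \<open>With the context replaced, this pushout and the standard one have the same span,
    so their results are isomorphic.\<close>
  from pushout_iso_context[OF poR \<delta> D0 k this]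
  have po: "pushout (es_type_graph S) (interface ?r) (rhs ?r) ?D0 (result s)
      (rmor ?r) (fuse A, id) (comatch s) (ctx_r s \<odot> \<delta>)" .
  show "\<exists>\<theta>'. typed_iso (current (insert e A)) (result s) \<theta>'"
    using pushout_iso_unique[OF pushout_rhs[OF f(1,2) resources_subset] po] by blast
qed

text \<open>The isomorphisms are found separately for each graph and each context, by following the
  steps. Their compatibility is left open here; \<open>typed_mor_unique\<close> gives it
  later.\<close>

lemma derivation_std_iso:
  assumes "typed_iso (current A) G \<theta>" "derivation (es_grammar S) G ss"
  defines "es \<equiv> map pname ss"
  shows "fire_seq A es"
    and "i \<le> length ss \<Longrightarrow>
      \<exists>\<theta>. typed_iso (graph_at (current A) (std_steps A es) i) (graph_at G ss i) \<theta>"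
    and "i < length ss \<Longrightarrow> \<exists>\<delta>. typed_iso (ctx (std_steps A es ! i)) (ctx (ss ! i)) \<delta>"
proof -
  have "fire_seq A (map pname ss) \<and>
    (\<forall>i\<le>length ss. \<exists>\<theta>. typed_iso (graph_at (current A) (std_steps A (map pname ss)) i) (graph_at G ss i) \<theta>) \<and>
    (\<forall>i<length ss. \<exists>\<delta>. typed_iso (ctx (std_steps A (map pname ss) ! i)) (ctx (ss ! i)) \<delta>)"
    using assms(1,2)
  proof (induction ss arbitrary: A G \<theta>)
    case Nil
    then show ?case by (auto simp del: split_paired_Ex)
  next
    case (Cons s ss)
    let ?e = "pname s"
    have dd: "direct_derivation (es_grammar S) G s" and ds: "derivation (es_grammar S) (result s) ss"
      using Cons.prems(2) by auto
    note st = direct_derivation_fires[OF Cons.prems(1) dd refl]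
      direct_derivation_std_iso[OF Cons.prems(1) dd refl]
    obtain \<theta>' where \<theta>': "typed_iso (current (insert ?e A)) (result s) \<theta>'"
      using st(3) by blast
    note IH = Cons.IH[OF \<theta>' ds]
    show ?case
    proof (intro conjI allI impI)
      show "fire_seq A (map pname (s # ss))"
        using st(1) IH by simp
    next
      fix i assume i: "i \<le> length (s # ss)"
      show "\<exists>\<theta>. typed_iso (graph_at (current A) (std_steps A (map pname (s # ss))) i)
          (graph_at G (s # ss) i) \<theta>"
      proof (cases i)
        case 0
        then show ?thesis using Cons.prems(1) by (auto simp del: split_paired_Ex)
      next
        case (Suc j)
        then show ?thesis
          using IH i by (simp add: graph_at_Cons del: graph_at_Suc)
      qed
    next
      fix i assume i: "i < length (s # ss)"
      show "\<exists>\<delta>. typed_iso (ctx (std_steps A (map pname (s # ss)) ! i)) (ctx ((s # ss) ! i)) \<delta>"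
      proof (cases i)
        case 0
        then show ?thesis using st(2) by simp
      next
        case (Suc j)
        then show ?thesis using IH i by simp
      qed
    qed
  qed
  then show "fire_seq A es"
    and "i \<le> length ss \<Longrightarrow>
      \<exists>\<theta>. typed_iso (graph_at (current A) (std_steps A es) i) (graph_at G ss i) \<theta>"
    and "i < length ss \<Longrightarrow> \<exists>\<delta>. typed_iso (ctx (std_steps A es ! i)) (ctx (ss ! i)) \<delta>"
    unfolding es_def by blast+
qed

end

section \<open>Traces\<close>

text \<open>The invariant of a trace: neither abstraction equivalence nor a shift changes the set of
  rule names.\<close>

definition fired :: "('n, 'a, 'tn, 'ta, 'p) dderivation \<Rightarrow> 'p set" where
  "fired \<psi> = pname ` set (steps \<psi>)"

text \<open>For a trace, a union of sets that are all equal; in this form no representative has to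
  be chosen.\<close>

definition fired_of :: "('n, 'a, 'tn, 'ta, 'p) trace \<Rightarrow> 'p set" where
  "fired_of t = \<Union>(fired ` t)"

lemma trace_equiv_refl: "trace_equiv \<G> \<psi> \<psi>"
  by (simp add: trace_equiv_def)

lemma trace_equiv_sym: "trace_equiv \<G> \<psi> \<psi>' \<Longrightarrow> trace_equiv \<G> \<psi>' \<psi>"
  unfolding trace_equiv_def by (rule equivclp_sym)

lemma trace_equiv_trans: "trace_equiv \<G> \<psi> \<psi>' \<Longrightarrow> trace_equiv \<G> \<psi>' \<psi>'' \<Longrightarrow> trace_equiv \<G> \<psi> \<psi>''"
  unfolding trace_equiv_def by (rule equivclp_trans)

lemma trace_equiv_step:
  "abstraction_equiv \<G> \<psi> \<psi>' \<Longrightarrow> trace_equiv \<G> \<psi> \<psi>'" "shift_step \<G> \<psi> \<psi>' \<Longrightarrow> trace_equiv \<G> \<psi> \<psi>'"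
  unfolding trace_equiv_def by (auto intro: r_into_equivclp)

lemma abstraction_equiv_fired:
  assumes "abstraction_equiv \<G> \<psi> \<psi>'"
  shows "fired \<psi> = fired \<psi>'"
proof -
  have "map pname (steps \<psi>) = map pname (steps \<psi>')"
    using assms unfolding abstraction_equiv_def Let_def by (intro nth_equalityI) auto
  then have "set (map pname (steps \<psi>)) = set (map pname (steps \<psi>'))"
    by simp
  then show ?thesis
    by (simp add: fired_def)
qed

lemma shift_step_fired:
  assumes "shift_step \<G> \<psi> \<psi>'"
  shows "fired \<psi> = fired \<psi>'"
  using assms by (auto simp: shift_step_def interchange_def fired_def)

lemma trace_equiv_fired:
  assumes "trace_equiv \<G> \<psi> \<psi>'"
  shows "fired \<psi> = fired \<psi>'"
  using assms unfolding trace_equiv_def equivclp_def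
proof (induction rule: rtranclp_induct)
  case (step \<psi>' \<psi>'')
  then show ?case
    by (auto simp: symclp_def dest: abstraction_equiv_fired shift_step_fired)
qed simp

lemma trace_of_eq_iff: "trace_of \<G> \<psi> = trace_of \<G> \<psi>' \<longleftrightarrow> trace_equiv \<G> \<psi> \<psi>'"
  using trace_equiv_refl trace_equiv_sym trace_equiv_trans unfolding trace_of_def by blast

lemma fired_of_trace_of: "fired_of (trace_of \<G> \<psi>) = fired \<psi>"
  using trace_equiv_fired trace_equiv_refl by (force simp: fired_of_def trace_of_def)

lemma fired_dcomp: "fired (dcomp \<G> \<psi> \<psi>') = fired \<psi> \<union> fired \<psi>'"
  by (auto simp: fired_def dcomp_def Let_def split: list.split)

section \<open>Composition of decorated derivations\<close>

lemma graph_at_append: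
  "graph_at G (xs @ ys) (length xs + n) = graph_at (graph_at G xs (length xs)) ys n"
proof (induction xs arbitrary: G)
  case (Cons x xs)
  then show ?case
    by (simp add: graph_at_Cons del: graph_at_Suc)
qed simp

lemma typed_graph_last:
  "derivation \<G> G ss \<Longrightarrow> typed_graph (type_graph \<G>) (graph_at G ss (length ss))"
  by (induction ss arbitrary: G) (simp_all add: graph_at_Cons del: graph_at_Suc)

lemma direct_derivation_iso:
  assumes "direct_derivation \<G> G s" "typed_iso G H \<iota>" "typed_graph (type_graph \<G>) H"
  shows "direct_derivation \<G> H (s\<lparr>match := \<iota> \<odot> match s, ctx_l := \<iota> \<odot> ctx_l s\<rparr>)"
  using assms pushout_iso_result[OF _ assms(2,3)] by (simp add: direct_derivation_def Let_def)

lemma decorated_dcomp: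
  assumes \<psi>: "decorated_derivation \<G> \<psi>" and \<psi>': "decorated_derivation \<G> \<psi>'"
    and eq: "dtarget \<G> \<psi> = dsource \<G> \<psi>'"
  shows "decorated_derivation \<G> (dcomp \<G> \<psi> \<psi>')" "dsource \<G> (dcomp \<G> \<psi> \<psi>') = dsource \<G> \<psi>"
proof -
  define \<iota> where "\<iota> = omega \<psi> \<odot> mor_inv (dsource \<G> \<psi>') (alpha \<psi>')"
  have d: "derivation \<G> (first_graph \<psi>) (steps \<psi>)" "derivation \<G> (first_graph \<psi>') (steps \<psi>')"
    and a: "typed_iso (dsource \<G> \<psi>) (first_graph \<psi>) (alpha \<psi>)"
      "typed_iso (dsource \<G> \<psi>') (first_graph \<psi>') (alpha \<psi>')"
    and o: "typed_iso (dtarget \<G> \<psi>) (last_graph \<psi>) (omega \<psi>)"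
      "typed_iso (dtarget \<G> \<psi>') (last_graph \<psi>') (omega \<psi>')"
    using \<psi> \<psi>' by (auto simp: decorated_derivation_def)
  have last: "typed_graph (type_graph \<G>) (last_graph \<psi>)"
    using typed_graph_last[OF d(1)] by (simp add: last_graph_def)
  have "typed_graph (type_graph \<G>) (dsource \<G> \<psi>')"
    unfolding dsource_def by (rule can_typed_iso(1)[OF derivation_typed_graph[OF d(2)]])
  then have \<iota>: "typed_iso (first_graph \<psi>') (last_graph \<psi>) \<iota>"
    unfolding \<iota>_def using typed_iso_comp[OF typed_iso_inv[OF _ a(2)]] o(1) eq by metis
  show "dsource \<G> (dcomp \<G> \<psi> \<psi>') = dsource \<G> \<psi>"
    by (simp add: dsource_def dcomp_def Let_def split: list.split)
  show "decorated_derivation \<G> (dcomp \<G> \<psi> \<psi>')"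
  proof (cases "steps \<psi>'")
    \<comment> \<open>Without a step to absorb the comparison isomorphism, it ends up in the
      decoration of the target.\<close>
    case Nil
    then have c: "dcomp \<G> \<psi> \<psi>' = \<psi>\<lparr>omega := \<iota> \<odot> omega \<psi>'\<rparr>"
      by (simp add: dcomp_def \<iota>_def Let_def)
    have "last_graph \<psi>' = first_graph \<psi>'"
      using Nil by (simp add: last_graph_def)
    then have "typed_iso (dtarget \<G> \<psi>') (first_graph \<psi>') (omega \<psi>')" "dtarget \<G> \<psi>' = dtarget \<G> \<psi>"
      using o(2) eq by (simp_all add: dtarget_def dsource_def)
    then have "typed_iso (dtarget \<G> \<psi>) (last_graph \<psi>) (\<iota> \<odot> omega \<psi>')"
      using typed_iso_comp \<iota> by metis
    then show ?thesis
      using d(1) a(1) unfolding c by (simp add: decorated_derivation_def dsource_def dtarget_def last_graph_def)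
  next
    case (Cons s ss)
    define s' where "s' = s\<lparr>match := \<iota> \<odot> match s, ctx_l := \<iota> \<odot> ctx_l s\<rparr>"
    have c: "dcomp \<G> \<psi> \<psi>' = \<psi>\<lparr>steps := steps \<psi> @ s' # ss, omega := omega \<psi>'\<rparr>"
      using Cons by (simp add: dcomp_def \<iota>_def Let_def s'_def)
    have "direct_derivation \<G> (last_graph \<psi>) s'"
      unfolding s'_def by (rule direct_derivation_iso[OF _ \<iota> last]) (use d(2) Cons in simp)
    then have "derivation \<G> (first_graph \<psi>) (steps \<psi> @ s' # ss)"
      using d Cons by (simp add: derivation_append last_graph_def s'_def)
    moreover have "last_graph (dcomp \<G> \<psi> \<psi>') = last_graph \<psi>'"
      using graph_at_append[of "first_graph \<psi>" "steps \<psi>" "s' # ss" "Suc (length ss)"] Cons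
      unfolding c by (simp add: last_graph_def graph_at_Cons s'_def del: graph_at_Suc)
    ultimately show ?thesis
      using a(1) o(2) by (simp add: decorated_derivation_def dsource_def dtarget_def c)
  qed
qed

section \<open>Standard representatives of traces\<close>

context live_es
begin

text \<open>Depends on the set \<open>A\<close> only, so two firing orders of the same events carry
  literally the same decorations, as \<open>shift_step\<close> demands.\<close>

definition deco :: "'e set \<Rightarrow> ('e gnode, 'e gedge) mor" where
  "deco A = (SOME f. typed_iso (can (es_type_graph S) (current A)) (current A) f)"

lemma typed_iso_deco: "typed_iso (can (es_type_graph S) (current A)) (current A) (deco A)"
  unfolding deco_def by (rule someI_ex[OF can_typed_iso(2)[OF typed_graph_current]])

definition std_derivation ::
    "'e set \<Rightarrow> 'e list \<Rightarrow> ('e gnode, 'e gedge, 'e tnode, 'e tedge, 'e) dderivation" where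
  "std_derivation A es =
     \<lparr>alpha = deco A, first_graph = current A, steps = std_steps A es, omega = deco (A \<union> set es)\<rparr>"

lemma std_derivation_simps [simp]:
  "alpha (std_derivation A es) = deco A" "first_graph (std_derivation A es) = current A"
  "steps (std_derivation A es) = std_steps A es" "omega (std_derivation A es) = deco (A \<union> set es)"
  "last_graph (std_derivation A es) = current (A \<union> set es)"
  "dsource (es_grammar S) (std_derivation A es) = can (es_type_graph S) (current A)"
  "dtarget (es_grammar S) (std_derivation A es) = can (es_type_graph S) (current (A \<union> set es))"
  by (simp_all add: std_derivation_def last_graph_def dsource_def dtarget_def graph_at_std_steps)

lemma fired_std_derivation [simp]: "fired (std_derivation A es) = set es"
  unfolding fired_def set_map[symmetric] std_derivation_simps map_pname_std_steps ..

lemma decorated_std_derivation: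
  "fire_seq A es \<Longrightarrow> decorated_derivation (es_grammar S) (std_derivation A es)"
  by (simp add: decorated_derivation_def derivation_std_steps typed_iso_deco)

text \<open>The stagewise isomorphisms serve as witnesses. Each equation required of them compares
  two morphisms from a looped graph to a simply typed one, hence holds.\<close>

lemma abstraction_equiv_std_derivation:
  assumes \<psi>: "decorated_derivation (es_grammar S) \<psi>"
    and src: "dsource (es_grammar S) \<psi> = can (es_type_graph S) (es_start_graph S)"
  defines "es \<equiv> map pname (steps \<psi>)"
  shows "fire_seq {} es" "abstraction_equiv (es_grammar S) (std_derivation {} es) \<psi>"
proof -
  let ?\<G> = "es_grammar S" and ?G = "first_graph \<psi>" and ?T = "es_type_graph S" and ?\<phi> = "std_derivation {} es"
  let ?n = "length (steps \<psi>)"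
  have d: "derivation ?\<G> ?G (steps \<psi>)" and a: "typed_iso (dsource ?\<G> \<psi>) ?G (alpha \<psi>)"
    and o: "typed_iso (dtarget ?\<G> \<psi>) (last_graph \<psi>) (omega \<psi>)"
    using \<psi> by (auto simp: decorated_derivation_def)
  have can: "typed_graph ?T (can ?T (current A))" for A
    by (rule can_typed_iso(1)[OF typed_graph_current])
  have src': "dsource ?\<G> \<psi> = can ?T (current {})"
    using src by (simp add: es_start_graph_eq)
  obtain \<theta>0 where \<theta>0: "typed_iso (current {}) ?G \<theta>0"
    using typed_iso_comp[OF typed_iso_inv[OF can typed_iso_deco] a[unfolded src']] by blast
  note I = derivation_std_iso[OF \<theta>0 d, folded es_def]
  show fs: "fire_seq {} es"
    by (rule I(1))
  have dec: "decorated_derivation ?\<G> ?\<phi>"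
    by (rule decorated_std_derivation[OF fs])
  let ?g = "graph_at (current {}) (std_steps {} es)" and ?h = "graph_at ?G (steps \<psi>)"
  obtain \<theta> where \<theta>: "\<And>i. i \<le> ?n \<Longrightarrow> typed_iso (?g i) (?h i) (\<theta> i)"
    using I(2) by metis
  obtain \<delta> where \<delta>: "\<And>i. i < ?n \<Longrightarrow> typed_iso (ctx (std_steps {} es ! i)) (ctx (steps \<psi> ! i)) (\<delta> i)"
    using I(3) by metis
  have len: "length es = ?n"
    by (simp add: es_def)
  have last: "typed_iso (current (set es)) (last_graph \<psi>) (\<theta> ?n)"
    using \<theta>[of ?n] graph_at_std_steps[of "{}" es] len by (simp add: last_graph_def)
  have tgt: "dtarget ?\<G> ?\<phi> = dtarget ?\<G> \<psi>"
    using can_cong[OF typed_graph_current last] by (simp add: dtarget_def)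
  have loop_can: "looped (can ?T (current A))" for A
    by (rule looped_iso[OF typed_iso_inv[OF can typed_iso_deco] rigid_state_graph(1)])
  have std_shape: "\<exists>A e. std_steps {} es ! i = std_step A e" if "i < ?n" for i
  proof -
    have "\<exists>A e. std_steps B xs ! i = std_step A e" if "i < length xs" for B xs i
      using that by (induction xs arbitrary: B i) (auto simp: nth_Cons split: nat.split)
    then show ?thesis
      using that len by simp
  qed
  have g_shape: "\<exists>A. ?g i = current A" if "i \<le> ?n" for i
  proof (cases i)
    case 0
    then show ?thesis by (intro exI[of _ "{}"]) simp
  next
    case (Suc j)
    then obtain A e where "std_steps {} es ! j = std_step A e"
      using std_shape[of j] \<open>i \<le> ?n\<close> by auto
    then show ?thesis
      using Suc by auto
  qed
  have h_simple: "simply_typed (?h i)" if "i \<le> ?n" for i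
    using simply_typed_iso[OF \<theta>[OF that]] g_shape[OF that] rigid_state_graph by metis
  have ex: "P \<theta> \<delta> \<Longrightarrow> \<exists>\<theta> \<delta>. P \<theta> \<delta>" for P
    by blast
  show "abstraction_equiv ?\<G> ?\<phi> \<psi>"
    unfolding abstraction_equiv_def
  proof (intro conjI ex allI impI)
    show "decorated_derivation ?\<G> ?\<phi>" "decorated_derivation ?\<G> \<psi>" "dtarget ?\<G> ?\<phi> = dtarget ?\<G> \<psi>"
      by (fact dec \<psi> tgt)+
    show "dsource ?\<G> ?\<phi> = dsource ?\<G> \<psi>" "length (steps ?\<phi>) = length (steps \<psi>)"
      by (simp_all add: src' len)
    show "typed_iso (graph_at (first_graph ?\<phi>) (steps ?\<phi>) i) (?h i) (\<theta> i)"
      if "i \<le> length (steps ?\<phi>)" for i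
      using that \<theta>[of i] by (simp add: len)
    show "mor_eq (dsource ?\<G> ?\<phi>) (\<theta> 0 \<odot> alpha ?\<phi>) (alpha \<psi>)"
    proof (rule typed_mor_unique)
      show "looped (dsource ?\<G> ?\<phi>)"
        by (simp add: loop_can)
      show "simply_typed ?G"
        using h_simple[of 0] by simp
      show "typed_mor (dsource ?\<G> ?\<phi>) ?G (\<theta> 0 \<odot> alpha ?\<phi>)"
        using typed_mor_comp[OF typed_iso_mor[OF typed_iso_deco] typed_iso_mor[OF \<theta>[OF le0, unfolded graph_at_0]]] by simp
      show "typed_mor (dsource ?\<G> ?\<phi>) ?G (alpha \<psi>)"
        using typed_iso_mor[OF a] src' by simp
    qed
    show "mor_eq (dtarget ?\<G> ?\<phi>) (\<theta> (length (steps ?\<phi>)) \<odot> omega ?\<phi>) (omega \<psi>)"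
    proof (rule typed_mor_unique)
      show "looped (dtarget ?\<G> ?\<phi>)"
        by (simp add: loop_can)
      show "simply_typed (last_graph \<psi>)"
        using h_simple[of ?n] by (simp add: last_graph_def)
      show "typed_mor (dtarget ?\<G> ?\<phi>) (last_graph \<psi>) (\<theta> (length (steps ?\<phi>)) \<odot> omega ?\<phi>)"
        using typed_mor_comp[OF typed_iso_mor[OF typed_iso_deco] typed_iso_mor[OF last]] by (simp add: len)
      show "typed_mor (dtarget ?\<G> ?\<phi>) (last_graph \<psi>) (omega \<psi>)"
        using typed_iso_mor[OF o] tgt by simp
    qed
    fix i assume "i < length (steps ?\<phi>)"
    then have i: "i < ?n"
      by (simp add: len)
    define s where "s = std_steps {} es ! i"
    define s' where "s' = steps \<psi> ! i"
    obtain A e where s: "s = std_step A e"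
      using std_shape[OF i] s_def by blast
    have name: "pname s' = pname s"
      using i nth_map[of i "std_steps {} es" pname] len by (simp add: s_def s'_def es_def)
    let ?r = "es_rule S (pname s)"
    have r': "?r = rule_of ?\<G> (pname s')" and r: "?r = rule_of ?\<G> (pname s)"
      using name by simp_all
    have "direct_derivation ?\<G> (?g i) s"
      unfolding s_def by (rule derivation_nth[OF derivation_std_steps[OF fs]]) (simp add: i len)
    note t = direct_derivation_typed[OF this r]
    note t' = direct_derivation_typed[OF derivation_nth[OF d i, folded s'_def] r']
    have \<theta>i: "typed_mor (?g i) (?h i) (\<theta> i)" and \<theta>s: "typed_mor (result s) (result s') (\<theta> (Suc i))"
      using typed_iso_mor[OF \<theta>[of i]] typed_iso_mor[OF \<theta>[of "Suc i"]] i by (simp_all add: s_def s'_def)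
    have \<delta>i: "typed_iso (ctx s) (ctx s') (\<delta> i)"
      using \<delta>[OF i] by (simp add: s_def s'_def)
    have si: "simply_typed (?h i)" and ss: "simply_typed (result s')"
      using h_simple[of i] h_simple[of "Suc i"] i by (simp_all add: s'_def)
    have lc: "looped (ctx s)" and sc: "simply_typed (ctx s')"
      using rigid_state_graph simply_typed_iso[OF \<delta>i] by (simp_all add: s)
    have "pname s = pname s' \<and> typed_iso (ctx s) (ctx s') (\<delta> i) \<and>
        mor_eq (lhs ?r) (\<theta> i \<odot> match s) (match s') \<and>
        mor_eq (interface ?r) (\<delta> i \<odot> kmatch s) (kmatch s') \<and>
        mor_eq (rhs ?r) (\<theta> (Suc i) \<odot> comatch s) (comatch s') \<and>
        mor_eq (ctx s) (\<theta> i \<odot> ctx_l s) (ctx_l s' \<odot> \<delta> i) \<and>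
        mor_eq (ctx s) (\<theta> (Suc i) \<odot> ctx_r s) (ctx_r s' \<odot> \<delta> i)"
    proof (intro conjI)
      note \<delta>m = typed_iso_mor[OF \<delta>i]
      show "mor_eq (lhs ?r) (\<theta> i \<odot> match s) (match s')"
        by (rule typed_mor_unique[OF looped_rule(1) si typed_mor_comp[OF t(4) \<theta>i] t'(4)])
      show "mor_eq (interface ?r) (\<delta> i \<odot> kmatch s) (kmatch s')"
        by (rule typed_mor_unique[OF looped_rule(2) sc typed_mor_comp[OF t(5) \<delta>m] t'(5)])
      show "mor_eq (rhs ?r) (\<theta> (Suc i) \<odot> comatch s) (comatch s')"
        by (rule typed_mor_unique[OF looped_rule(3) ss typed_mor_comp[OF t(6) \<theta>s] t'(6)])
      show "mor_eq (ctx s) (\<theta> i \<odot> ctx_l s) (ctx_l s' \<odot> \<delta> i)"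
        by (rule typed_mor_unique[OF lc si typed_mor_comp[OF t(7) \<theta>i] typed_mor_comp[OF \<delta>m t'(7)]])
      show "mor_eq (ctx s) (\<theta> (Suc i) \<odot> ctx_r s) (ctx_r s' \<odot> \<delta> i)"
        by (rule typed_mor_unique[OF lc ss typed_mor_comp[OF t(8) \<theta>s] typed_mor_comp[OF \<delta>m t'(8)]])
    qed (use name \<delta>i in auto)
    then show "let s = steps ?\<phi> ! i; s' = steps \<psi> ! i; r = rule_of ?\<G> (pname s) in
        pname s = pname s' \<and> typed_iso (ctx s) (ctx s') (\<delta> i) \<and>
        mor_eq (lhs r) (\<theta> i \<odot> match s) (match s') \<and>
        mor_eq (interface r) (\<delta> i \<odot> kmatch s) (kmatch s') \<and>
        mor_eq (rhs r) (\<theta> (Suc i) \<odot> comatch s) (comatch s') \<and>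
        mor_eq (ctx s) (\<theta> i \<odot> ctx_l s) (ctx_l s' \<odot> \<delta> i) \<and>
        mor_eq (ctx s) (\<theta> (Suc i) \<odot> ctx_r s) (ctx_r s' \<odot> \<delta> i)"
      unfolding Let_def std_derivation_simps es_grammar_simps s_def s'_def .
  qed
qed

section \<open>Reordering firing sequences\<close>

lemma fires_swap:
  assumes "fires A x" "fires (insert x A) y" "ready A y"
  shows "fires A y" "fires (insert y A) x"
proof -
  have "consumed y \<subseteq> resources A - consumed x"
    using assms(2) by (simp add: fires_def resources_insert)
  moreover have "consumed x \<subseteq> resources A"
    using assms(1) by (simp add: fires_def)
  ultimately have "consumed y \<subseteq> resources A" "consumed x \<subseteq> resources (insert y A)"
    unfolding resources_insert by blast+
  then show "fires A y" "fires (insert y A) x"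
    using assms ready_mono[of A x "insert y A"] by (auto simp: fires_def)
qed

text \<open>Firing \<open>e\<close> needs the node \<open>NI e\<close>, which is absent from the
  resources once \<open>e\<close> has fired.\<close>

lemma fires_not_mem: "fires A e \<Longrightarrow> e \<notin> A"
  by (auto simp: fires_def consumed_def resources_def)

lemma fire_seq_distinct: "fire_seq A es \<Longrightarrow> distinct es \<and> set es \<inter> A = {}"
proof (induction es arbitrary: A)
  case (Cons e es)
  then have "distinct es \<and> set es \<inter> insert e A = {}" "e \<notin> A"
    using fires_not_mem by auto
  then show ?case
    by auto
qed simp

lemma trace_equiv_swap:
  assumes "fire_seq {} (us @ x # y # vs)" "fire_seq {} (us @ y # x # vs)"
  shows "trace_equiv (es_grammar S) (std_derivation {} (us @ x # y # vs)) (std_derivation {} (us @ y # x # vs))"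
    (is "trace_equiv _ ?\<psi> ?\<psi>'")
proof -
  let ?A = "set us"
  have f: "fires ?A x" "fires (insert x ?A) y" "fires ?A y" "fires (insert y ?A) x"
    using assms by (simp_all add: fire_seq_append)
  let ?B = "insert x (insert y ?A)"
  have comm: "insert y (insert x ?A) = ?B"
    by auto
  have s: "steps ?\<psi> = std_steps {} us @ [std_step ?A x, std_step (insert x ?A) y] @ std_steps ?B vs"
    by (simp add: std_steps_append comm)
  have s': "?\<psi>' = ?\<psi>\<lparr>steps := std_steps {} us @ [std_step ?A y, std_step (insert y ?A) x] @ std_steps ?B vs\<rparr>"
    by (simp add: std_derivation_def std_steps_append insert_commute)
  have "graph_at (first_graph ?\<psi>) (std_steps {} us) (length (std_steps {} us)) = current ?A"
    using graph_at_std_steps[of "{}" us] by simp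
  then have "interchange (es_grammar S)
      (graph_at (first_graph ?\<psi>) (std_steps {} us) (length (std_steps {} us)))
      (fuse (insert x ?A), id) (fuse ?A, id)
      (std_step ?A x) (std_step (insert x ?A) y) (std_step ?A y) (std_step (insert y ?A) x)"
    using interchange_std[OF f(1,4,3,2)] by simp
  then have "shift_step (es_grammar S) ?\<psi> ?\<psi>'"
    unfolding shift_step_def using s s' decorated_std_derivation[OF assms(1)] decorated_std_derivation[OF assms(2)]
    by blast
  then show ?thesis
    by (rule trace_equiv_step(2))
qed

text \<open>\<open>y\<close> moves left past one neighbour at a time, and the neighbour joins the
  suffix, which is why \<open>vs\<close> is arbitrary. Readiness after \<open>us\<close> persists
  when further events fire, so it is available for every swap.\<close>

lemma trace_equiv_move:
  assumes "fire_seq {} (us @ xs @ y # vs)" "ready (set us) y"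
  shows "fire_seq {} (us @ y # xs @ vs) \<and>
    trace_equiv (es_grammar S) (std_derivation {} (us @ xs @ y # vs)) (std_derivation {} (us @ y # xs @ vs))"
  using assms
proof (induction xs arbitrary: vs rule: rev_induct)
  case Nil
  then show ?case by (simp add: trace_equiv_refl)
next
  case (snoc x xs)
  let ?A = "set us \<union> set xs"
  have f: "fires ?A x" "fires (insert x ?A) y" "fire_seq (insert y (insert x ?A)) vs" "fire_seq {} (us @ xs)"
    using snoc.prems(1) by (simp_all add: fire_seq_append)
  have "ready ?A y"
    using snoc.prems(2) by (rule ready_mono) simp
  note g = fires_swap[OF f(1,2) this]
  have 1: "fire_seq {} ((us @ xs) @ y # x # vs)"
    using f(3,4) g by (simp add: fire_seq_append insert_commute)
  have 2: "fire_seq {} ((us @ xs) @ x # y # vs)"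
    using snoc.prems(1) by simp
  note IH = snoc.IH[of "x # vs"]
  have "fire_seq {} (us @ y # xs @ x # vs) \<and>
      trace_equiv (es_grammar S) (std_derivation {} (us @ xs @ y # x # vs)) (std_derivation {} (us @ y # xs @ x # vs))"
    using IH 1 snoc.prems(2) by simp
  then show ?case
    using trace_equiv_swap[OF 2 1] trace_equiv_trans by simp blast
qed

text \<open>The first event of \<open>ys\<close> is moved to the front of \<open>xs\<close>: it is
  ready after \<open>us\<close> because the second sequence fires it there. It then joins the common
  prefix \<open>us\<close>.\<close>

lemma trace_equiv_same_events:
  assumes "fire_seq {} (us @ xs)" "fire_seq {} (us @ ys)" "set xs = set ys"
  shows "trace_equiv (es_grammar S) (std_derivation {} (us @ xs)) (std_derivation {} (us @ ys))"
  using assms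
proof (induction ys arbitrary: us xs)
  case Nil
  then show ?case by (simp add: trace_equiv_refl)
next
  case (Cons y ys)
  then obtain as bs where xs: "xs = as @ y # bs"
    by (metis list.set_intros(1) split_list)
  have "ready (set us) y"
    using Cons.prems(2) by (simp add: fire_seq_append fires_def)
  then have m: "fire_seq {} (us @ y # as @ bs)"
    "trace_equiv (es_grammar S) (std_derivation {} (us @ xs)) (std_derivation {} (us @ y # as @ bs))"
    using trace_equiv_move[of us as y bs] Cons.prems(1) unfolding xs by auto
  have "distinct xs" "distinct (y # ys)"
    using fire_seq_distinct[OF Cons.prems(1)] fire_seq_distinct[OF Cons.prems(2)] by auto
  then have "set (as @ bs) = set ys"
    using Cons.prems(3) unfolding xs by (auto simp: insert_eq_iff)
  then have "trace_equiv (es_grammar S) (std_derivation {} ((us @ [y]) @ as @ bs)) (std_derivation {} ((us @ [y]) @ ys))"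
    using m(1) Cons.prems(2) by (intro Cons.IH) simp_all
  then show ?case
    using m(2) trace_equiv_trans by simp blast
qed

lemma start_trace_cases:
  assumes "t \<in> start_traces (es_grammar S)"
  obtains es where "fire_seq {} es" "t = trace_of (es_grammar S) (std_derivation {} es)" "fired_of t = set es"
proof -
  obtain \<psi> where \<psi>: "decorated_derivation (es_grammar S) \<psi>" "t = trace_of (es_grammar S) \<psi>"
    "dsource (es_grammar S) \<psi> = can (es_type_graph S) (es_start_graph S)"
    using assms by (auto simp: start_traces_def)
  note a = abstraction_equiv_std_derivation[OF \<psi>(1,3)]
  have t: "t = trace_of (es_grammar S) (std_derivation {} (map pname (steps \<psi>)))"
    using trace_equiv_step(1)[OF a(2)] \<psi>(2) trace_of_eq_iff by metis
  then show ?thesis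
    using that[OF a(1) t] fired_of_trace_of fired_std_derivation by metis
qed

lemma std_start_trace:
  assumes "fire_seq {} es"
  shows "trace_of (es_grammar S) (std_derivation {} es) \<in> start_traces (es_grammar S)"
  using decorated_std_derivation[OF assms] unfolding start_traces_def
  by (auto simp: es_start_graph_eq)

lemma start_trace_eq:
  assumes "t \<in> start_traces (es_grammar S)" "t' \<in> start_traces (es_grammar S)" "fired_of t = fired_of t'"
  shows "t = t'"
proof -
  obtain es es' where "fire_seq {} es" "t = trace_of (es_grammar S) (std_derivation {} es)" "fired_of t = set es"
    "fire_seq {} es'" "t' = trace_of (es_grammar S) (std_derivation {} es')" "fired_of t' = set es'"
    using start_trace_cases[OF assms(1)] start_trace_cases[OF assms(2)] by metis
  then show ?thesis
    using trace_equiv_same_events[of "[]" es es'] assms(3) by (simp add: trace_of_eq_iff)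
qed

end

section \<open>Start traces as finite configurations\<close>

context live_connected_es
begin

text \<open>The demands of the rule match up one by one: \<open>NI e\<close> is available iff
  \<open>e\<close> has not fired, the conflict nodes ask that no conflicting event has, and
  readiness means that a minimal enabling lies in \<open>A\<close>, which for a configuration
  \<open>A\<close> is the same as enabling.\<close>

lemma fires_iff:
  assumes A: "configuration S A" "finite A"
  shows "fires A e \<longleftrightarrow> e \<notin> A \<and> enables S A e \<and> es_consistent S (insert e A)"
proof
  assume f: "fires A e"
  then have e: "e \<in> events S" and "ready A e" and c: "consumed e \<subseteq> resources A"
    by (auto simp: fires_def)
  then obtain M where "min_enables S M e" "M \<subseteq> A"
    using choices_hit_iff[OF e] unfolding ready_def by blast
  then have "enables S A e"
    using enables_mono[of M e A] min_enablesD(2) A configurationD(1) by blast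
  moreover have "\<not> conflict S e a" if "a \<in> A" for a
  proof
    assume "conflict S e a"
    then have "NC {e, a} \<in> resources A"
      using c by (auto simp: consumed_def)
    then show False
      using that by (auto simp: resources_def doubleton_eq_iff)
  qed
  then have "es_consistent S (insert e A)"
    using configurationD(3)[OF A(1)] e conflict_sym conflict_irrefl unfolding es_consistent_def by blast
  ultimately show "e \<notin> A \<and> enables S A e \<and> es_consistent S (insert e A)"
    using fires_not_mem[OF f] by simp
next
  assume *: "e \<notin> A \<and> enables S A e \<and> es_consistent S (insert e A)"
  then have e: "e \<in> events S"
    using enables_events by blast
  obtain M where "min_enables S M e" "M \<subseteq> A"
    using min_enables_exists[OF A(1)] * by blast
  then have "ready A e"
    using choices_hit_iff[OF e] unfolding ready_def by blast
  moreover have "e' \<notin> A" if "conflict S e e'" for e'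
    using * that by (auto simp: es_consistent_def)
  then have "consumed e \<subseteq> resources A"
    using * e unfolding consumed_def resources_def by blast
  ultimately show "fires A e"
    using e by (simp add: fires_def)
qed

lemma fire_seq_configuration:
  "fire_seq A es \<Longrightarrow> configuration S A \<Longrightarrow> finite A \<Longrightarrow> configuration S (A \<union> set es)"
proof (induction es arbitrary: A)
  case (Cons e es)
  then have "configuration S (insert e A)"
    using fires_iff[of A e] configuration_insert by simp
  then show ?case
    using Cons.IH[of "insert e A"] Cons.prems by simp
qed simp

text \<open>\<open>configuration_subset_enables\<close> supplies the next event of \<open>C\<close>,
  and consistency is inherited from \<open>C\<close>; the measure is the number of missing
  events.\<close>

lemma fire_seq_exists:
  assumes "configuration S A" "configuration S C" "finite C" "A \<subseteq> C"
  shows "\<exists>es. fire_seq A es \<and> A \<union> set es = C"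
  using assms
proof (induction "card (C - A)" arbitrary: A rule: less_induct)
  case less
  have fin: "finite A"
    using less.prems finite_subset by blast
  show ?case
  proof (cases "A = C")
    case True
    then show ?thesis by (intro exI[of _ "[]"]) simp
  next
    case False
    then obtain x where "x \<in> C" "x \<notin> A"
      using less.prems(4) by blast
    then obtain e where e: "e \<in> C" "e \<notin> A" "enables S A e"
      using configuration_subset_enables[OF less.prems(1) fin less.prems(2)] by blast
    have c: "es_consistent S (insert e A)"
      by (rule es_consistent_subset[OF configurationD(3)[OF less.prems(2)]]) (use e less.prems in auto)
    have "card (C - insert e A) < card (C - A)"
      using e less.prems(3) by (intro psubset_card_mono) auto
    then obtain es where "fire_seq (insert e A) es \<and> insert e A \<union> set es = C"
      using less.hyps[of "insert e A"] configuration_insert[OF less.prems(1) e(3) c] less.prems e by auto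
    then show ?thesis
      using fires_iff[OF less.prems(1) fin] e c by (intro exI[of _ "e # es"]) auto
  qed
qed

lemma start_trace_configuration:
  assumes "t \<in> start_traces (es_grammar S)"
  shows "configuration S (fired_of t)" "finite (fired_of t)"
proof -
  obtain es where "fire_seq {} es" "fired_of t = set es"
    using start_trace_cases[OF assms] by metis
  then show "configuration S (fired_of t)" "finite (fired_of t)"
    using fire_seq_configuration[of "{}" es] by simp_all
qed

lemma configuration_start_trace:
  assumes "configuration S C" "finite C"
  obtains t where "t \<in> start_traces (es_grammar S)" "fired_of t = C"
proof -
  obtain es where "fire_seq {} es" "set es = C"
    using fire_seq_exists[OF configuration_empty assms] by auto
  then show ?thesis
    using that std_start_trace fired_of_trace_of fired_std_derivation by metis
qed

text \<open>Composition only adds events. Conversely, \<open>es\<close> is continued by a firing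
  sequence up to \<open>fired_of t'\<close>, and the composite must represent \<open>t'\<close>
  because a start trace is determined by its events.\<close>

lemma trace_le_iff:
  assumes t: "t \<in> start_traces (es_grammar S)" and t': "t' \<in> start_traces (es_grammar S)"
  shows "trace_le (es_grammar S) t t' \<longleftrightarrow> fired_of t \<subseteq> fired_of t'"
proof
  assume "trace_le (es_grammar S) t t'"
  then obtain \<psi> \<psi>' \<psi>'' where *: "\<psi> \<in> t" "\<psi>' \<in> t'" "trace_equiv (es_grammar S) (dcomp (es_grammar S) \<psi> \<psi>'') \<psi>'"
    unfolding trace_le_def by blast
  have f: "fired \<chi> = fired_of r" if "\<chi> \<in> r" and r: "r \<in> start_traces (es_grammar S)" for \<chi> r
  proof -
    obtain \<xi> where "r = trace_of (es_grammar S) \<xi>"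
      using r by (auto simp: start_traces_def)
    then show ?thesis
      using that(1) trace_equiv_fired[of "es_grammar S" \<xi> \<chi>] fired_of_trace_of[of "es_grammar S" \<xi>]
      by (simp add: trace_of_def)
  qed
  show "fired_of t \<subseteq> fired_of t'"
    using trace_equiv_fired[OF *(3)] f[OF *(1) t] f[OF *(2) t'] by (auto simp: fired_dcomp)
next
  assume sub: "fired_of t \<subseteq> fired_of t'"
  let ?\<G> = "es_grammar S"
  obtain es where es: "fire_seq {} es" "t = trace_of ?\<G> (std_derivation {} es)" "fired_of t = set es"
    using start_trace_cases[OF t] by metis
  obtain fs where fs: "fire_seq (set es) fs" "set es \<union> set fs = fired_of t'"
    using fire_seq_exists[OF start_trace_configuration(1)[OF t] start_trace_configuration[OF t'] sub] es(3) by metis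
  let ?\<psi> = "std_derivation {} es" and ?\<psi>'' = "std_derivation (set es) fs"
  have d: "decorated_derivation ?\<G> ?\<psi>" "decorated_derivation ?\<G> ?\<psi>''"
    using decorated_std_derivation es(1) fs(1) by auto
  have eq: "dtarget ?\<G> ?\<psi> = dsource ?\<G> ?\<psi>''"
    by simp
  let ?\<chi> = "dcomp ?\<G> ?\<psi> ?\<psi>''"
  have "trace_of ?\<G> ?\<chi> \<in> start_traces ?\<G>"
    unfolding start_traces_def using decorated_dcomp[OF d eq] by (auto simp: es_start_graph_eq)
  moreover have "fired_of (trace_of ?\<G> ?\<chi>) = fired_of t'"
    using fs(2) by (simp add: fired_of_trace_of fired_dcomp)
  ultimately have "trace_of ?\<G> ?\<chi> = t'"
    using start_trace_eq t' by blast
  then have "?\<chi> \<in> t'" "?\<psi> \<in> t"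
    using trace_equiv_refl[of ?\<G> ?\<chi>] trace_equiv_refl[of ?\<G> ?\<psi>] es(2) by (auto simp: trace_of_def)
  then show "trace_le ?\<G> t t'"
    unfolding trace_le_def using d(2) eq trace_equiv_refl by blast
qed

section \<open>Ideals of traces as configurations\<close>

definition ideal_configuration :: "('e gnode, 'e gedge, 'e tnode, 'e tedge, 'e) trace set \<Rightarrow> 'e set" where
  "ideal_configuration I = \<Union>(fired_of ` I)"

lemma DomD:
  assumes "I \<in> Dom (es_grammar S)"
  shows "I \<subseteq> start_traces (es_grammar S)" "I \<noteq> {}"
    "\<And>t t'. t \<in> I \<Longrightarrow> t' \<in> start_traces (es_grammar S) \<Longrightarrow> fired_of t' \<subseteq> fired_of t \<Longrightarrow> t' \<in> I"
    "\<And>t t'. t \<in> I \<Longrightarrow> t' \<in> I \<Longrightarrow> \<exists>t''\<in>I. fired_of t \<union> fired_of t' \<subseteq> fired_of t''"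
proof -
  show sub: "I \<subseteq> start_traces (es_grammar S)" and "I \<noteq> {}"
    using assms by (auto simp: Dom_def)
  show "t' \<in> I" if "t \<in> I" "t' \<in> start_traces (es_grammar S)" "fired_of t' \<subseteq> fired_of t" for t t'
    using assms that sub trace_le_iff[of t' t] unfolding Dom_def by blast
  show "\<exists>t''\<in>I. fired_of t \<union> fired_of t' \<subseteq> fired_of t''" if tt: "t \<in> I" "t' \<in> I" for t t'
  proof -
    obtain t'' where "t'' \<in> I" "trace_le (es_grammar S) t t''" "trace_le (es_grammar S) t' t''"
      using assms tt unfolding Dom_def by blast
    then show ?thesis
      using trace_le_iff[of t t''] trace_le_iff[of t' t''] sub tt by blast
  qed
qed

lemma ideal_finite_subset:
  assumes I: "I \<in> Dom (es_grammar S)" and "finite F" "F \<subseteq> ideal_configuration I"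
  shows "\<exists>t\<in>I. F \<subseteq> fired_of t"
  using assms(2,3)
proof (induction F rule: finite_induct)
  case empty
  then show ?case using DomD(2)[OF I] by auto
next
  case (insert a F)
  then obtain t t' where t: "t \<in> I" "F \<subseteq> fired_of t" "t' \<in> I" "a \<in> fired_of t'"
    by (auto simp: ideal_configuration_def)
  then obtain t'' where "t'' \<in> I" "fired_of t \<union> fired_of t' \<subseteq> fired_of t''"
    using DomD(4)[OF I] by blast
  then show ?case
    using t by (intro bexI[of _ t'']) auto
qed

lemma configuration_ideal:
  assumes I: "I \<in> Dom (es_grammar S)"
  shows "configuration S (ideal_configuration I)"
  unfolding ideal_configuration_def
proof (rule configuration_Union)
  show "configuration S C" if "C \<in> fired_of ` I" for C
    using that DomD(1)[OF I] start_trace_configuration(1) by blast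
  show "es_consistent S (\<Union>(fired_of ` I))"
    unfolding es_consistent_def
  proof (intro conjI ballI)
    show "\<Union>(fired_of ` I) \<subseteq> events S"
      using DomD(1)[OF I] start_trace_configuration(1) configurationD(1) by blast
    fix x y assume "x \<in> \<Union>(fired_of ` I)" "y \<in> \<Union>(fired_of ` I)"
    \<comment> \<open>Conflict is binary, so a single trace that fires both events is
      enough.\<close>
    then obtain t where "t \<in> I" "{x, y} \<subseteq> fired_of t"
      using ideal_finite_subset[OF I, of "{x, y}"] by (auto simp: ideal_configuration_def)
    then show "\<not> conflict S x y"
      using DomD(1)[OF I] start_trace_configuration(1)[of t] configurationD(2)[of "fired_of t" x y] by auto
  qed
qed

text \<open>A trace in \<open>I\<close> fires finitely many events, so directedness puts them below
  a single member of \<open>J\<close>, and downward closure brings the trace into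
  \<open>J\<close>.\<close>

lemma ideal_le_iff:
  assumes I: "I \<in> Dom (es_grammar S)" and J: "J \<in> Dom (es_grammar S)"
  shows "I \<subseteq> J \<longleftrightarrow> ideal_configuration I \<subseteq> ideal_configuration J"
proof
  assume sub: "ideal_configuration I \<subseteq> ideal_configuration J"
  show "I \<subseteq> J"
  proof
    fix t assume t: "t \<in> I"
    then have st: "t \<in> start_traces (es_grammar S)"
      using DomD(1)[OF I] by blast
    have "fired_of t \<subseteq> ideal_configuration J"
      using sub t by (auto simp: ideal_configuration_def)
    then obtain t' where "t' \<in> J" "fired_of t \<subseteq> fired_of t'"
      using ideal_finite_subset[OF J start_trace_configuration(2)[OF st]] by blast
    then show "t \<in> J"
      using DomD(3)[OF J] st by blast
  qed
qed (auto simp: ideal_configuration_def)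

text \<open>An arbitrary configuration is exhausted by finite ones, as each event \<open>e\<close>
  lies in some finite \<open>insert e M\<close> inside it. Two finite ones inside \<open>C\<close>
  have a consistent union because \<open>C\<close> is consistent, which gives directedness.\<close>

lemma ideal_of_configuration:
  assumes C: "configuration S C"
  defines "I \<equiv> {t \<in> start_traces (es_grammar S). fired_of t \<subseteq> C}"
  shows "I \<in> Dom (es_grammar S)" "ideal_configuration I = C"
proof -
  have get: "\<exists>t\<in>I. fired_of t = B" if "configuration S B" "finite B" "B \<subseteq> C" for B
  proof -
    obtain t where "t \<in> start_traces (es_grammar S)" "fired_of t = B"
      using configuration_start_trace[OF \<open>configuration S B\<close> \<open>finite B\<close>] by blast
    then show ?thesis
      using that(3) by (auto simp: I_def)
  qed
  show "I \<in> Dom (es_grammar S)"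
    unfolding Dom_def mem_Collect_eq
  proof (intro conjI ballI impI)
    show "I \<subseteq> start_traces (es_grammar S)"
      by (auto simp: I_def)
    show "I \<noteq> {}"
      using get[of "{}"] by auto
    show "t' \<in> I" if "t \<in> I" "t' \<in> start_traces (es_grammar S)" "trace_le (es_grammar S) t' t" for t t'
      using that trace_le_iff[of t' t] by (auto simp: I_def)
    show "\<exists>t''\<in>I. trace_le (es_grammar S) t t'' \<and> trace_le (es_grammar S) t' t''"
      if tt: "t \<in> I" "t' \<in> I" for t t'
    proof -
      have st: "t \<in> start_traces (es_grammar S)" "t' \<in> start_traces (es_grammar S)"
        and sub: "fired_of t \<union> fired_of t' \<subseteq> C"
        using tt by (auto simp: I_def)
      have "configuration S (fired_of t \<union> fired_of t')"
        by (rule configuration_Un[OF start_trace_configuration(1)[OF st(1)] start_trace_configuration(1)[OF st(2)]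
              es_consistent_subset[OF configurationD(3)[OF C] sub]])
      then obtain t'' where t'': "t'' \<in> I" "fired_of t'' = fired_of t \<union> fired_of t'"
        using get sub start_trace_configuration(2)[OF st(1)] start_trace_configuration(2)[OF st(2)] by blast
      then have "t'' \<in> start_traces (es_grammar S)"
        by (simp add: I_def)
      then show ?thesis
        using t'' trace_le_iff[OF st(1)] trace_le_iff[OF st(2)] by (intro bexI[of _ t'']) auto
    qed
  qed
  show "ideal_configuration I = C"
  proof
    show "ideal_configuration I \<subseteq> C"
      by (auto simp: ideal_configuration_def I_def)
    show "C \<subseteq> ideal_configuration I"
    proof
      fix e assume e: "e \<in> C"
      obtain M where M: "min_enables S M e" "M \<subseteq> C - {e}"
        using configuration_min_enables[OF C e] by blast
      have "finite (insert e M)" "insert e M \<subseteq> C"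
        using M e min_enablesD(3) by auto
      then obtain t where "t \<in> I" "fired_of t = insert e M"
        using get[OF min_enables_configuration[OF M(1)]] by blast
      then show "e \<in> ideal_configuration I"
        by (auto simp: ideal_configuration_def)
    qed
  qed
qed

lemma bij_ideal_configuration:
  "bij_betw ideal_configuration (Dom (es_grammar S)) {C. configuration S C}"
  unfolding bij_betw_def
proof
  show "inj_on ideal_configuration (Dom (es_grammar S))"
  proof (rule inj_onI)
    fix I J assume "I \<in> Dom (es_grammar S)" "J \<in> Dom (es_grammar S)"
      "ideal_configuration I = ideal_configuration J"
    then show "I = J"
      using ideal_le_iff[of I J] ideal_le_iff[of J I] by auto
  qed
  have "C \<in> ideal_configuration ` Dom (es_grammar S)" if "configuration S C" for C
    using ideal_of_configuration(2)[OF that, symmetric] ideal_of_configuration(1)[OF that] by (rule image_eqI)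
  then show "ideal_configuration ` Dom (es_grammar S) = {C. configuration S C}"
    using configuration_ideal by blast
qed

end

theorem mainTheorem4:
  fixes S :: "'e es"
  assumes "event_structure S" and "live S" and "connected_es S"
  shows "es_isomorphic S (es_of_domain (Dom (es_grammar S)))"
proof -
  interpret live_connected_es S
    by unfold_locales (fact assms)+
  interpret configuration_domain S "Dom (es_grammar S)" ideal_configuration
    by unfold_locales (use bij_ideal_configuration ideal_le_iff in auto)
  show ?thesis
    by (rule es_isomorphic_es_of_domain)
qed

end
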